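(* Let $\mathcal{M}$ be a connected Riemannian manifold, $R:T\mathcal{M}\to\mathcal{M}$ a retraction, $F:\mathcal{M}\to\mathbb{R}$ a $C^1$ function, $K$ a compact subset of $\mathcal{M}$, and $A>0$ a constant such that $\nabla F$ is $R$-Lipschitz on $K$ up to radius $A$. Let $(\Omega,\mathcal{F},\mu)$ be a probability space and $H:\mathcal{M}\times\Omega\to T\mathcal{M}$ a function such that: (a) for every $\omega\in\Omega$, $H(\bullet,\omega)$ is a tangent vector field on $\mathcal{M}$; (b) either $\Omega$ is a finite set and $\mathcal{F}$ consists of all subsets of $\Omega$, or $H:(\mathcal{M}\times\Omega,\mathcal{B}_{\mathcal{M}}\otimes\mathcal{F})\to(T\mathcal{M},\mathcal{B}_{T\mathcal{M}})$ is measurable; (c) $\int_\Omega H(x,\omega)\,d\mu=\nabla F(x)$ for every $x\in\mathcal{M}$; (d) $\|H(x,\omega)\|_x\le A$ for all $x\in K$ and $\omega\in\Omega$. Let $\{\omega_t\}_{t=0}^\infty$ be a sequence of independent random variables, each taking values in $\Omega$ with probability distribution $\mu$, and let $\{S_t\}_{t=0}^\infty$ be a strictly increasing sequence of integers with $S_0=0$. 1. Let $\{\gamma_t\}_{t=0}^\infty$ be a sequence of positive numbers with $\sum_{t=0}^\infty\gamma_t^2<\infty$, $\sum_{t=0}^\infty\gamma_t=\infty$ and $\gamma_t\le 1$ for all $t\ge0$. Let $x_0$ be a fixed point in $K$ and let $\{x_t\}_{t=0}^\infty\subset\mathcal{M}$ be generated by $$x_{t+1}=R_{x_t}\left(-\frac{\gamma_t}{S_{t+1}-S_t}\sum_{j=S_t}^{S_{t+1}-1}H(x_t,\omega_j)\right)\quad\text{for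 } t\ge0.$$ If $\{x_t\}_{t=0}^\infty\subset K$, then $F(x_t)$ converges almost surely and $\|\nabla F(x_t)\|_{x_t}\to0$ both almost surely and in mean square. 2. Let $x_0$ be a fixed point in $K$ and let $\alpha,\beta,\varepsilon$ be fixed positive numbers with $0<\varepsilon\le\frac12$ and $0<\alpha\le\beta^{\frac12+\varepsilon}$. Let $\{x_t\}_{t=0}^\infty\subset\mathcal{M}$ and $\{\eta_t\}_{t=0}^\infty$ be generated by $$x_{t+1}=R_{x_t}\left(-\frac{\eta_t}{S_{t+1}-S_t}\sum_{j=S_t}^{S_{t+1}-1}H(x_t,\omega_j)\right),\qquad \eta_t=\frac{\alpha}{\left(\beta+\sum_{k=0}^{t-1}\left\|\frac{1}{S_{k+1}-S_k}\sum_{j=S_k}^{S_{k+1}-1}H(x_k,\omega_j)\right\|_{x_k}^2\right)^{\frac12+\varepsilon}}\quad\text{for } t\ge0.$$ If $\{x_t\}_{t=0}^\infty\subset K$, then $F(x_t)$ converges almost surely and $\|\nabla F(x_t)\|_{x_t}\to0$ almost surely.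
   Context: Retraction: a $C^2$ map $R:T\mathcal{M}\to\mathcal{M}$ such that for every $x\in\mathcal{M}$ the restriction $R_x=R|_{T_x\mathcal{M}}$ satisfies $R_x(\mathbf{0}_x)=x$ and $dR_x(\mathbf{0}_x)=\mathrm{id}_{T_x\mathcal{M}}$ (under the standard identification $T_{\mathbf{0}_x}T_x\mathcal{M}\cong T_x\mathcal{M}$). $\langle\cdot,\cdot\rangle_x$ and $\|\cdot\|_x$ are the Riemannian inner product and norm on $T_x\mathcal{M}$; $\nabla F$ is the Riemannian gradient. For $x\in\mathcal{M}$, $\mathbf{u}\in T_x\mathcal{M}$, identify $T_{\mathbf{u}}(T_x\mathcal{M})$ with $T_x\mathcal{M}$, so that $dR_x|_{\mathbf{u}}:T_x\mathcal{M}\to T_{R_x(\mathbf{u})}\mathcal{M}$ is linear, and let $\mathrm{adj}(dR_x|_{\mathbf{u}}):T_{R_x(\mathbf{u})}\mathcal{M}\to T_x\mathcal{M}$ be its adjoint: $\langle\mathbf{v},\mathrm{adj}(dR_x|_{\mathbf{u}})(\mathbf{w})\rangle_x=\langle dR_x|_{\mathbf{u}}(\mathbf{v}),\mathbf{w}\rangle_{R_x(\mathbf{u})}$ for all $\mathbf{v},\mathbf{w}$. $R$-Lipschitz: for a subset $K\subset\mathcal{M}$ and $r>0$, a vector field $\mathbf{v}$ on $\mathcal{M}$ is $R$-Lipschitz on $K$ up to radius $r$ if there is a constant $C>0$ (depending on $K$ and $r$) such that $\|\mathrm{adj}(dR_x|_{\mathbf{u}})(\mathbf{v}(R_x(\mathbf{u})))-\mathbf{v}(x)\|_x\le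 C\|\mathbf{u}\|_x$ for all $x\in K$ and $\mathbf{u}\in T_x\mathcal{M}$ with $\|\mathbf{u}\|_x\le r$. $\mathcal{B}_{\mathcal{M}}$ and $\mathcal{B}_{T\mathcal{M}}$ are the Borel $\sigma$-algebras of $\mathcal{M}$ and $T\mathcal{M}$; $\otimes$ denotes the product $\sigma$-algebra. An empty sum is $0$. "$\|\nabla F(x_t)\|_{x_t}\to0$ in mean square" means $\mathbb{E}(\|\nabla F(x_t)\|_{x_t}^2)\to0$. *)

theory Defs
  imports "HOL-Probability.Probability"
begin

section \<open>Model spaces\<close>

text \<open>
  Manifolds are modelled on an arbitrary finite-dimensional inner product space. The class
  \<^class>\<open>euclidean_space\<close> is not used because it excludes dimension zero. The inner product of
  the model space only serves to fix its standard topology.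
\<close>

class findim_inner = real_inner +
  assumes finite_spanning_set:
    "\<exists>B. finite B \<and> (\<forall>x. \<exists>c :: 'a \<Rightarrow> real. x = (\<Sum>b\<in>B. c b *\<^sub>R b))"

instance euclidean_space \<subseteq> findim_inner
proof
  show "\<exists>B. finite B \<and> (\<forall>x. \<exists>c :: 'a \<Rightarrow> real. x = (\<Sum>b\<in>B. c b *\<^sub>R b))"
    by (metis euclidean_representation finite_Basis)
qed

lemma findim_orthonormal_basis:
  obtains B :: "'a::findim_inner set" where "finite B" "\<And>b. b \<in> B \<Longrightarrow> norm b = 1"
    "pairwise orthogonal B" "\<And>x. (\<Sum>b\<in>B. (x \<bullet> b) *\<^sub>R b) = x"
proof -
  obtain B0 :: "'a set" where B0: "finite B0" "\<And>x. \<exists>c :: 'a \<Rightarrow> real. x = (\<Sum>b\<in>B0. c b *\<^sub>R b)"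
    using finite_spanning_set by blast
  have sp0: "span B0 = UNIV"
  proof (intro set_eqI iffI UNIV_I)
    fix x :: 'a
    obtain c where "x = (\<Sum>b\<in>B0. c b *\<^sub>R b)" using B0(2) by blast
    then show "x \<in> span B0" by (simp only:) (intro span_sum span_scale span_base)
  qed
  obtain C where C: "finite C" "span C = span B0" "pairwise orthogonal C"
    using basis_orthogonal[OF B0(1)] by blast
  define B where "B = (\<lambda>c. c /\<^sub>R norm c) ` (C - {0})"
  have fin: "finite B" using C by (simp add: B_def)
  have nrm: "norm b = 1" if b: "b \<in> B" for b
  proof -
    obtain c where "b = c /\<^sub>R norm c" "c \<noteq> 0" using b unfolding B_def by blast
    then show ?thesis by simp
  qed
  have orth: "pairwise orthogonal B"
    using C(3) by (auto simp: B_def pairwise_def orthogonal_def)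
  have "C \<subseteq> span B"
  proof
    fix c assume "c \<in> C"
    show "c \<in> span B"
    proof (cases "c = 0")
      case False
      then have "c /\<^sub>R norm c \<in> B" using \<open>c \<in> C\<close> unfolding B_def by blast
      then have "norm c *\<^sub>R (c /\<^sub>R norm c) \<in> span B" by (intro span_scale span_base)
      then show ?thesis using False by simp
    qed (simp add: span_zero)
  qed
  then have spB: "span B = UNIV" using span_mono[of C "span B"] C(2) sp0 by (simp add: top.extremum_unique span_span)
  have expand: "(\<Sum>b\<in>B. (x \<bullet> b) *\<^sub>R b) = x" for x
  proof -
    obtain u where u: "x = (\<Sum>b\<in>B. u b *\<^sub>R b)"
      using UNIV_I[of x] unfolding spB[symmetric] span_finite[OF fin] by (rule imageE) blast
    have "x \<bullet> b = u b" if b: "b \<in> B" for b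
    proof -
      have "x \<bullet> b = (\<Sum>c\<in>B. u c * (c \<bullet> b))" by (subst u) (simp add: inner_sum_left)
      also have "\<dots> = (\<Sum>c\<in>B. if c = b then u b else 0)"
        using orth b nrm[OF b]
        by (intro sum.cong refl) (auto simp: pairwise_def orthogonal_def norm_eq_1)
      also have "\<dots> = u b" using fin b by simp
      finally show ?thesis .
    qed
    then have "(\<Sum>b\<in>B. (x \<bullet> b) *\<^sub>R b) = (\<Sum>b\<in>B. u b *\<^sub>R b)" by (intro sum.cong) auto
    then show ?thesis using u by (rule trans[OF _ sym])
  qed
  show thesis using that fin nrm orth expand by blast
qed

instance findim_inner \<subseteq> heine_borel
proof
  fix f :: "nat \<Rightarrow> 'a"
  assume f: "bounded (range f)"
  obtain B :: "'a set" where B: "finite B" "\<And>b. b \<in> B \<Longrightarrow> norm b = 1"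
    "\<And>x. (\<Sum>b\<in>B. (x \<bullet> b) *\<^sub>R b) = x"
    using findim_orthonormal_basis by metis
  have "\<exists>r l. strict_mono (r :: nat \<Rightarrow> nat) \<and> (\<forall>b\<in>D. (\<lambda>n. f (r n) \<bullet> b) \<longlonglongrightarrow> l b)"
    if "finite D" for D
    using that
  proof (induction D)
    case empty
    show ?case by (intro exI[of _ id]) (auto simp: strict_mono_def)
  next
    case (insert a D)
    then obtain r l where r: "strict_mono (r :: nat \<Rightarrow> nat)"
      and l: "\<And>b. b \<in> D \<Longrightarrow> (\<lambda>n. f (r n) \<bullet> b) \<longlonglongrightarrow> l b" by blast
    have "bounded (range (\<lambda>n. f (r n) \<bullet> a))"
      by (rule bounded_subset[OF bounded_linear_image[OF f bounded_linear_inner_left[of a]]]) auto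
    then obtain s la where s: "strict_mono (s :: nat \<Rightarrow> nat)"
      and la: "(\<lambda>n. f (r (s n)) \<bullet> a) \<longlonglongrightarrow> la"
      using bounded_imp_convergent_subsequence[of "\<lambda>n. f (r n) \<bullet> a"] by (auto simp: o_def)
    have "(\<lambda>n. f (r (s n)) \<bullet> b) \<longlonglongrightarrow> l b" if "b \<in> D" for b
      using LIMSEQ_subseq_LIMSEQ[OF l[OF that] s] by (simp add: o_def)
    then show ?case using la insert.hyps
      by (intro exI[of _ "r \<circ> s"] exI[of _ "l(a := la)"]) (use strict_mono_o[OF r s] in \<open>auto simp: o_def\<close>)
  qed
  then obtain r l where r: "strict_mono (r :: nat \<Rightarrow> nat)"
    and l: "\<And>b. b \<in> B \<Longrightarrow> (\<lambda>n. f (r n) \<bullet> b) \<longlonglongrightarrow> l b" using B(1) by metis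
  have "(\<lambda>n. \<Sum>b\<in>B. (f (r n) \<bullet> b) *\<^sub>R b) \<longlonglongrightarrow> (\<Sum>b\<in>B. l b *\<^sub>R b)"
    by (intro tendsto_intros l)
  then show "\<exists>l r. strict_mono (r :: nat \<Rightarrow> nat) \<and> (f \<circ> r) \<longlonglongrightarrow> l"
    using r by (auto simp: B(3) o_def)
qed

instance findim_inner \<subseteq> banach ..

instance findim_inner \<subseteq> second_countable_topology
proof
  obtain B :: "'a set" where B: "finite B" "\<And>b. b \<in> B \<Longrightarrow> norm b = 1"
    "\<And>x. (\<Sum>b\<in>B. (x \<bullet> b) *\<^sub>R b) = x"
    using findim_orthonormal_basis by metis
  define D where "D = (\<lambda>q. \<Sum>b\<in>B. q b *\<^sub>R b) ` (B \<rightarrow>\<^sub>E \<rat>)"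
  have cD: "countable D"
    unfolding D_def by (intro countable_image countable_PiE B countable_rat)
  have dense: "\<exists>d\<in>D. dist d x < e" if "e > 0" for x e
  proof -
    have e': "e / (card B + 1) > 0" using that by simp
    have "\<exists>q. q \<in> \<rat> \<and> \<bar>q - x \<bullet> b\<bar> < e / (card B + 1)" for b
      using Rats_dense_in_real[of "x \<bullet> b - e / (card B + 1)" "x \<bullet> b"] e'
      by (force simp: abs_if)
    then obtain q where q: "\<And>b. q b \<in> \<rat>" "\<And>b. \<bar>q b - x \<bullet> b\<bar> < e / (card B + 1)" by metis
    have "norm ((\<Sum>b\<in>B. q b *\<^sub>R b) - x) = norm (\<Sum>b\<in>B. (q b - x \<bullet> b) *\<^sub>R b)"
      by (subst B(3)[of x, symmetric]) (simp add: sum_subtractf scaleR_left_diff_distrib B(3))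
    also have "\<dots> \<le> (\<Sum>b\<in>B. e / (card B + 1))"
      using q(2) B(2) by (intro sum_norm_le) (auto intro: less_imp_le)
    also have "\<dots> < e" using that by (simp add: field_simps)
    finally have "dist (\<Sum>b\<in>B. restrict q B b *\<^sub>R b) x < e"
      by (simp add: dist_norm)
    moreover have "(\<Sum>b\<in>B. restrict q B b *\<^sub>R b) \<in> D"
      unfolding D_def using q(1) by (intro imageI) auto
    ultimately show ?thesis by blast
  qed
  define \<B> where "\<B> = (\<lambda>(d, n). ball d (1 / real (Suc n))) ` (D \<times> UNIV)"
  have "topological_basis \<B>"
  proof (rule topological_basisI)
    fix O' and x :: 'a assume "open O'" "x \<in> O'"
    then obtain e where e: "e > 0" "ball x e \<subseteq> O'" using open_contains_ball by blast
    obtain n where n: "1 / real (Suc n) < e / 2"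
      using nat_approx_posE[of "e / 2"] e by auto
    obtain d where d: "d \<in> D" "dist d x < 1 / real (Suc n)"
      using dense[of "1 / real (Suc n)" x] by auto
    have "ball d (1 / real (Suc n)) \<subseteq> ball x e"
    proof
      fix y assume "y \<in> ball d (1 / real (Suc n))"
      then have "dist x y \<le> dist d x + dist d y" "dist d y < 1 / real (Suc n)"
        by (auto simp: dist_triangle3)
      then show "y \<in> ball x e" using d n by simp
    qed
    then show "\<exists>B'\<in>\<B>. x \<in> B' \<and> B' \<subseteq> O'"
      using d e by (intro bexI[of _ "ball d (1 / real (Suc n))"]) (auto simp: \<B>_def)
  qed (auto simp: \<B>_def)
  moreover have "countable \<B>" unfolding \<B>_def using cD by auto
  ultimately show "\<exists>B :: 'a set set. countable B \<and> open = generate_topology B"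
    using topological_basis_imp_subbasis by blast
qed

section \<open>Smooth manifolds\<close>

text \<open>
  \<open>Ck_on k S f\<close>: all iterated directional derivatives of \<open>f\<close> up to order \<open>k\<close> exist (as values of
  Frechet derivatives) and are continuous on \<open>S\<close>. For open \<open>S\<close> in a finite-dimensional space this
  is the usual class \<open>C\<^sup>k\<close>; it is only used in this situation.
\<close>

primrec Ck_on :: "nat \<Rightarrow> 'a::real_normed_vector set \<Rightarrow> ('a \<Rightarrow> 'b::real_normed_vector) \<Rightarrow> bool" where
  "Ck_on 0 S f \<longleftrightarrow> continuous_on S f"
| "Ck_on (Suc k) S f \<longleftrightarrow>
    (\<forall>x\<in>S. f differentiable (at x)) \<and> (\<forall>v. Ck_on k S (\<lambda>x. frechet_derivative f (at x) v))"

definition smooth_on :: "'a::real_normed_vector set \<Rightarrow> ('a \<Rightarrow> 'b::real_normed_vector) \<Rightarrow> bool" where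
  "smooth_on S f \<longleftrightarrow> (\<forall>k. Ck_on k S f)"

text \<open>A chart is a pair of its domain and a coordinate map, whose values off the domain are irrelevant.\<close>

type_synonym ('m, 'e) chart = "'m set \<times> ('m \<Rightarrow> 'e)"

abbreviation chart_dom :: "('m, 'e) chart \<Rightarrow> 'm set" where
  "chart_dom \<equiv> fst"

abbreviation chart_map :: "('m, 'e) chart \<Rightarrow> 'm \<Rightarrow> 'e" where
  "chart_map \<equiv> snd"

definition chart_inv :: "('m, 'e) chart \<Rightarrow> 'e \<Rightarrow> 'm" where
  "chart_inv c = inv_into (chart_dom c) (chart_map c)"

locale smooth_manifold =
  fixes \<A> :: "('m::{t2_space, second_countable_topology}, 'e::findim_inner) chart set"
  assumes open_chart_dom: "c \<in> \<A> \<Longrightarrow> open (chart_dom c)"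
    and open_chart_range: "c \<in> \<A> \<Longrightarrow> open (chart_map c ` chart_dom c)"
    and chart_homeomorphism:
      "c \<in> \<A> \<Longrightarrow> homeomorphism (chart_dom c) (chart_map c ` chart_dom c) (chart_map c) (chart_inv c)"
    and charts_cover: "(\<Union>c\<in>\<A>. chart_dom c) = UNIV"
    and charts_compatible:
      "c \<in> \<A> \<Longrightarrow> d \<in> \<A> \<Longrightarrow>
        smooth_on (chart_map c ` (chart_dom c \<inter> chart_dom d)) (chart_map d \<circ> chart_inv c)"

text \<open>Maps of class \<open>C\<^sup>k\<close> between manifolds given by atlases; the openness condition is continuity.\<close>

definition Ck_map ::
  "nat \<Rightarrow> ('m, 'e::real_normed_vector) chart set \<Rightarrow> ('n, 'f::real_normed_vector) chart set
    \<Rightarrow> ('m \<Rightarrow> 'n) \<Rightarrow> bool" where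
  "Ck_map k \<A> \<B> f \<longleftrightarrow> (\<forall>c\<in>\<A>. \<forall>d\<in>\<B>.
     open (chart_map c ` (chart_dom c \<inter> f -` chart_dom d)) \<and>
     Ck_on k (chart_map c ` (chart_dom c \<inter> f -` chart_dom d)) (chart_map d \<circ> f \<circ> chart_inv c))"

definition vector_space_atlas :: "('e, 'e) chart set" where
  "vector_space_atlas = {(UNIV, \<lambda>v. v)}"

section \<open>The tangent bundle\<close>

text \<open>
  A tangent vector at \<open>x\<close> is a class of pairs (chart around \<open>x\<close>, coordinate vector) under the usual
  change of coordinates. Every class has exactly one representative in the chart selected by
  \<open>chart_at\<close>, so the tangent space at \<open>x\<close> is identified, as a vector space, with the model space
  \<open>'e\<close>, and the tangent bundle is, as a set, \<open>'m \<times> 'e\<close> with projection \<^const>\<open>fst\<close>. Its topology and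
  its smooth structure are not those of the product: they come from the bundle charts below.
\<close>

definition chart_at :: "('m, 'e) chart set \<Rightarrow> 'm \<Rightarrow> ('m, 'e) chart" where
  "chart_at \<A> x = (SOME c. c \<in> \<A> \<and> x \<in> chart_dom c)"

text \<open>Coordinates in the chart \<open>c\<close> of the tangent vector \<open>v\<close> at \<open>x\<close>.\<close>

definition tangent_coords ::
  "('m, 'e::real_normed_vector) chart set \<Rightarrow> ('m, 'e) chart \<Rightarrow> 'm \<Rightarrow> 'e \<Rightarrow> 'e" where
  "tangent_coords \<A> c x v =
     frechet_derivative (chart_map c \<circ> chart_inv (chart_at \<A> x)) (at (chart_map (chart_at \<A> x) x)) v"

definition tangent_chart ::
  "('m, 'e::real_normed_vector) chart set \<Rightarrow> ('m, 'e) chart \<Rightarrow> ('m \<times> 'e, 'e \<times> 'e) chart" where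
  "tangent_chart \<A> c = (chart_dom c \<times> UNIV, \<lambda>(x, v). (chart_map c x, tangent_coords \<A> c x v))"

definition tangent_atlas ::
  "('m, 'e::real_normed_vector) chart set \<Rightarrow> ('m \<times> 'e, 'e \<times> 'e) chart set" where
  "tangent_atlas \<A> = tangent_chart \<A> ` \<A>"

definition tangent_topology ::
  "('m, 'e::real_normed_vector) chart set \<Rightarrow> ('m \<times> 'e) topology" where
  "tangent_topology \<A> =
     topology_generated_by {{p \<in> chart_dom c. chart_map c p \<in> U} |c U. c \<in> tangent_atlas \<A> \<and> open U}"

definition tangent_borel ::
  "('m, 'e::real_normed_vector) chart set \<Rightarrow> ('m \<times> 'e) measure" where
  "tangent_borel \<A> = sigma UNIV {W. openin (tangent_topology \<A>) W}"

text \<open>The differential at \<open>x\<close>, between the tangent spaces at \<open>x\<close> and at \<open>f x\<close>.\<close>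

definition differential ::
  "('m, 'e::real_normed_vector) chart set \<Rightarrow> ('n, 'f::real_normed_vector) chart set
    \<Rightarrow> ('m \<Rightarrow> 'n) \<Rightarrow> 'm \<Rightarrow> 'e \<Rightarrow> 'f" where
  "differential \<A> \<B> f x =
     frechet_derivative (chart_map (chart_at \<B> (f x)) \<circ> f \<circ> chart_inv (chart_at \<A> x))
       (at (chart_map (chart_at \<A> x) x))"

section \<open>Riemannian metrics\<close>

text \<open>
  \<open>g x\<close> is the inner product on the tangent space at \<open>x\<close>. Smoothness is that of the coefficients in
  every chart \<open>c\<close>: the second component of the inverse bundle chart at \<open>(y, v)\<close> is the tangent
  vector with \<open>c\<close>-coordinates \<open>v\<close> at the point with \<open>c\<close>-coordinates \<open>y\<close>.
\<close>

locale riemannian_manifold = smooth_manifold \<A>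
  for \<A> :: "('m::{t2_space, second_countable_topology}, 'e::findim_inner) chart set" +
  fixes g :: "'m \<Rightarrow> 'e \<Rightarrow> 'e \<Rightarrow> real"
  assumes metric_bilinear: "bilinear (g x)"
    and metric_sym: "g x v w = g x w v"
    and metric_pos: "v \<noteq> 0 \<Longrightarrow> g x v v > 0"
    and metric_smooth:
      "c \<in> \<A> \<Longrightarrow> smooth_on (chart_map c ` chart_dom c)
        (\<lambda>y. g (chart_inv c y) (snd (chart_inv (tangent_chart \<A> c) (y, v)))
                               (snd (chart_inv (tangent_chart \<A> c) (y, w))))"

definition tangent_norm :: "('m \<Rightarrow> 'e \<Rightarrow> 'e \<Rightarrow> real) \<Rightarrow> 'm \<Rightarrow> 'e \<Rightarrow> real" where
  "tangent_norm g x v = sqrt (g x v v)"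

definition riemannian_gradient ::
  "('m, 'e::real_normed_vector) chart set \<Rightarrow> ('m \<Rightarrow> 'e \<Rightarrow> 'e \<Rightarrow> real) \<Rightarrow> ('m \<Rightarrow> real) \<Rightarrow> 'm \<Rightarrow> 'e" where
  "riemannian_gradient \<A> g F x = (THE w. \<forall>v. g x w v = differential \<A> vector_space_atlas F x v)"

text \<open>Adjoint of a linear map \<open>L\<close> from the tangent space at \<open>x\<close> to that at \<open>y\<close>.\<close>

definition tangent_adjoint ::
  "('m \<Rightarrow> 'e \<Rightarrow> 'e \<Rightarrow> real) \<Rightarrow> 'm \<Rightarrow> 'm \<Rightarrow> ('e \<Rightarrow> 'e) \<Rightarrow> 'e \<Rightarrow> 'e" where
  "tangent_adjoint g x y L w = (THE u. \<forall>v. g x v u = g y (L v) w)"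

section \<open>Retractions\<close>

text \<open>The differential of the restriction of \<open>R\<close> to the tangent space at \<open>x\<close>, at the point \<open>u\<close>.\<close>

definition fibre_differential ::
  "('m, 'e::real_normed_vector) chart set \<Rightarrow> ('m \<times> 'e \<Rightarrow> 'm) \<Rightarrow> 'm \<Rightarrow> 'e \<Rightarrow> 'e \<Rightarrow> 'e" where
  "fibre_differential \<A> R x u = differential vector_space_atlas \<A> (\<lambda>v. R (x, v)) u"

definition manifold_retraction ::
  "('m, 'e::real_normed_vector) chart set \<Rightarrow> ('m \<times> 'e \<Rightarrow> 'm) \<Rightarrow> bool" where
  "manifold_retraction \<A> R \<longleftrightarrow> Ck_map 2 (tangent_atlas \<A>) \<A> R \<and>
     (\<forall>x. R (x, 0) = x \<and> fibre_differential \<A> R x 0 = id)"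

definition R_Lipschitz_on ::
  "('m, 'e::real_normed_vector) chart set \<Rightarrow> ('m \<Rightarrow> 'e \<Rightarrow> 'e \<Rightarrow> real) \<Rightarrow> ('m \<times> 'e \<Rightarrow> 'm)
    \<Rightarrow> ('m \<Rightarrow> 'e) \<Rightarrow> 'm set \<Rightarrow> real \<Rightarrow> bool" where
  "R_Lipschitz_on \<A> g R V K r \<longleftrightarrow> (\<exists>C>0. \<forall>x\<in>K. \<forall>u. tangent_norm g x u \<le> r \<longrightarrow>
     tangent_norm g x
       (tangent_adjoint g x (R (x, u)) (fibre_differential \<A> R x u) (V (R (x, u))) - V x)
     \<le> C * tangent_norm g x u)"

end

theory Submission
  imports Defs
begin

text \<open>
  Integrating the derivative of \<open>s \<mapsto> F (R (x, s u))\<close> and moving \<open>dR\<close> to the other side by its adjoint,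
  the \<open>R\<close>-Lipschitz condition gives \<open>\<bar>F (R (x, u)) - F x - \<langle>\<nabla>F x, u\<rangle>\<bar> \<le> C \<parallel>u\<parallel>\<^sup>2\<close>. Along the iteration this
  writes \<open>F (x\<^sub>n)\<close> as \<open>F (x\<^sub>0) - \<Sum> \<eta>\<^sub>t \<parallel>\<nabla>F (x\<^sub>t)\<parallel>\<^sup>2\<close> minus a martingale plus an absolutely summable error. The
  martingale is bounded in \<open>L\<^sup>2\<close> because \<open>\<Sum> \<eta>\<^sub>t\<^sup>2 \<parallel>G\<^sub>t\<parallel>\<^sup>2\<close> is bounded (\<open>G\<^sub>t\<close> the averaged direction), hence
  it converges almost surely; since \<open>F\<close> is bounded on \<open>K\<close>, \<open>F (x\<^sub>t)\<close> converges and
  \<open>\<Sum> \<eta>\<^sub>t \<parallel>\<nabla>F (x\<^sub>t)\<parallel>\<^sup>2 < \<infinity>\<close>. As \<open>\<Sum> \<eta>\<^sub>t = \<infinity>\<close>, the gradient must vanish: otherwise the iterates come arbitrarily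
  late arbitrarily close to a point \<open>p\<close> with \<open>\<nabla>F p \<noteq> 0\<close>; near \<open>p\<close> the travelled distance is at most a multiple of
  \<open>\<Sum> \<eta>\<^sub>t \<parallel>\<nabla>F (x\<^sub>t)\<parallel>\<^sup>2\<close>, whose tail is small, so they would never leave a neighbourhood on which the gradient
  is bounded away from zero. Both parts are instances of one iteration with step sizes
  \<open>\<eta>\<^sub>t = e\<^sub>t (\<Sum>k<t. \<parallel>G\<^sub>k\<parallel>\<^sup>2)\<close>.
\<close>

section \<open>Linear algebra of the model space\<close>

text \<open>The constants of part 2 have one task each: \<open>\<epsilon> > 0\<close> keeps the sum
  of squared steps bounded, \<open>\<epsilon> \<le> 1 / 2\<close> keeps the sum of step sizes
  infinite, and \<open>\<alpha> \<le> \<beta> powr (1 / 2 + \<epsilon>)\<close> makes every step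
  size at most 1, so that the step vector stays within the radius \<open>A\<close> on which the
  Lipschitz condition speaks. The step size at time \<open>t\<close> uses directions strictly before
  \<open>t\<close>; it is known before the samples of that step are drawn and therefore factors out
  of conditional means. Conditional expectations themselves are avoided: differences are tested
  against bounded functions of the history, and one Fubini argument evaluates such tests. In the
  finite case of (b), \<open>H\<close> need not be measurable in the point, so measurability comes
  from there being finitely many histories of each length; in the other case the tangent bundle does
  not carry the product topology, and measurability is checked in countably many charts. Travel near
  \<open>p\<close> is measured in a single chart, without Riemannian distance, and the gradient
  enters there only through continuity of its norm.\<close>

lemma norm_linear_le_sum:
  fixes l :: "'a::findim_inner \<Rightarrow> 'b::real_normed_vector"
  assumes l: "linear l" and B: "\<And>b. b \<in> B \<Longrightarrow> norm b = 1" "\<And>x. (\<Sum>b\<in>B. (x \<bullet> b) *\<^sub>R b) = x"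
  shows "norm (l v) \<le> norm v * (\<Sum>b\<in>B. norm (l b))"
proof -
  have "l v = (\<Sum>b\<in>B. (v \<bullet> b) *\<^sub>R l b)"
    by (subst B(2)[of v, symmetric]) (simp add: linear_sum[OF l] linear_scale[OF l] del: B(2))
  also have "norm \<dots> \<le> (\<Sum>b\<in>B. norm v * norm (l b))"
  proof (intro sum_norm_le)
    fix b assume "b \<in> B"
    then have "\<bar>v \<bullet> b\<bar> \<le> norm v" using Cauchy_Schwarz_ineq2[of v b] B(1) by simp
    then show "norm ((v \<bullet> b) *\<^sub>R l b) \<le> norm v * norm (l b)" by (simp add: mult_right_mono)
  qed
  finally show ?thesis by (simp add: sum_distrib_left)
qed

lemma findim_linear_bounded_linear:
  fixes f :: "'a::findim_inner \<Rightarrow> 'b::real_normed_vector"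
  assumes f: "linear f"
  shows "bounded_linear f"
proof -
  obtain B :: "'a set" where B: "\<And>b. b \<in> B \<Longrightarrow> norm b = 1"
    "\<And>x. (\<Sum>b\<in>B. (x \<bullet> b) *\<^sub>R b) = x"
    using findim_orthonormal_basis by metis
  show ?thesis
    by (rule bounded_linear_intro[OF linear_add[OF f] linear_scale[OF f] norm_linear_le_sum[OF f B]])
qed

text \<open>The dimension count needs an algebraic basis; a maximal independent subset of an
  orthonormal spanning set serves, also in dimension zero.\<close>

lemma findim_linear_inj_imp_surj:
  fixes f :: "'a::findim_inner \<Rightarrow> 'a"
  assumes f: "linear f" and inj: "inj f"
  shows "surj f"
proof -
  obtain B0 :: "'a set" where B0: "finite B0" "\<And>x. (\<Sum>b\<in>B0. (x \<bullet> b) *\<^sub>R b) = x"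
    using findim_orthonormal_basis by metis
  have "x \<in> span B0" for x
    by (subst B0(2)[of x, symmetric]) (intro span_sum span_scale span_base)
  then have sp: "span B0 = UNIV" by auto
  obtain B where B: "B \<subseteq> B0" "independent B" "span B0 = span B"
    using maximal_independent_subset[of B0] span_eq span_superset span_mono
    by (metis dual_order.trans order.refl span_span span_subspace subspace_span)
  interpret fd: finite_dimensional_vector_space "scaleR :: real \<Rightarrow> 'a \<Rightarrow> 'a" B
    using B B0(1) sp
    by unfold_locales (auto intro: finite_subset simp: scaleR_add_right scaleR_add_left dependent_raw_def span_raw_def)
  interpret fdp: finite_dimensional_vector_space_pair "scaleR :: real \<Rightarrow> 'a \<Rightarrow> 'a" B "scaleR :: real \<Rightarrow> 'a \<Rightarrow> 'a" B ..
  show ?thesis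
    using fdp.linear_injective_imp_surjective[OF _ inj refl] f by (simp add: linear_def)
qed

text \<open>\<open>T w\<close> represents \<open>h w\<close> through the inner product of the model
  space. Positivity makes \<open>T\<close> injective, hence surjective, so the representative of
  \<open>l\<close> is attained. With \<open>h = g x\<close> this makes the descriptions of the
  gradient and of the adjoint well defined.\<close>

lemma riesz_findim:
  fixes h :: "'a::findim_inner \<Rightarrow> 'a \<Rightarrow> real"
  assumes h: "bilinear h" and pos: "\<And>v. v \<noteq> 0 \<Longrightarrow> h v v > 0" and l: "linear l"
  shows "\<exists>!w. \<forall>v. h w v = l v"
proof -
  obtain B :: "'a set" where B: "finite B" "\<And>x. (\<Sum>b\<in>B. (x \<bullet> b) *\<^sub>R b) = x"
    using findim_orthonormal_basis by metis
  define T where "T w = (\<Sum>b\<in>B. h w b *\<^sub>R b)" for w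
  have rep: "(\<Sum>b\<in>B. k b *\<^sub>R b) \<bullet> v = k v" if "linear k" for k v
  proof -
    have "k v = (\<Sum>b\<in>B. (v \<bullet> b) * k b)"
      by (subst B(2)[of v, symmetric]) (simp add: linear_sum[OF that] linear_scale[OF that] del: B(2))
    then show ?thesis by (simp add: inner_sum_left inner_sum_right inner_commute mult.commute)
  qed
  have lin: "linear (h w)" for w using h by (simp add: bilinear_def)
  have Tv: "T w \<bullet> v = h w v" for w v unfolding T_def by (rule rep[OF lin])
  have "linear T"
    by (intro linearI; rule vector_eq_rdot[THEN iffD1], intro allI)
      (use h in \<open>auto simp: Tv inner_add_left bilinear_ladd bilinear_lmul\<close>)
  moreover have "inj T"
  proof (rule injI)
    fix a b assume "T a = T b"
    then have "h (a - b) (a - b) = 0"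
      using Tv[of a "a - b"] Tv[of b "a - b"] bilinear_lsub[OF h] by simp
    then show "a = b" using pos[of "a - b"] by force
  qed
  ultimately have "surj T" by (rule findim_linear_inj_imp_surj)
  then obtain w where w: "T w = (\<Sum>b\<in>B. l b *\<^sub>R b)" by (metis surjD)
  show ?thesis
  proof (rule ex1I[of _ w])
    show "\<forall>v. h w v = l v" using Tv rep[OF l] w by metis
    then show "w' = w" if "\<forall>v. h w' v = l v" for w'
      using that \<open>inj T\<close> unfolding T_def inj_def by simp
  qed
qed

lemma bilinear_Cauchy_Schwarz:
  assumes h: "bilinear h" and sym: "\<And>v w. h v w = h w v" and pos: "\<And>v. h v v \<ge> (0::real)"
  shows "\<bar>h v w\<bar> \<le> sqrt (h v v) * sqrt (h w w)"
proof -
  have q: "h v v + 2 * s * h v w + s\<^sup>2 * h w w \<ge> 0" for s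
    using pos[of "v + s *\<^sub>R w"] sym[of w v]
    by (simp add: bilinear_ladd[OF h] bilinear_radd[OF h] bilinear_lmul[OF h] bilinear_rmul[OF h]
        power2_eq_square algebra_simps)
  have "(h v w)\<^sup>2 \<le> h v v * h w w"
  proof (cases "h w w = 0")
    case True
    have "h v w = 0"
    proof (rule ccontr)
      assume nz: "h v w \<noteq> 0"
      \<comment> \<open>For \<open>h w w = 0\<close> the quadratic is linear in \<open>s\<close>,
        and this \<open>s\<close> gives it the value \<open>- 1\<close>.\<close>
      then show False using q[of "- (h v v + 1) / (2 * h v w)"] True by (simp add: field_simps)
    qed
    then show ?thesis using True by simp
  next
    case False
    then have p: "h w w > 0" using pos[of w] by simp
    show ?thesis using q[of "- h v w / h w w"] p
      by (simp add: power2_eq_square field_simps)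
  qed
  then have "sqrt ((h v w)\<^sup>2) \<le> sqrt (h v v * h w w)" by (rule real_sqrt_le_mono)
  then show ?thesis by (simp add: real_sqrt_mult)
qed

section \<open>Charts and tangent coordinates\<close>

lemma Ck_on_differentiable:
  "Ck_on (Suc k) S f \<Longrightarrow> x \<in> S \<Longrightarrow> f differentiable (at x)"
  by simp

lemma Ck_on_Suc_continuous_on: "Ck_on (Suc k) S f \<Longrightarrow> continuous_on S f"
  by (auto intro!: differentiable_imp_continuous_on differentiable_at_imp_differentiable_on)

lemma Ck_on_frechet_continuous_on:
  "Ck_on (Suc k) S f \<Longrightarrow> continuous_on S (\<lambda>x. frechet_derivative f (at x) v)"
  by (cases k) (simp, metis Ck_on.simps(2) Ck_on_Suc_continuous_on)

text \<open>Expansion in a finite basis turns continuity for each fixed vector into joint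
  continuity. \<open>Ck_on\<close> and the smoothness of the metric provide the former only.\<close>

lemma continuous_on_linear_family:
  fixes \<phi> :: "'p::topological_space \<Rightarrow> 'e::findim_inner \<Rightarrow> 'b::real_normed_vector"
  assumes lin: "\<And>p. p \<in> S \<Longrightarrow> linear (\<phi> p)" and cont: "\<And>v. continuous_on S (\<lambda>p. \<phi> p v)"
  shows "continuous_on (S \<times> UNIV) (\<lambda>(p, v). \<phi> p v)"
proof -
  obtain B :: "'e set" where B: "finite B" "\<And>x. (\<Sum>b\<in>B. (x \<bullet> b) *\<^sub>R b) = x"
    using findim_orthonormal_basis by metis
  have eq: "\<phi> p v = (\<Sum>b\<in>B. (v \<bullet> b) *\<^sub>R \<phi> p b)" if "p \<in> S" for p v
    by (subst B(2)[of v, symmetric])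
      (simp add: linear_sum[OF lin[OF that]] linear_scale[OF lin[OF that]] del: B(2))
  have "continuous_on (S \<times> UNIV) (\<lambda>x. \<phi> (fst x) b)" for b
    by (rule continuous_on_compose2[OF cont]) (auto intro!: continuous_intros)
  then have "continuous_on (S \<times> UNIV) (\<lambda>x. \<Sum>b\<in>B. (snd x \<bullet> b) *\<^sub>R \<phi> (fst x) b)"
    by (intro continuous_intros)
  then show ?thesis
    by (rule continuous_on_eq) (auto simp: eq)
qed

context smooth_manifold
begin

lemma chart_inv_map:
  assumes "c \<in> \<A>" "x \<in> chart_dom c"
  shows "chart_inv c (chart_map c x) = x"
  using chart_homeomorphism[OF assms(1)] assms(2) by (auto simp: homeomorphism_def)

lemma map_chart_inv:
  assumes "c \<in> \<A>" "y \<in> chart_map c ` chart_dom c"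
  shows "chart_map c (chart_inv c y) = y" "chart_inv c y \<in> chart_dom c"
  using chart_homeomorphism[OF assms(1)] assms(2) by (auto simp: homeomorphism_def)

lemma continuous_on_chart_map: "c \<in> \<A> \<Longrightarrow> continuous_on (chart_dom c) (chart_map c)"
  using chart_homeomorphism by (auto simp: homeomorphism_def)

lemma open_chart_image:
  assumes c: "c \<in> \<A>" and U: "open U"
  shows "open (chart_map c ` (chart_dom c \<inter> U))"
proof -
  have "chart_map c ` (chart_dom c \<inter> U) = chart_map c ` chart_dom c \<inter> chart_inv c -` U"
  proof (intro set_eqI iffI)
    fix y assume "y \<in> chart_map c ` chart_dom c \<inter> chart_inv c -` U"
    then have "chart_inv c y \<in> chart_dom c \<inter> U" "chart_map c (chart_inv c y) = y"
      using map_chart_inv[OF c, of y] by auto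
    then show "y \<in> chart_map c ` (chart_dom c \<inter> U)" by (metis imageI)
  qed (use chart_inv_map[OF c] in auto)
  moreover have "open (chart_map c ` chart_dom c \<inter> chart_inv c -` U)"
    using chart_homeomorphism[OF c] open_chart_range[OF c] U
    by (intro continuous_open_preimage) (auto simp: homeomorphism_def)
  ultimately show ?thesis by simp
qed

lemma open_chart_preimage:
  assumes c: "c \<in> \<A>" and U: "open U"
  shows "open {x \<in> chart_dom c. chart_map c x \<in> U}"
  using continuous_open_preimage[OF continuous_on_chart_map[OF c] open_chart_dom[OF c] U]
  by (simp add: vimage_def Int_def)

lemma chart_at: "chart_at \<A> x \<in> \<A>" "x \<in> chart_dom (chart_at \<A> x)"
proof -
  have "\<exists>c. c \<in> \<A> \<and> x \<in> chart_dom c" using charts_cover by blast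
  then have "chart_at \<A> x \<in> \<A> \<and> x \<in> chart_dom (chart_at \<A> x)"
    unfolding chart_at_def by (rule someI_ex)
  then show "chart_at \<A> x \<in> \<A>" "x \<in> chart_dom (chart_at \<A> x)" by auto
qed

lemma transition_has_derivative:
  assumes c: "c \<in> \<A>" "x \<in> chart_dom c" and d: "d \<in> \<A>" "x \<in> chart_dom d"
  shows "((chart_map d \<circ> chart_inv c) has_derivative
    frechet_derivative (chart_map d \<circ> chart_inv c) (at (chart_map c x))) (at (chart_map c x))"
proof -
  have "Ck_on (Suc 0) (chart_map c ` (chart_dom c \<inter> chart_dom d)) (chart_map d \<circ> chart_inv c)"
    using charts_compatible[OF c(1) d(1)] unfolding smooth_on_def by blast
  then have "(chart_map d \<circ> chart_inv c) differentiable (at (chart_map c x))"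
    by (rule Ck_on_differentiable) (use c d in auto)
  then show ?thesis using frechet_derivative_works by blast
qed

lemma chart_change_has_derivative:
  assumes c: "c \<in> \<A>" "x \<in> chart_dom c" and d: "d \<in> \<A>" "x \<in> chart_dom d"
    and f: "((f \<circ> chart_inv d) has_derivative D) (at (chart_map d x))"
  shows "((f \<circ> chart_inv c) has_derivative
    (D \<circ> frechet_derivative (chart_map d \<circ> chart_inv c) (at (chart_map c x)))) (at (chart_map c x))"
proof -
  have "((f \<circ> chart_inv d) \<circ> (chart_map d \<circ> chart_inv c) has_derivative
    (D \<circ> frechet_derivative (chart_map d \<circ> chart_inv c) (at (chart_map c x)))) (at (chart_map c x))"
    by (rule diff_chain_at[OF transition_has_derivative[OF c d]])
      (use f chart_inv_map[OF c] in simp)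
  then show ?thesis
  proof (rule has_derivative_transform_within_open)
    show "open (chart_map c ` (chart_dom c \<inter> chart_dom d))"
      by (rule open_chart_image[OF c(1) open_chart_dom[OF d(1)]])
    show "chart_map c x \<in> chart_map c ` (chart_dom c \<inter> chart_dom d)" using c d by auto
  qed (auto simp: chart_inv_map[OF c(1)] chart_inv_map[OF d(1)])
qed

lemma chart_self_has_derivative:
  assumes c: "c \<in> \<A>" "x \<in> chart_dom c"
  shows "((chart_map c \<circ> chart_inv c) has_derivative id) (at (chart_map c x))"
proof -
  have "((\<lambda>y. y) has_derivative id) (at (chart_map c x))" by (auto simp: id_def)
  then show ?thesis
    by (rule has_derivative_transform_within_open[OF _ open_chart_range[OF c(1)]])
      (use c in \<open>auto simp: map_chart_inv chart_inv_map\<close>)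
qed

lemma transition_derivative_inverse:
  assumes c: "c \<in> \<A>" "x \<in> chart_dom c" and d: "d \<in> \<A>" "x \<in> chart_dom d"
  shows "frechet_derivative (chart_map c \<circ> chart_inv d) (at (chart_map d x)) \<circ>
    frechet_derivative (chart_map d \<circ> chart_inv c) (at (chart_map c x)) = id"
  by (rule has_derivative_unique[OF chart_change_has_derivative[OF c d transition_has_derivative[OF d c]]
        chart_self_has_derivative[OF c]])

abbreviation "tc \<equiv> tangent_coords \<A>"

lemma tangent_coords_eq: "tc c x =
  frechet_derivative (chart_map c \<circ> chart_inv (chart_at \<A> x)) (at (chart_map (chart_at \<A> x) x))"
  by (simp add: tangent_coords_def fun_eq_iff)

lemma linear_tangent_coords:
  assumes c: "c \<in> \<A>" "x \<in> chart_dom c"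
  shows "linear (tc c x)"
  unfolding tangent_coords_eq
  by (rule has_derivative_linear[OF transition_has_derivative[OF chart_at[of x] c]])

lemma bij_tangent_coords:
  assumes c: "c \<in> \<A>" "x \<in> chart_dom c"
  shows "bij (tc c x)"
  unfolding tangent_coords_eq
  by (rule o_bij[OF transition_derivative_inverse[OF chart_at[of x] c]
        transition_derivative_inverse[OF c chart_at[of x]]])

lemma inj_on_tangent_chart:
  assumes c: "c \<in> \<A>"
  shows "inj_on (chart_map (tangent_chart \<A> c)) (chart_dom (tangent_chart \<A> c))"
proof (rule inj_onI)
  fix p q assume p: "p \<in> chart_dom (tangent_chart \<A> c)" and q: "q \<in> chart_dom (tangent_chart \<A> c)"
    and eq: "chart_map (tangent_chart \<A> c) p = chart_map (tangent_chart \<A> c) q"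
  obtain x v x' v' where pq: "p = (x, v)" "q = (x', v')" by fastforce
  have x: "x \<in> chart_dom c" "x' \<in> chart_dom c" "chart_map c x = chart_map c x'"
    and v: "tc c x v = tc c x' v'"
    using p q eq by (auto simp: pq tangent_chart_def)
  have "x = x'" using x chart_inv_map[OF c] by metis
  then show "p = q" using v bij_is_inj[OF bij_tangent_coords[OF c x(1)]] by (simp add: pq inj_eq)
qed

lemma tangent_chart_inv_map:
  assumes c: "c \<in> \<A>" "x \<in> chart_dom c"
  shows "chart_inv (tangent_chart \<A> c) (chart_map c x, tc c x v) = (x, v)"
proof -
  have "chart_inv (tangent_chart \<A> c) (chart_map (tangent_chart \<A> c) (x, v)) = (x, v)"
    unfolding chart_inv_def[of "tangent_chart \<A> c"]
    by (rule inv_into_f_f[OF inj_on_tangent_chart[OF c(1)]]) (use c in \<open>simp add: tangent_chart_def\<close>)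
  then show ?thesis by (simp add: tangent_chart_def)
qed

lemma tangent_chart_inv:
  assumes c: "c \<in> \<A>" "y \<in> chart_map c ` chart_dom c"
  shows "chart_inv (tangent_chart \<A> c) (y, v) = (chart_inv c y, inv (tc c (chart_inv c y)) v)"
proof -
  let ?x = "chart_inv c y"
  have x: "?x \<in> chart_dom c" "chart_map c ?x = y" using map_chart_inv[OF c] by auto
  show ?thesis
    using tangent_chart_inv_map[OF c(1) x(1), of "inv (tc c ?x) v"] bij_tangent_coords[OF c(1) x(1)]
    by (simp add: x surj_f_inv_f bij_is_surj)
qed

lemma linear_inv_tangent_coords:
  assumes c: "c \<in> \<A>" "x \<in> chart_dom c"
  shows "linear (inv (tc c x))"
proof -
  note l = linear_tangent_coords[OF c] and b = bij_tangent_coords[OF c]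
  have "tc c x (inv (tc c x) w) = w" for w using b by (simp add: bij_is_surj surj_f_inv_f)
  then show ?thesis
    using bij_is_inj[OF b] by (metis (no_types, lifting) injD linearI linear_add[OF l] linear_scale[OF l])
qed

end

lemma chart_at_vector_space_atlas: "chart_at vector_space_atlas v = (UNIV, \<lambda>v. v)"
  unfolding chart_at_def vector_space_atlas_def by (rule some_equality) auto

lemma chart_inv_vector_space: "chart_inv (UNIV, \<lambda>v. v) = (\<lambda>v. v)"
  by (simp add: chart_inv_def inv_into_def fun_eq_iff)

lemma (in smooth_manifold) tangent_chart_image:
  assumes c: "c \<in> \<A>" and y: "y \<in> chart_map c ` chart_dom c"
  shows "chart_map (tangent_chart \<A> c) (chart_inv (tangent_chart \<A> c) (y, v)) = (y, v)"
    and "chart_inv (tangent_chart \<A> c) (y, v) \<in> chart_dom (tangent_chart \<A> c)"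
proof -
  note x = map_chart_inv[OF c y]
  have "tc c (chart_inv c y) (inv (tc c (chart_inv c y)) v) = v"
    using bij_tangent_coords[OF c x(2)] by (simp add: bij_is_surj surj_f_inv_f)
  then show "chart_map (tangent_chart \<A> c) (chart_inv (tangent_chart \<A> c) (y, v)) = (y, v)"
    and "chart_inv (tangent_chart \<A> c) (y, v) \<in> chart_dom (tangent_chart \<A> c)"
    using x by (simp_all add: tangent_chart_inv[OF c y]) (simp_all add: tangent_chart_def)
qed

section \<open>The metric and the gradient\<close>

context riemannian_manifold
begin

lemmas metric_linear_simps = bilinear_ladd[OF metric_bilinear] bilinear_radd[OF metric_bilinear]
  bilinear_lmul[OF metric_bilinear] bilinear_rmul[OF metric_bilinear]
  bilinear_lsub[OF metric_bilinear] bilinear_rsub[OF metric_bilinear]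

lemma linear_metric: "linear (g x v)" "linear (\<lambda>v. g x v w)"
  using metric_bilinear[of x] by (auto simp: bilinear_def)

lemma metric_nonneg: "g x v v \<ge> 0"
  using metric_pos[of v x] by (cases "v = 0") (auto simp: bilinear_lzero[OF metric_bilinear] less_imp_le)

lemma tangent_norm_nonneg: "tangent_norm g x v \<ge> 0"
  by (simp add: tangent_norm_def metric_nonneg)

lemma tangent_norm_power2: "(tangent_norm g x v)\<^sup>2 = g x v v"
  by (simp add: tangent_norm_def metric_nonneg)

lemma metric_Cauchy_Schwarz: "\<bar>g x v w\<bar> \<le> tangent_norm g x v * tangent_norm g x w"
  unfolding tangent_norm_def
  by (rule bilinear_Cauchy_Schwarz[OF metric_bilinear metric_sym metric_nonneg])

lemma tangent_norm_scale: "tangent_norm g x (a *\<^sub>R v) = \<bar>a\<bar> * tangent_norm g x v"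
  by (simp add: tangent_norm_def metric_linear_simps real_sqrt_mult mult.assoc[symmetric])

lemma tangent_norm_triangle: "tangent_norm g x (v + w) \<le> tangent_norm g x v + tangent_norm g x w"
proof -
  have "(tangent_norm g x (v + w))\<^sup>2 \<le> (tangent_norm g x v + tangent_norm g x w)\<^sup>2"
    using metric_Cauchy_Schwarz[of x v w] metric_sym[of x v w]
    by (simp add: tangent_norm_power2 power2_sum metric_linear_simps)
  then show ?thesis using tangent_norm_nonneg[of x v] tangent_norm_nonneg[of x w]
    by (metis abs_le_square_iff abs_of_nonneg add_nonneg_nonneg tangent_norm_nonneg)
qed

lemma tangent_norm_sum: "tangent_norm g x (\<Sum>i\<in>I. v i) \<le> (\<Sum>i\<in>I. tangent_norm g x (v i))"
proof (induction I rule: infinite_finite_induct)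
  case (insert i I)
  then show ?case using tangent_norm_triangle[of x "v i" "\<Sum>i\<in>I. v i"] by simp
qed (auto simp: tangent_norm_def bilinear_lzero[OF metric_bilinear])

abbreviation "lift c y v \<equiv> snd (chart_inv (tangent_chart \<A> c) (y, v))"

lemma lift_coords: "c \<in> \<A> \<Longrightarrow> x \<in> chart_dom c \<Longrightarrow> lift c (chart_map c x) (tc c x v) = v"
  by (simp add: tangent_chart_inv_map)

lemma linear_lift: "c \<in> \<A> \<Longrightarrow> y \<in> chart_map c ` chart_dom c \<Longrightarrow> linear (lift c y)"
  using linear_inv_tangent_coords[of c "chart_inv c y"] map_chart_inv[of c y]
  by (simp add: tangent_chart_inv)

text \<open>Linear families are used twice, once for each argument of the metric.\<close>

lemma continuous_on_metric_coeffs: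
  assumes c: "c \<in> \<A>"
  shows "continuous_on ((chart_map c ` chart_dom c \<times> UNIV) \<times> UNIV)
    (\<lambda>((y, v), w). g (chart_inv c y) (lift c y v) (lift c y w))"
proof -
  let ?Y = "chart_map c ` chart_dom c"
  have cont: "continuous_on ?Y (\<lambda>y. g (chart_inv c y) (lift c y v) (lift c y w))" for v w
    using spec[OF metric_smooth[OF c, of v w, unfolded smooth_on_def], of 0] by simp
  have l1: "linear (\<lambda>v. g (chart_inv c y) (lift c y v) (lift c y w))" if "y \<in> ?Y" for y w
    using linear_compose[OF linear_lift[OF c that] linear_metric(2)] by (simp add: o_def)
  have l2: "linear (\<lambda>w. g (chart_inv c y) (lift c y v) (lift c y w))" if "y \<in> ?Y" for y v
    using linear_compose[OF linear_lift[OF c that] linear_metric(1)] by (simp add: o_def)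
  have "continuous_on (?Y \<times> UNIV) (\<lambda>(y, v). g (chart_inv c y) (lift c y v) (lift c y w))" for w
    by (rule continuous_on_linear_family[OF l1 cont])
  then show ?thesis
    using continuous_on_linear_family[of "?Y \<times> UNIV" "\<lambda>(y, v) w. g (chart_inv c y) (lift c y v) (lift c y w)"] l2
    by (auto simp: case_prod_unfold)
qed

lemma continuous_on_tangent_norm_coords:
  assumes c: "c \<in> \<A>"
  shows "continuous_on (chart_map c ` chart_dom c \<times> UNIV)
    (\<lambda>(y, v). tangent_norm g (chart_inv c y) (lift c y v))"
proof -
  have "continuous_on (chart_map c ` chart_dom c \<times> UNIV)
    (\<lambda>p. (\<lambda>((y, v), w). g (chart_inv c y) (lift c y v) (lift c y w)) (p, snd p))"
    by (rule continuous_on_compose2[OF continuous_on_metric_coeffs[OF c]]) (auto intro!: continuous_intros)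
  then show ?thesis
    unfolding tangent_norm_def case_prod_unfold by (intro continuous_intros) simp
qed

text \<open>On a closed coordinate ball times the unit sphere the Riemannian norm is continuous and
  positive, so compactness gives a positive minimum; homogeneity extends it to all vectors. It
  converts bounds in the metric into bounds in coordinates, uniformly near \<open>p\<close>.\<close>

lemma tangent_norm_chart_bound:
  assumes c: "c \<in> \<A>" "p \<in> chart_dom c"
  obtains r m where "r > 0" "m > 0"
    "\<And>x v. x \<in> chart_dom c \<Longrightarrow> norm (chart_map c x - chart_map c p) < r \<Longrightarrow>
      m * norm (tc c x v) \<le> tangent_norm g x v"
proof -
  let ?Y = "chart_map c ` chart_dom c"
  let ?N = "\<lambda>(y, v). tangent_norm g (chart_inv c y) (lift c y v)"
  obtain r where r: "r > 0" "cball (chart_map c p) r \<subseteq> ?Y"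
    using open_chart_range[OF c(1)] c(2) open_contains_cball by (metis imageI)
  let ?Q = "cball (chart_map c p) r \<times> sphere (0::'e) 1"
  have "\<exists>m>0. \<forall>q\<in>?Q. m \<le> ?N q"
  \<comment> \<open>In dimension zero the unit sphere is empty and no minimum exists; any constant
    works.\<close>
  proof (cases "?Q = {}")
    case False
    have "closed (sphere (0::'e) 1)"
    proof -
      have "sphere (0::'e) 1 = norm -` {1}" by auto
      moreover have "closed ((norm :: 'e \<Rightarrow> real) -` {1})"
        by (rule closed_vimage[OF closed_singleton continuous_on_norm_id])
      ultimately show ?thesis by simp
    qed
    then have "compact (sphere (0::'e) 1)"
      by (simp add: compact_eq_bounded_closed bounded_subset[OF bounded_cball sphere_cball])
    then have "compact ?Q" by (intro compact_Times compact_cball)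
    moreover have "continuous_on ?Q ?N"
      by (rule continuous_on_subset[OF continuous_on_tangent_norm_coords[OF c(1)]]) (use r in auto)
    ultimately have "\<exists>q\<in>?Q. \<forall>q'\<in>?Q. ?N q \<le> ?N q'"
      using False by (intro continuous_attains_inf)
    then obtain q where q: "q \<in> ?Q" "\<And>q'. q' \<in> ?Q \<Longrightarrow> ?N q \<le> ?N q'" by blast
    obtain y v where qe: "q = (y, v)" by (cases q)
    then have y: "y \<in> ?Y" and v: "v \<noteq> 0" using q(1) r(2) by auto
    have "tc c (chart_inv c y) (lift c y v) = v"
      using tangent_chart_image(1)[OF c(1) y, of v] map_chart_inv[OF c(1) y]
      by (simp add: tangent_chart_inv[OF c(1) y]) (simp add: tangent_chart_def)
    then have "lift c y v \<noteq> 0"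
      using v linear_0[OF linear_tangent_coords[OF c(1) map_chart_inv(2)[OF c(1) y]]] by auto
    then have "?N q > 0" using metric_pos by (simp add: qe tangent_norm_def)
    then show ?thesis using q(2) by blast
  qed (auto intro: exI[of _ 1])
  then obtain m where m: "m > 0" "\<And>q. q \<in> ?Q \<Longrightarrow> m \<le> ?N q" by blast
  show thesis
  proof (rule that[OF r(1) m(1)])
    fix x v assume x: "x \<in> chart_dom c" "norm (chart_map c x - chart_map c p) < r"
    note lin = linear_tangent_coords[OF c(1) x(1)]
    show "m * norm (tc c x v) \<le> tangent_norm g x v"
    proof (cases "tc c x v = 0")
      case True
      then show ?thesis by (simp add: tangent_norm_nonneg)
    next
      case False
      let ?s = "1 / norm (tc c x v)"
      have "m \<le> ?N (chart_map c x, tc c x (?s *\<^sub>R v))"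
        by (rule m(2)) (use x False in \<open>auto simp: linear_scale[OF lin] dist_norm norm_minus_commute\<close>)
      also have "\<dots> = ?s * tangent_norm g x v"
        by (simp add: lift_coords[OF c(1) x(1)] chart_inv_map[OF c(1) x(1)] tangent_norm_scale)
      finally show ?thesis using False by (simp add: field_simps)
    qed
  qed
qed

end

section \<open>The differential of the objective and the continuity of its gradient norm\<close>

locale retraction_objective = riemannian_manifold \<A> g
  for \<A> :: "('m::{t2_space, second_countable_topology}, 'e::findim_inner) chart set" and g +
  fixes R :: "'m \<times> 'e \<Rightarrow> 'm" and F :: "'m \<Rightarrow> real"
  assumes retraction: "manifold_retraction \<A> R" and F_C1: "Ck_map 1 \<A> vector_space_atlas F"
begin

abbreviation "dF x \<equiv> differential \<A> vector_space_atlas F x"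

abbreviation "grad \<equiv> riemannian_gradient \<A> g F"

lemma Ck_on_F_chart:
  assumes c: "c \<in> \<A>"
  shows "Ck_on (Suc 0) (chart_map c ` chart_dom c) (F \<circ> chart_inv c)"
proof -
  have "Ck_on 1 (chart_map c ` (chart_dom c \<inter> F -` chart_dom (UNIV, \<lambda>v. v)))
    (chart_map (UNIV, \<lambda>v. v) \<circ> F \<circ> chart_inv c)"
    using F_C1 c unfolding Ck_map_def vector_space_atlas_def by blast
  then show ?thesis by (simp only: fst_conv snd_conv vimage_UNIV Int_UNIV_right o_def One_nat_def)
qed

lemma F_chart_has_derivative:
  assumes "c \<in> \<A>" "y \<in> chart_map c ` chart_dom c"
  shows "((F \<circ> chart_inv c) has_derivative frechet_derivative (F \<circ> chart_inv c) (at y)) (at y)"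
  using Ck_on_differentiable[OF Ck_on_F_chart[OF assms(1)] assms(2)] frechet_derivative_works by blast

text \<open>\<open>differential\<close> is computed in the selected chart, which may jump from point
  to point; continuity arguments need one fixed chart around the point.\<close>

lemma differential_chart:
  assumes c: "c \<in> \<A>" "x \<in> chart_dom c"
  shows "dF x v = frechet_derivative (F \<circ> chart_inv c) (at (chart_map c x)) (tc c x v)"
proof -
  have "frechet_derivative (F \<circ> chart_inv (chart_at \<A> x)) (at (chart_map (chart_at \<A> x) x)) =
    frechet_derivative (F \<circ> chart_inv c) (at (chart_map c x)) \<circ> tc c x"
    unfolding tangent_coords_eq
    by (rule frechet_derivative_at[OF chart_change_has_derivative[OF chart_at c F_chart_has_derivative[OF c(1)]], symmetric])
      (use c in auto)
  then show ?thesis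
    by (simp add: differential_def chart_at_vector_space_atlas o_def)
qed

lemma linear_dF: "linear (dF x)"
proof -
  note c = chart_at[of x]
  have "dF x = frechet_derivative (F \<circ> chart_inv (chart_at \<A> x)) (at (chart_map (chart_at \<A> x) x))
      \<circ> tc (chart_at \<A> x) x"
    by (simp add: fun_eq_iff differential_chart[OF c])
  then show ?thesis
    using linear_compose[OF linear_tangent_coords[OF c] has_derivative_linear[OF F_chart_has_derivative[OF c(1)]]] c
    by simp
qed

lemma continuous_on_dF_coords:
  assumes c: "c \<in> \<A>"
  shows "continuous_on (chart_map c ` chart_dom c \<times> UNIV)
    (\<lambda>(y, v). frechet_derivative (F \<circ> chart_inv c) (at y) v)"
  by (rule continuous_on_linear_family)
    (use F_chart_has_derivative[OF c] has_derivative_linear Ck_on_frechet_continuous_on[OF Ck_on_F_chart[OF c]]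
      in blast)+

lemma continuous_F: "continuous_on UNIV F"
proof -
  have "isCont F x" for x
  proof -
    note c = chart_at[of x]
    have "continuous_on (chart_dom (chart_at \<A> x)) ((F \<circ> chart_inv (chart_at \<A> x)) \<circ> chart_map (chart_at \<A> x))"
      by (intro continuous_on_compose continuous_on_chart_map c Ck_on_Suc_continuous_on[OF Ck_on_F_chart])
    then have "continuous_on (chart_dom (chart_at \<A> x)) F"
      by (rule continuous_on_eq) (simp add: chart_inv_map[OF c(1)])
    then show ?thesis
      using continuous_on_eq_continuous_at[OF open_chart_dom[OF c(1)]] c by blast
  qed
  then show ?thesis by (simp add: continuous_at_imp_continuous_on)
qed

lemma gradient: "g x (grad x) v = dF x v"
  using theI'[OF riesz_findim[OF metric_bilinear metric_pos linear_dF[of x], of x]]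
  unfolding riemannian_gradient_def by blast

text \<open>The gradient is known only through its defining equation, so continuity is a
  perturbation argument: the coordinates \<open>W p\<close> solve the equation at a nearby
  \<open>x\<close> up to a small residual, and the lower norm bound \<open>m\<close> turns the
  residual into a bound on \<open>W x - W p\<close>.\<close>

lemma isCont_gradient_norm: "isCont (\<lambda>x. dF x (grad x)) p"
proof -
  let ?c = "chart_at \<A> p"
  note c = chart_at[of p]
  let ?Y = "chart_map ?c ` chart_dom ?c"
  define D where "D y v = frechet_derivative (F \<circ> chart_inv ?c) (at y) v" for y v
  define G where "G y v w = g (chart_inv ?c y) (lift ?c y v) (lift ?c y w)" for y v w
  define W where "W x = tc ?c x (grad x)" for x
  define x0 where "x0 = chart_map ?c p"
  obtain B :: "'e set" where B: "finite B" "\<And>b. b \<in> B \<Longrightarrow> norm b = 1"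
    "\<And>x. (\<Sum>b\<in>B. (x \<bullet> b) *\<^sub>R b) = x"
    using findim_orthonormal_basis by metis
  \<comment> \<open>A sum over basis vectors replaces the operator norm of the residual, so that
    continuity in fixed directions suffices.\<close>
  define err where "err y = (\<Sum>b\<in>B. norm (D y b - G y (W p) b))" for y
  obtain r m where rm: "r > 0" "m > 0"
    "\<And>x v. x \<in> chart_dom ?c \<Longrightarrow> norm (chart_map ?c x - chart_map ?c p) < r \<Longrightarrow>
      m * norm (tc ?c x v) \<le> tangent_norm g x v"
    using tangent_norm_chart_bound[OF c] by metis
  have DW: "G (chart_map ?c x) (W x) (tc ?c x v) = D (chart_map ?c x) (tc ?c x v)" if "x \<in> chart_dom ?c" for x v
    unfolding G_def D_def W_def using gradient[of x v] differential_chart[OF c(1) that, of v]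
    by (simp add: lift_coords[OF c(1) that] chart_inv_map[OF c(1) that])
  have x0: "x0 \<in> ?Y" using c by (auto simp: x0_def)
  have op: "open ?Y" by (rule open_chart_range[OF c(1)])
  have contD: "continuous_on ?Y (\<lambda>y. D y v)" for v
    unfolding D_def by (rule Ck_on_frechet_continuous_on[OF Ck_on_F_chart[OF c(1)]])
  have contG: "continuous_on ?Y (\<lambda>y. G y v w)" for v w
    unfolding G_def using spec[OF metric_smooth[OF c(1), of v w, unfolded smooth_on_def], of 0] by simp
  have "continuous_on ?Y err"
    unfolding err_def by (intro continuous_intros contD contG)
  then have "isCont err x0"
    using continuous_on_eq_continuous_at[OF op] x0 by blast
  have "err x0 = 0"
  proof -
    have "D x0 b = G x0 (W p) b" for b
    proof -
      obtain v where "b = tc ?c p v" using bij_tangent_coords[OF c] by (metis bij_is_surj surjD)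
      then show ?thesis using DW[OF c(2), of v] by (simp add: x0_def)
    qed
    then show ?thesis by (simp add: err_def)
  qed
  have contc: "isCont (chart_map ?c) p"
    using continuous_on_eq_continuous_at[OF open_chart_dom[OF c(1)]] c continuous_on_chart_map by blast
  have "isCont (\<lambda>x. err (chart_map ?c x)) p"
    using isCont_o2[OF contc] \<open>isCont err x0\<close> by (simp add: x0_def)
  then have errt: "((\<lambda>x. err (chart_map ?c x) / m\<^sup>2) \<longlongrightarrow> 0) (at p)"
    using \<open>err x0 = 0\<close> by (auto simp: isCont_def x0_def intro: tendsto_divide_zero)
  have bound: "norm (W x - W p) \<le> err (chart_map ?c x) / m\<^sup>2"
    if x: "x \<in> chart_dom ?c" "norm (chart_map ?c x - chart_map ?c p) < r" for x
  proof -
    let ?y = "chart_map ?c x" and ?v = "W x - W p"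
    have y: "?y \<in> ?Y" using x by simp
    obtain u where u: "?v = tc ?c x u" using bij_tangent_coords[OF c(1) x(1)] by (metis bij_is_surj surjD)
    have lin: "linear (\<lambda>v. D ?y v - G ?y (W p) v)"
      unfolding D_def G_def
      using has_derivative_linear[OF F_chart_has_derivative[OF c(1) y]]
        linear_compose[OF linear_lift[OF c(1) y] linear_metric(1)]
      by (intro linear_compose_sub) (auto simp: o_def)
    have "(m * norm ?v)\<^sup>2 \<le> (tangent_norm g x u)\<^sup>2"
      using rm(3)[OF x, of u] u rm(2) by (intro power_mono) auto
    also have "\<dots> = G ?y ?v ?v"
      by (simp add: tangent_norm_power2 G_def u lift_coords[OF c(1) x(1)] chart_inv_map[OF c(1) x(1)])
    also have "\<dots> = G ?y (W x) ?v - G ?y (W p) ?v"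
      unfolding G_def by (simp add: linear_diff[OF linear_lift[OF c(1) y]] metric_linear_simps)
    also have "\<dots> = D ?y ?v - G ?y (W p) ?v"
      using DW[OF x(1), of u] u by simp
    also have "\<dots> \<le> norm ?v * err ?y"
      using norm_linear_le_sum[OF lin B(2,3), of ?v] unfolding err_def by simp
    finally have "norm ?v * (m\<^sup>2 * norm ?v) \<le> norm ?v * err ?y"
      by (simp add: power_mult_distrib power2_eq_square mult_ac)
    moreover have "err ?y \<ge> 0" unfolding err_def by (simp add: sum_nonneg)
    ultimately have "m\<^sup>2 * norm ?v \<le> err ?y" by (cases "norm ?v = 0") auto
    then show ?thesis using rm(2) by (simp add: field_simps)
  qed
  have near: "eventually (\<lambda>x. x \<in> chart_dom ?c \<and> norm (chart_map ?c x - chart_map ?c p) < r) (at p)"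
  proof (intro eventually_conj)
    show "eventually (\<lambda>x. x \<in> chart_dom ?c) (at p)"
      using open_chart_dom[OF c(1)] c(2) by (auto simp: eventually_at_topological)
    show "eventually (\<lambda>x. norm (chart_map ?c x - chart_map ?c p) < r) (at p)"
      using contc rm(1) unfolding isCont_def tendsto_iff dist_norm by blast
  qed
  have "((\<lambda>x. W x - W p) \<longlongrightarrow> 0) (at p)"
    by (rule Lim_null_comparison[OF _ errt]) (use near bound in \<open>auto elim: eventually_mono\<close>)
  then have "(W \<longlongrightarrow> W p) (at p)" by (simp add: LIM_zero_iff)
  then have "((\<lambda>x. (chart_map ?c x, W x)) \<longlongrightarrow> (x0, W p)) (at p)"
    using contc by (intro tendsto_Pair) (auto simp: isCont_def x0_def)
  moreover have "isCont (\<lambda>(y, v). D y v) (x0, W p)"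
    using continuous_on_dF_coords[OF c(1)] open_Times[OF op open_UNIV] x0
    unfolding D_def by (subst (asm) continuous_on_eq_continuous_at) auto
  ultimately have "((\<lambda>x. (\<lambda>(y, v). D y v) (chart_map ?c x, W x)) \<longlongrightarrow> (\<lambda>(y, v). D y v) (x0, W p)) (at p)"
    by (rule isCont_tendsto_compose[rotated])
  then have "((\<lambda>x. D (chart_map ?c x) (W x)) \<longlongrightarrow> dF p (grad p)) (at p)"
    by (simp add: x0_def D_def W_def differential_chart[OF c])
  then show ?thesis
    unfolding isCont_def
    by (rule Lim_transform_eventually)
      (use near in \<open>auto simp: D_def W_def differential_chart[OF c(1)] elim!: eventually_mono\<close>)
qed

section \<open>The retraction in charts\<close>

abbreviation "R_chart_dom c d \<equiv> chart_map (tangent_chart \<A> c) ` (chart_dom (tangent_chart \<A> c) \<inter> R -` chart_dom d)"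

abbreviation "R_chart c d \<equiv> chart_map d \<circ> R \<circ> chart_inv (tangent_chart \<A> c)"

lemma
  assumes "c \<in> \<A>" "d \<in> \<A>"
  shows open_R_chart_dom: "open (R_chart_dom c d)"
    and Ck_on_R_chart: "Ck_on (Suc (Suc 0)) (R_chart_dom c d) (R_chart c d)"
  using retraction assms unfolding manifold_retraction_def Ck_map_def tangent_atlas_def numeral_2_eq_2
  by blast+

lemma R_zero: "R (x, 0) = x"
  using retraction unfolding manifold_retraction_def by blast

lemma R_chart_has_derivative:
  assumes "c \<in> \<A>" "d \<in> \<A>" "q \<in> R_chart_dom c d"
  shows "(R_chart c d has_derivative frechet_derivative (R_chart c d) (at q)) (at q)"
  using Ck_on_differentiable[OF Ck_on_R_chart[OF assms(1,2)] assms(3)] frechet_derivative_works by blast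

lemma R_chart_dom_I:
  assumes "c \<in> \<A>" "x \<in> chart_dom c" "R (x, v) \<in> chart_dom d"
  shows "(chart_map c x, tc c x v) \<in> R_chart_dom c d"
  using assms by (intro image_eqI[of _ _ "(x, v)"]) (auto simp: tangent_chart_def)

lemma R_chart_dom_D:
  assumes "c \<in> \<A>" "x \<in> chart_dom c" "(chart_map c x, tc c x v) \<in> R_chart_dom c d"
  shows "R (x, v) \<in> chart_dom d"
proof -
  obtain p where p: "p \<in> chart_dom (tangent_chart \<A> c)" "R p \<in> chart_dom d"
    "chart_map (tangent_chart \<A> c) p = chart_map (tangent_chart \<A> c) (x, v)"
    using assms(3) by (auto simp: tangent_chart_def)
  then have "p = (x, v)"
    using inj_onD[OF inj_on_tangent_chart[OF assms(1)] p(3,1)] assms(2)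
    by (simp add: tangent_chart_def)
  then show ?thesis using p(2) by simp
qed

lemma R_chart_apply:
  "c \<in> \<A> \<Longrightarrow> x \<in> chart_dom c \<Longrightarrow> R_chart c d (chart_map c x, tc c x v) = chart_map d (R (x, v))"
  by (simp add: tangent_chart_inv_map)

text \<open>The fibre derivative of \<open>R\<close> is bounded near \<open>(p, 0)\<close> by
  continuity. The mean value inequality along the segment from \<open>(x, 0)\<close> to
  \<open>(x, u)\<close>, which starts at \<open>R (x, 0) = x\<close>, bounds the displacement
  uniformly in \<open>x\<close>.\<close>

lemma retraction_step_bound:
  assumes c: "c \<in> \<A>" "p \<in> chart_dom c"
  obtains r L where "r > 0" "L \<ge> 0"
    "\<And>x u. x \<in> chart_dom c \<Longrightarrow> norm (chart_map c x - chart_map c p) < r \<Longrightarrow> norm (tc c x u) < r \<Longrightarrow>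
      R (x, u) \<in> chart_dom c \<and>
      norm (chart_map c (R (x, u)) - chart_map c x) \<le> L * norm (tc c x u)"
proof -
  let ?W = "R_chart_dom c c" and ?f = "R_chart c c"
  define D where "D q w = frechet_derivative ?f (at q) w" for q w
  define q0 where "q0 = (chart_map c p, 0 :: 'e)"
  obtain B :: "'e set" where B: "finite B" "\<And>b. b \<in> B \<Longrightarrow> norm b = 1"
    "\<And>x. (\<Sum>b\<in>B. (x \<bullet> b) *\<^sub>R b) = x"
    using findim_orthonormal_basis by metis
  define s where "s q = (\<Sum>b\<in>B. norm (D q (0, b)))" for q
  have "tc c p 0 = 0" by (rule linear_0[OF linear_tangent_coords[OF c]])
  then have q0: "q0 \<in> ?W"
    using R_chart_dom_I[OF c, of 0 c] c R_zero by (simp add: q0_def)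
  have op: "open ?W" by (rule open_R_chart_dom[OF c(1) c(1)])
  have "continuous_on ?W s"
    unfolding s_def D_def
    by (intro continuous_intros Ck_on_frechet_continuous_on[OF Ck_on_R_chart[OF c(1) c(1)]])
  then have "isCont s q0" using continuous_on_eq_continuous_at[OF op] q0 by blast
  then obtain d1 where d1: "d1 > 0" "\<And>q. dist q q0 < d1 \<Longrightarrow> dist (s q) (s q0) < 1"
    unfolding continuous_at_eps_delta by (metis zero_less_one)
  obtain d2 where d2: "d2 > 0" "ball q0 d2 \<subseteq> ?W" using op q0 open_contains_ball by metis
  \<comment> \<open>Halved because the distance of a pair to \<open>q0\<close> is estimated by the
    sum of two norms below \<open>r\<close>.\<close>
  define r where "r = min d1 d2 / 2"
  show thesis
  proof (rule that[of r "s q0 + 1"])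
    show "r > 0" using d1 d2 by (simp add: r_def)
    show "s q0 + 1 \<ge> 0" unfolding s_def by (intro add_nonneg_nonneg sum_nonneg) auto
    fix x u assume x: "x \<in> chart_dom c" and xr: "norm (chart_map c x - chart_map c p) < r"
      and ur: "norm (tc c x u) < r"
    let ?y = "chart_map c x" and ?v = "tc c x u"
    have near: "dist (?y, t *\<^sub>R ?v) q0 < min d1 d2" if "t \<in> {0..1}" for t
    proof -
      have "dist (?y, t *\<^sub>R ?v) q0 = norm (?y - chart_map c p, t *\<^sub>R ?v)"
        by (simp add: q0_def dist_norm)
      also have "\<dots> \<le> norm (?y - chart_map c p) + norm (t *\<^sub>R ?v)" by (rule norm_Pair_le)
      also have "norm (t *\<^sub>R ?v) \<le> norm ?v" using that by (simp add: mult_left_le_one_le)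
      finally show ?thesis using xr ur by (simp add: r_def)
    qed
    have inW: "(?y, t *\<^sub>R ?v) \<in> ?W" if "t \<in> {0..1}" for t
      using near[OF that] d2 by (auto simp: dist_commute)
    have dom: "R (x, u) \<in> chart_dom c"
      using inW[of 1] R_chart_dom_D[OF c(1) x, of u c] by simp
    have der: "((\<lambda>t. ?f (?y, t *\<^sub>R ?v)) has_derivative (\<lambda>h. D (?y, t *\<^sub>R ?v) (0, h *\<^sub>R ?v))) (at t within {0..1})"
      if t: "t \<in> {0..1}" for t
    proof -
      have "((\<lambda>t. (?y, t *\<^sub>R ?v)) has_derivative (\<lambda>h. (0, h *\<^sub>R ?v))) (at t within {0..1})"
        by (auto intro!: derivative_eq_intros)
      from has_derivative_compose[OF this R_chart_has_derivative[OF c(1) c(1) inW[OF t]]]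
      show ?thesis unfolding D_def .
    qed
    have bd: "onorm (\<lambda>h. D (?y, t *\<^sub>R ?v) (0, h *\<^sub>R ?v)) \<le> (s q0 + 1) * norm ?v" if t: "t \<in> {0..1}" for t
    proof (rule onorm_bound)
      show "(s q0 + 1) * norm ?v \<ge> 0" unfolding s_def by (intro mult_nonneg_nonneg add_nonneg_nonneg sum_nonneg) auto
      fix h :: real
      let ?q = "(?y, t *\<^sub>R ?v)"
      have "linear (\<lambda>v. (0 :: 'e, v :: 'e))" by (intro linearI) auto
      then have lin: "linear (\<lambda>v. D ?q (0, v))"
        using linear_compose[OF _ has_derivative_linear[OF R_chart_has_derivative[OF c(1) c(1) inW[OF t]]]]
        unfolding D_def o_def by blast
      have "norm (D ?q (0, h *\<^sub>R ?v)) \<le> norm (h *\<^sub>R ?v) * s ?q"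
        unfolding s_def by (rule norm_linear_le_sum[OF lin B(2,3)])
      also have "\<dots> \<le> norm (h *\<^sub>R ?v) * (s q0 + 1)"
        using d1(2)[of ?q] near[OF t] by (intro mult_left_mono) (auto simp: dist_real_def)
      finally show "norm (D ?q (0, h *\<^sub>R ?v)) \<le> (s q0 + 1) * norm ?v * norm h"
        by (simp add: mult_ac)
    qed
    have "norm (?f (?y, 1 *\<^sub>R ?v) - ?f (?y, 0 *\<^sub>R ?v)) \<le> (s q0 + 1) * norm ?v * norm (1 - 0 :: real)"
      by (rule differentiable_bound[where f = "\<lambda>t. ?f (?y, t *\<^sub>R ?v)", OF _ der bd]) auto
    moreover have "?f (?y, 0) = ?y"
      using R_chart_apply[OF c(1) x, of c 0] R_zero linear_0[OF linear_tangent_coords[OF c(1) x]] by simp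
    ultimately show "R (x, u) \<in> chart_dom c \<and> norm (chart_map c (R (x, u)) - ?y) \<le> (s q0 + 1) * norm ?v"
      using dom R_chart_apply[OF c(1) x, of c u] by simp
  qed
qed

lemma fibre_has_derivative:
  assumes "d = chart_at \<A> (R (x, u))"
  shows "((\<lambda>v. chart_map d (R (x, v))) has_derivative fibre_differential \<A> R x u) (at u)"
proof -
  let ?c = "chart_at \<A> x"
  note c = chart_at[of x] and d = chart_at[of "R (x, u)", folded assms]
  note lin = linear_tangent_coords[OF c]
  have "((\<lambda>v. (chart_map ?c x, tc ?c x v)) has_derivative (\<lambda>v. (0, tc ?c x v))) (at u)"
    by (auto intro!: derivative_eq_intros bounded_linear_imp_has_derivative
        findim_linear_bounded_linear[OF lin])
  from has_derivative_compose[OF this R_chart_has_derivative[OF c(1) d(1) R_chart_dom_I[OF c d(2)]]]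
  have "(\<lambda>v. chart_map d (R (x, v))) differentiable (at u)"
    unfolding R_chart_apply[OF c] differentiable_def by blast
  then have "((\<lambda>v. chart_map d (R (x, v))) has_derivative frechet_derivative (\<lambda>v. chart_map d (R (x, v))) (at u)) (at u)"
    using frechet_derivative_works by blast
  then show ?thesis
    by (simp add: fibre_differential_def differential_def chart_at_vector_space_atlas
        chart_inv_vector_space assms o_def)
qed

lemma linear_fibre_differential: "linear (fibre_differential \<A> R x u)"
  using fibre_has_derivative[OF refl] has_derivative_linear by blast

lemma F_fibre_has_derivative:
  "((\<lambda>v. F (R (x, v))) has_derivative (\<lambda>v. dF (R (x, u)) (fibre_differential \<A> R x u v))) (at u)"
proof -
  define d where "d = chart_at \<A> (R (x, u))"
  let ?c = "chart_at \<A> x"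
  note c = chart_at[of x] and d = chart_at[of "R (x, u)", folded d_def]
  let ?D = "frechet_derivative (F \<circ> chart_inv d) (at (chart_map d (R (x, u))))"
  have "(F \<circ> chart_inv d has_derivative ?D) (at (chart_map d (R (x, u))))"
    by (rule F_chart_has_derivative[OF d(1)]) (use d in simp)
  from has_derivative_compose[OF fibre_has_derivative[OF d_def] this]
  have *: "((\<lambda>v. (F \<circ> chart_inv d) (chart_map d (R (x, v)))) has_derivative
    (\<lambda>v. ?D (fibre_differential \<A> R x u v))) (at u)" .
  \<comment> \<open>In the selected chart at a point, tangent coordinates are the identity.\<close>
  have tcd: "tc d (R (x, u)) w = w" for w
    unfolding tangent_coords_def d_def[symmetric]
    by (simp add: frechet_derivative_at[OF chart_self_has_derivative[OF d], symmetric])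
  \<comment> \<open>\<open>F \<circ> chart_inv d\<close> reproduces \<open>F\<close> only while
    \<open>R (x, v)\<close> stays in the domain of \<open>d\<close>, which holds for
    \<open>v\<close> in an open set around \<open>u\<close>.\<close>
  let ?S = "(\<lambda>v. (chart_map ?c x, tc ?c x v)) -` R_chart_dom ?c d"
  have "open ?S"
    by (intro continuous_open_vimage open_R_chart_dom c d continuous_intros
        linear_continuous_at findim_linear_bounded_linear linear_tangent_coords) 
  moreover have "u \<in> ?S" using R_chart_dom_I[OF c d(2)] by simp
  ultimately have "((\<lambda>v. F (R (x, v))) has_derivative (\<lambda>v. ?D (fibre_differential \<A> R x u v))) (at u)"
    by (rule has_derivative_transform_within_open[OF *])
      (auto dest!: R_chart_dom_D[OF c] simp: chart_inv_map[OF d(1)] simp del: image_iff)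
  then show ?thesis by (simp add: differential_chart[OF d] tcd)
qed

lemma tangent_adjoint:
  assumes "linear L"
  shows "g x v (tangent_adjoint g x y L w) = g y (L v) w"
proof -
  have "linear (\<lambda>v. g y (L v) w)"
    using linear_compose[OF assms linear_metric(2)] by (simp add: o_def)
  from theI'[OF riesz_findim[OF metric_bilinear metric_pos this, of x]]
  show ?thesis unfolding tangent_adjoint_def by (simp add: metric_sym[of x])
qed

text \<open>A single intermediate \<open>s\<close> from the mean value theorem plays the part of the
  integral; bounding it by 1 afterwards leaves the constant \<open>C\<close> instead of
  \<open>C / 2\<close>.\<close>

lemma descent_estimate:
  assumes C: "\<And>x u. x \<in> K \<Longrightarrow> tangent_norm g x u \<le> A \<Longrightarrow>
      tangent_norm g x (tangent_adjoint g x (R (x, u)) (fibre_differential \<A> R x u) (grad (R (x, u))) - grad x)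
      \<le> C * tangent_norm g x u"
    and x: "x \<in> K" and u: "tangent_norm g x u \<le> A"
  shows "\<bar>F (R (x, u)) - F x - dF x u\<bar> \<le> C * (tangent_norm g x u)\<^sup>2"
proof -
  let ?n = "tangent_norm g x u"
  let ?f' = "\<lambda>s. dF (R (x, s *\<^sub>R u)) (fibre_differential \<A> R x (s *\<^sub>R u) u)"
  have der: "((\<lambda>s. F (R (x, s *\<^sub>R u))) has_real_derivative ?f' s) (at s)" for s
  proof -
    have "((\<lambda>s. s *\<^sub>R u) has_derivative (\<lambda>h. h *\<^sub>R u)) (at s)"
      by (auto intro!: derivative_eq_intros)
    from has_derivative_compose[OF this F_fibre_has_derivative[of x "s *\<^sub>R u"]]
    show ?thesis
      by (simp add: has_field_derivative_def linear_scale[OF linear_fibre_differential]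
          linear_scale[OF linear_dF] mult.commute[of _ "?f' s"])
  qed
  obtain s where s: "0 < s" "s < 1" "F (R (x, 1 *\<^sub>R u)) - F (R (x, 0 *\<^sub>R u)) = (1 - 0) * ?f' s"
    using MVT2[OF zero_less_one, of "\<lambda>s. F (R (x, s *\<^sub>R u))" ?f'] der by blast
  let ?w = "tangent_adjoint g x (R (x, s *\<^sub>R u)) (fibre_differential \<A> R x (s *\<^sub>R u)) (grad (R (x, s *\<^sub>R u)))"
  have ns: "tangent_norm g x (s *\<^sub>R u) = s * ?n" using s by (simp add: tangent_norm_scale)
  have "s * ?n \<le> ?n" using s tangent_norm_nonneg[of x u] by (simp add: mult_left_le_one_le)
  then have le: "tangent_norm g x (s *\<^sub>R u) \<le> A" using ns u by simp
  have "?f' s = g x u ?w"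
    using tangent_adjoint[OF linear_fibre_differential, of x u "R (x, s *\<^sub>R u)" x "s *\<^sub>R u"]
      gradient[of "R (x, s *\<^sub>R u)"] by (simp add: metric_sym)
  then have "F (R (x, u)) - F x - dF x u = g x u (?w - grad x)"
    using s gradient[of x u] by (simp add: R_zero metric_linear_simps metric_sym)
  also have "\<bar>\<dots>\<bar> \<le> ?n * tangent_norm g x (?w - grad x)" by (rule metric_Cauchy_Schwarz)
  also have "\<dots> \<le> ?n * (C * (s * ?n))"
    using C[OF x le] ns by (intro mult_left_mono) (auto simp: tangent_norm_nonneg)
  also have "\<dots> = s * (C * ?n\<^sup>2)" by (simp add: power2_eq_square)
  also have "\<dots> \<le> C * ?n\<^sup>2"
  proof -
    \<comment> \<open>No sign of \<open>C\<close> is assumed; the Lipschitz bound at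
      \<open>s *\<^sub>R u\<close> dominates a norm, which forces
      \<open>0 \<le> C * ?n\<close>.\<close>
    have "0 \<le> C * (s * ?n)" using C[OF x le] ns tangent_norm_nonneg order_trans by metis
    then have "0 \<le> s * (C * ?n)" by (simp add: mult_ac)
    then have "0 \<le> C * ?n" using s by (simp only: zero_le_mult_iff) linarith
    then have "0 \<le> C * ?n\<^sup>2" using tangent_norm_nonneg[of x u]
      by (simp add: power2_eq_square mult.assoc[symmetric])
    then show ?thesis using s by (simp add: mult_left_le_one_le)
  qed
  finally show ?thesis .
qed

section \<open>Confinement near a point and vanishing of the gradient\<close>

lemma gradient_norm: "(tangent_norm g x (grad x))\<^sup>2 = dF x (grad x)"
  by (simp add: tangent_norm_power2 gradient)

lemma gradient_norm_nonneg: "dF x (grad x) \<ge> 0"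
  by (simp add: gradient_norm[symmetric])

text \<open>Here \<open>\<rho>\<close> is the coordinate distance to \<open>p\<close> and
  \<open>U\<close> the chart domain; membership in \<open>U\<close> is carried along since
  \<open>\<rho>\<close> has no meaning off the chart. Points start within \<open>r\<close> and are
  controlled up to \<open>2 * r\<close>, which leaves a travel allowance of
  \<open>r\<close>.\<close>

lemma chart_ball_control:
  assumes V: "open V" "p \<in> V"
  obtains \<rho> :: "'m \<Rightarrow> real" and r L U W where "r > 0" "L \<ge> 0" "open W" "p \<in> W"
    "\<And>x. x \<in> W \<Longrightarrow> x \<in> U \<and> \<rho> x < r"
    "\<And>x. x \<in> U \<Longrightarrow> \<rho> x < 2 * r \<Longrightarrow> x \<in> V"
    "\<And>x u. x \<in> U \<Longrightarrow> \<rho> x < 2 * r \<Longrightarrow> tangent_norm g x u < r \<Longrightarrow>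
      R (x, u) \<in> U \<and> \<rho> (R (x, u)) \<le> \<rho> x + L * tangent_norm g x u"
proof -
  let ?c = "chart_at \<A> p"
  note c = chart_at[of p]
  define \<rho> where "\<rho> x = norm (chart_map ?c x - chart_map ?c p)" for x
  obtain r1 m where rm: "r1 > 0" "m > 0" "\<And>x v. x \<in> chart_dom ?c \<Longrightarrow> \<rho> x < r1 \<Longrightarrow>
      m * norm (tc ?c x v) \<le> tangent_norm g x v"
    using tangent_norm_chart_bound[OF c] unfolding \<rho>_def by metis
  obtain r2 L where rL: "r2 > 0" "L \<ge> 0"
    "\<And>x u. x \<in> chart_dom ?c \<Longrightarrow> \<rho> x < r2 \<Longrightarrow> norm (tc ?c x u) < r2 \<Longrightarrow>
      R (x, u) \<in> chart_dom ?c \<and> norm (chart_map ?c (R (x, u)) - chart_map ?c x) \<le> L * norm (tc ?c x u)"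
    using retraction_step_bound[OF c] unfolding \<rho>_def by metis
  have "chart_map ?c p \<in> chart_map ?c ` (chart_dom ?c \<inter> V)" using c V by blast
  then obtain r3 where r3: "r3 > 0" "ball (chart_map ?c p) r3 \<subseteq> chart_map ?c ` (chart_dom ?c \<inter> V)"
    using open_chart_image[OF c(1) V(1)] open_contains_ball by metis
  \<comment> \<open>\<open>2 * r\<close> must respect four radii: the norm comparison
    \<open>r1\<close>, the step bound \<open>r2\<close>, the neighbourhood \<open>r3\<close>, and
    \<open>m * r2\<close>, below which a Riemannian norm forces coordinates shorter than
    \<open>r2\<close>.\<close>
  define r where "r = min (min r1 r2) (min r3 (m * r2)) / 2"
  have r: "r > 0" "2 * r \<le> r1" "2 * r \<le> r2" "2 * r \<le> r3" "2 * r \<le> m * r2"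
    using rm rL r3 by (auto simp: r_def)
  let ?W = "{x \<in> chart_dom ?c. chart_map ?c x \<in> ball (chart_map ?c p) r}"
  show thesis
  proof (rule that[of r "L / m" ?W "chart_dom ?c" \<rho>])
    show "r > 0" "L / m \<ge> 0" using r rL rm by auto
    show "open ?W" by (rule open_chart_preimage[OF c(1) open_ball])
    show "p \<in> ?W" using c r by simp
  next
    fix x assume "x \<in> ?W"
    then show "x \<in> chart_dom ?c \<and> \<rho> x < r" by (simp add: \<rho>_def dist_norm norm_minus_commute)
  next
    fix x assume x: "x \<in> chart_dom ?c" "\<rho> x < 2 * r"
    then have "chart_map ?c x \<in> ball (chart_map ?c p) r3"
      using r by (simp add: \<rho>_def dist_norm norm_minus_commute)
    then obtain y where y: "y \<in> chart_dom ?c" "y \<in> V" "chart_map ?c x = chart_map ?c y"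
      using r3(2) by blast
    then have "x = y" using x(1) chart_inv_map[OF c(1)] by metis
    then show "x \<in> V" using y by simp
  next
    fix x u assume x: "x \<in> chart_dom ?c" "\<rho> x < 2 * r" and u: "tangent_norm g x u < r"
    have n: "m * norm (tc ?c x u) \<le> tangent_norm g x u" using rm(3) x r by simp
    then have "m * norm (tc ?c x u) < m * r2" using u r by linarith
    then have "norm (tc ?c x u) < r2" using rm(2) by simp
    then have *: "R (x, u) \<in> chart_dom ?c"
      "norm (chart_map ?c (R (x, u)) - chart_map ?c x) \<le> L * norm (tc ?c x u)"
      using rL(3) x r by auto
    have "norm (tc ?c x u) \<le> tangent_norm g x u / m" using n rm(2) by (simp add: field_simps)
    then have "L * norm (tc ?c x u) \<le> L * (tangent_norm g x u / m)" using rL(2) by (rule mult_left_mono)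
    moreover have "\<rho> (R (x, u)) \<le> \<rho> x + norm (chart_map ?c (R (x, u)) - chart_map ?c x)"
      using norm_triangle_ineq[of "chart_map ?c x - chart_map ?c p" "chart_map ?c (R (x, u)) - chart_map ?c x"]
      by (simp add: \<rho>_def)
    ultimately show "R (x, u) \<in> chart_dom ?c \<and> \<rho> (R (x, u)) \<le> \<rho> x + L / m * tangent_norm g x u"
      using * by simp
  qed
qed

text \<open>
  The \<open>\<eta>\<close>-weighted summability bounds the distance travelled inside \<open>{y. q y > d}\<close> by \<open>1 / d\<close> times a
  small tail, so a late visit close to \<open>p\<close> is never followed by an exit.
\<close>

lemma gradient_vanishes:
  fixes x :: "nat \<Rightarrow> 'm" and u :: "nat \<Rightarrow> 'e" and \<eta> :: "nat \<Rightarrow> real"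
  assumes K: "compact K" "\<And>t. x t \<in> K"
    and step: "\<And>t. x (Suc t) = R (x t, u t)"
    and bound: "\<And>t. tangent_norm g (x t) (u t) \<le> a * \<eta> t" and a: "a \<ge> 0"
    and null: "(\<lambda>t. tangent_norm g (x t) (u t)) \<longlonglongrightarrow> 0"
    and eta: "\<And>t. \<eta> t \<ge> 0"
    and summable: "summable (\<lambda>t. \<eta> t * dF (x t) (grad (x t)))"
    and diverges: "filterlim (\<lambda>n. \<Sum>t<n. \<eta> t) at_top sequentially"
  shows "(\<lambda>t. dF (x t) (grad (x t))) \<longlonglongrightarrow> 0"
proof (rule order_tendstoI)
  define q where "q y = dF y (grad y)" for y
  fix e :: real
  show "eventually (\<lambda>t. e < dF (x t) (grad (x t))) sequentially" if "e < 0"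
    using that gradient_norm_nonneg by (auto intro!: always_eventually intro: less_le_trans)
  assume e: "0 < e"
  have opq: "open {y. q y < b}" "open {y. q y > b}" for b
    using isCont_gradient_norm continuous_at_imp_continuous_on[of UNIV q]
    unfolding q_def by (auto intro!: open_Collect_less continuous_intros)
  \<comment> \<open>A local statement, to be globalized by compactness of \<open>K\<close>: around a
    point with \<open>q p < e\<close> it is openness, around any other point it holds because late
    visits do not occur.\<close>
  have "\<exists>W. open W \<and> p \<in> W \<and> eventually (\<lambda>t. x t \<in> W \<longrightarrow> q (x t) < e) sequentially" if "p \<in> K" for p
  proof (cases "q p < e")
    case True
    then show ?thesis using opq(1)[of e] by (intro exI[of _ "{y. q y < e}"]) auto
  next
    case False
    define d where "d = e / 2"
    have d: "d > 0" "p \<in> {y. q y > d}" using e False by (auto simp: d_def)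
    obtain r L W U \<rho> where W: "r > 0" "L \<ge> 0" "open W" "p \<in> W"
      "\<And>x. x \<in> W \<Longrightarrow> x \<in> U \<and> \<rho> x < r"
      "\<And>x. x \<in> U \<Longrightarrow> \<rho> x < 2 * r \<Longrightarrow> x \<in> {y. q y > d}"
      "\<And>x u. x \<in> U \<Longrightarrow> \<rho> x < 2 * r \<Longrightarrow> tangent_norm g x u < r \<Longrightarrow>
        R (x, u) \<in> U \<and> \<rho> (R (x, u)) \<le> \<rho> x + L * tangent_norm g x u"
      using chart_ball_control[OF opq(2) d(2)] by metis
    \<comment> \<open>Total step mass below \<open>s / d\<close> costs at most
      \<open>L * a * s / d < r\<close> of travel; the \<open>+ 1\<close> keeps the denominator
      positive when \<open>L * a = 0\<close>.\<close>
    define s where "s = d * r / (L * a + 1)"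
    have La: "L * a \<ge> 0" using W(2) a by simp
    have s: "s > 0" using d W(1) La by (simp add: s_def)
    have "eventually (\<lambda>t. tangent_norm g (x t) (u t) < r) sequentially"
      using order_tendstoD(2)[OF null W(1)] .
    then obtain T1 where T1: "\<And>t. t \<ge> T1 \<Longrightarrow> tangent_norm g (x t) (u t) < r"
      unfolding eventually_sequentially by blast
    obtain T2 where T2: "\<And>m n. m \<ge> T2 \<Longrightarrow> norm (\<Sum>t=m..<n. \<eta> t * q (x t)) < s"
      using summable s unfolding summable_Cauchy q_def by metis
    have "x t0 \<notin> W" if t0: "t0 \<ge> max T1 T2" for t0
    proof
      assume xW: "x t0 \<in> W"
      define S where "S n = (\<Sum>t=t0..<t0 + n. \<eta> t)" for n
      have S0: "S n \<ge> 0" for n by (simp add: S_def sum_nonneg eta)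
      have small: "\<rho> (x t0) + L * a * S n < 2 * r" if "d * S n < s" for n
      proof -
        have "d * S n < d * (r / (L * a + 1))" using that by (simp add: s_def)
        then have "S n < r / (L * a + 1)" using d by (simp only: mult_less_cancel_left_pos)
        then have "S n * (L * a + 1) < r" using La by (simp add: pos_less_divide_eq)
        then have "L * a * S n < r" using S0[of n] by (simp add: algebra_simps)
        then show ?thesis using W(5)[OF xW] by simp
      qed
      \<comment> \<open>The three claims need each other: the step mass bounds the position, the
        position keeps \<open>q\<close> above \<open>d\<close>, and this lets the tail of the
        summable series bound the mass.\<close>
      have inv: "x (t0 + n) \<in> U \<and> \<rho> (x (t0 + n)) \<le> \<rho> (x t0) + L * a * S n
          \<and> d * S n \<le> (\<Sum>t=t0..<t0 + n. \<eta> t * q (x t))" for n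
      proof (induction n)
        case 0
        then show ?case using W(5)[OF xW] by (simp add: S_def)
      next
        case (Suc n)
        let ?y = "x (t0 + n)" and ?u = "u (t0 + n)"
        have "d * S n < s" using Suc T2[of t0 "t0 + n"] t0 by (auto simp: abs_less_iff)
        then have y: "?y \<in> U" "\<rho> ?y < 2 * r" using Suc small[of n] by auto
        have "d \<le> q ?y" using W(6)[OF y] by simp
        then have "\<eta> (t0 + n) * d \<le> \<eta> (t0 + n) * q ?y" using eta by (rule mult_left_mono)
        moreover have "L * tangent_norm g ?y ?u \<le> L * (a * \<eta> (t0 + n))"
          using bound W(2) by (rule mult_left_mono)
        ultimately show ?case
          using W(7)[OF y T1] Suc step[of "t0 + n"] t0 by (simp add: S_def algebra_simps)
      qed
      have Ss: "S n < s / d" for n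
      proof -
        have "d * S n < s" using inv[of n] T2[of t0 "t0 + n"] t0 by (auto simp: abs_less_iff)
        then show ?thesis using d by (simp add: field_simps)
      qed
      \<comment> \<open>The trapped orbit would have total step mass at most \<open>s / d\<close>
        after \<open>t0\<close>, against the divergence of the step sizes.\<close>
      obtain n where n: "n \<ge> t0" "(\<Sum>t<n. \<eta> t) \<ge> s / d + (\<Sum>t<t0. \<eta> t)"
        using diverges unfolding filterlim_at_top eventually_sequentially by (metis linear)
      have "(\<Sum>t<n. \<eta> t) = (\<Sum>t<t0. \<eta> t) + S (n - t0)"
        using sum.atLeastLessThan_concat[of 0 t0 n \<eta>] n(1) by (simp add: S_def lessThan_atLeast0)
      then show False using n(2) Ss[of "n - t0"] by simp
    qed
    then show ?thesis using W(3,4) unfolding eventually_sequentially by blast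
  qed
  then obtain W where W: "\<And>p. p \<in> K \<Longrightarrow> open (W p)" "\<And>p. p \<in> K \<Longrightarrow> p \<in> W p"
    "\<And>p. p \<in> K \<Longrightarrow> eventually (\<lambda>t. x t \<in> W p \<longrightarrow> q (x t) < e) sequentially" by metis
  obtain D where D: "D \<subseteq> K" "finite D" "K \<subseteq> (\<Union>p\<in>D. W p)"
    using compactE_image[OF K(1), of K W] W(1,2) by blast
  have "eventually (\<lambda>t. \<forall>p\<in>D. x t \<in> W p \<longrightarrow> q (x t) < e) sequentially"
    using D W(3) by (intro eventually_ball_finite) auto
  then show "eventually (\<lambda>t. dF (x t) (grad (x t)) < e) sequentially"
    by (rule eventually_mono) (use K(2) D(3) in \<open>auto simp: q_def\<close>)
qed

section \<open>Measurability of vector fields along maps\<close>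

text \<open>
  Measurability of \<open>z \<mapsto> (X z, V z)\<close> into the tangent bundle, phrased so that it is visibly linear in \<open>V\<close>:
  the coordinates are extended by \<open>0\<close> off the chart.
\<close>

definition vector_measurable :: "'z measure \<Rightarrow> ('z \<Rightarrow> 'm) \<Rightarrow> ('z \<Rightarrow> 'e) \<Rightarrow> bool" where
  "vector_measurable Z X V \<longleftrightarrow> X \<in> borel_measurable Z \<and>
    (\<forall>c\<in>\<A>. (\<lambda>z. if X z \<in> chart_dom c then tc c (X z) (V z) else 0) \<in> borel_measurable Z)"

lemma vector_measurable_lincomb:
  assumes X: "X \<in> borel_measurable Z"
    and V: "\<And>j. j \<in> J \<Longrightarrow> vector_measurable Z X (V j)" and a: "a \<in> borel_measurable Z"
  shows "vector_measurable Z X (\<lambda>z. a z *\<^sub>R (\<Sum>j\<in>J. V j z))"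
  unfolding vector_measurable_def
proof (intro conjI ballI X)
  fix c assume c: "c \<in> \<A>"
  have "(\<lambda>z. if X z \<in> chart_dom c then tc c (X z) (a z *\<^sub>R (\<Sum>j\<in>J. V j z)) else 0) =
    (\<lambda>z. a z *\<^sub>R (\<Sum>j\<in>J. if X z \<in> chart_dom c then tc c (X z) (V j z) else 0))"
    using linear_tangent_coords[OF c] by (auto simp: linear_scale linear_sum)
  moreover have "\<dots> \<in> borel_measurable Z"
    using V c a unfolding vector_measurable_def by (intro borel_measurable_scaleR borel_measurable_sum) auto
  ultimately show "(\<lambda>z. if X z \<in> chart_dom c then tc c (X z) (a z *\<^sub>R (\<Sum>j\<in>J. V j z)) else 0) \<in> borel_measurable Z"
    by simp
qed

lemma vector_measurable_cong:
  assumes "\<And>z. z \<in> space Z \<Longrightarrow> X z = X' z" "\<And>z. z \<in> space Z \<Longrightarrow> V z = V' z"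
  shows "vector_measurable Z X V \<longleftrightarrow> vector_measurable Z X' V'"
  unfolding vector_measurable_def
  by (intro arg_cong2[where f = conj] ball_cong measurable_cong refl) (simp_all add: assms)

lemma vector_measurable_compose:
  assumes "vector_measurable Z X V" "f \<in> Y \<rightarrow>\<^sub>M Z"
  shows "vector_measurable Y (\<lambda>y. X (f y)) (\<lambda>y. V (f y))"
  using assms unfolding vector_measurable_def by (auto intro: measurable_compose[OF assms(2)])

lemma tangent_borel_sets:
  assumes "c \<in> \<A>" "open Q"
  shows "{p. fst p \<in> chart_dom c \<and> (chart_map c (fst p), tc c (fst p) (snd p)) \<in> Q} \<in> sets (tangent_borel \<A>)"
proof -
  have "{p \<in> chart_dom (tangent_chart \<A> c). chart_map (tangent_chart \<A> c) p \<in> Q}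
    \<in> {{p \<in> chart_dom c. chart_map c p \<in> U} |c U. c \<in> tangent_atlas \<A> \<and> open U}"
    using assms unfolding tangent_atlas_def by blast
  then have "openin (tangent_topology \<A>) {p \<in> chart_dom (tangent_chart \<A> c). chart_map (tangent_chart \<A> c) p \<in> Q}"
    unfolding tangent_topology_def by (rule topology_generated_by_Basis)
  moreover have "{p \<in> chart_dom (tangent_chart \<A> c). chart_map (tangent_chart \<A> c) p \<in> Q} =
    {p. fst p \<in> chart_dom c \<and> (chart_map c (fst p), tc c (fst p) (snd p)) \<in> Q}"
    by (auto simp: tangent_chart_def)
  ultimately show ?thesis by (auto simp: tangent_borel_def)
qed

text \<open>The atlas may be uncountable; the Lindelof property makes chartwise decompositions
  countable, as measurability requires.\<close>

lemma countable_chart_cover: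
  obtains C where "C \<subseteq> \<A>" "countable C" "(\<Union>c\<in>C. chart_dom c) = UNIV"
proof -
  obtain \<F> where F: "\<F> \<subseteq> chart_dom ` \<A>" "countable \<F>" "\<Union>\<F> = \<Union>(chart_dom ` \<A>)"
    using Lindelof[of "chart_dom ` \<A>"] open_chart_dom by blast
  obtain C where "C \<subseteq> \<A>" "countable C" "\<F> = chart_dom ` C"
    using F(1,2) by (meson countable_subset_image)
  then show thesis using that F(3) charts_cover by auto
qed

lemma tangent_borel_fst: "fst \<in> tangent_borel \<A> \<rightarrow>\<^sub>M (borel :: 'm measure)"
proof (rule borel_measurableI)
  fix O' :: "'m set" assume O': "open O'"
  obtain C where C: "C \<subseteq> \<A>" "countable C" "(\<Union>c\<in>C. chart_dom c) = UNIV"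
    by (rule countable_chart_cover)
  have "fst -` O' \<inter> space (tangent_borel \<A>) = (\<Union>c\<in>C. {p :: 'm \<times> 'e. fst p \<in> chart_dom c \<and>
    (chart_map c (fst p), tc c (fst p) (snd p)) \<in> chart_map c ` (chart_dom c \<inter> O') \<times> UNIV})"
  proof (intro set_eqI iffI)
    fix p :: "'m \<times> 'e" assume "p \<in> fst -` O' \<inter> space (tangent_borel \<A>)"
    moreover obtain c where "c \<in> C" "fst p \<in> chart_dom c" using C(3) by blast
    ultimately show "p \<in> (\<Union>c\<in>C. {p. fst p \<in> chart_dom c \<and>
      (chart_map c (fst p), tc c (fst p) (snd p)) \<in> chart_map c ` (chart_dom c \<inter> O') \<times> UNIV})" by auto
  next
    fix p :: "'m \<times> 'e" assume "p \<in> (\<Union>c\<in>C. {p. fst p \<in> chart_dom c \<and>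
      (chart_map c (fst p), tc c (fst p) (snd p)) \<in> chart_map c ` (chart_dom c \<inter> O') \<times> UNIV})"
    then obtain c y where c: "c \<in> C" "fst p \<in> chart_dom c" "y \<in> chart_dom c" "y \<in> O'"
      "chart_map c (fst p) = chart_map c y" by auto
    then have "fst p = y" using chart_inv_map[of c] C(1) by (metis subsetD)
    then show "p \<in> fst -` O' \<inter> space (tangent_borel \<A>)"
      using c by (simp add: tangent_borel_def space_measure_of_conv)
  qed
  also have "\<dots> \<in> sets (tangent_borel \<A>)"
  proof (rule sets.countable_UN'[OF C(2)], rule image_subsetI)
    fix c assume "c \<in> C"
    then have c: "c \<in> \<A>" using C(1) by blast
    show "{p. fst p \<in> chart_dom c \<and> (chart_map c (fst p), tc c (fst p) (snd p)) \<in>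
      chart_map c ` (chart_dom c \<inter> O') \<times> UNIV} \<in> sets (tangent_borel \<A>)"
      by (rule tangent_borel_sets[OF c open_Times[OF open_chart_image[OF c O'] open_UNIV]])
  qed
  finally show "fst -` O' \<inter> space (tangent_borel \<A>) \<in> sets (tangent_borel \<A>)" .
qed

lemma vector_measurable_tangent_borel: "vector_measurable (tangent_borel \<A>) fst snd"
  unfolding vector_measurable_def
proof (intro conjI ballI tangent_borel_fst borel_measurableI)
  fix c and Q :: "'e set" assume c: "c \<in> \<A>" and Q: "open Q"
  let ?f = "\<lambda>p. if fst p \<in> chart_dom c then tc c (fst p) (snd p) else 0"
  have sp: "space (tangent_borel \<A>) = UNIV" by (simp add: tangent_borel_def space_measure_of_conv)
  let ?D = "{p :: 'm \<times> 'e. fst p \<in> chart_dom c}"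
  have "?D = {p. fst p \<in> chart_dom c \<and> (chart_map c (fst p), tc c (fst p) (snd p)) \<in> UNIV}" by simp
  then have D: "?D \<in> sets (tangent_borel \<A>)" using tangent_borel_sets[OF c open_UNIV] by simp
  \<comment> \<open>Off the chart the coordinates take the default \<open>0\<close>, so the
    complement of the chart enters exactly when \<open>0 \<in> Q\<close>.\<close>
  have "?f -` Q \<inter> space (tangent_borel \<A>) =
    {p. fst p \<in> chart_dom c \<and> (chart_map c (fst p), tc c (fst p) (snd p)) \<in> UNIV \<times> Q} \<union>
    (if 0 \<in> Q then space (tangent_borel \<A>) - ?D else {})"
    by (auto simp: sp split: if_splits)
  also have "\<dots> \<in> sets (tangent_borel \<A>)"
    using tangent_borel_sets[OF c open_Times[OF open_UNIV Q]] D by auto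
  finally show "?f -` Q \<inter> space (tangent_borel \<A>) \<in> sets (tangent_borel \<A>)" .
qed

text \<open>The topology of the bundle is not that of the product, so regularity of \<open>f\<close>
  is expressed through bundle charts. The preimage is cut along a countable chart cover, and on each
  piece \<open>X\<close> and \<open>V\<close> are replaced by their coordinates.\<close>

lemma vector_measurable_apply:
  fixes f :: "'m \<times> 'e \<Rightarrow> 'n::topological_space"
  assumes f: "\<And>c U. c \<in> \<A> \<Longrightarrow> open U \<Longrightarrow>
      open {q \<in> chart_map c ` chart_dom c \<times> UNIV. f (chart_inv (tangent_chart \<A> c) q) \<in> U}"
    and XV: "vector_measurable Z X V"
  shows "(\<lambda>z. f (X z, V z)) \<in> borel_measurable Z"
proof (rule borel_measurableI)
  fix U :: "'n set" assume U: "open U"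
  obtain C where C: "C \<subseteq> \<A>" "countable C" "(\<Union>c\<in>C. chart_dom c) = UNIV"
    by (rule countable_chart_cover)
  have X: "X \<in> borel_measurable Z" using XV by (simp add: vector_measurable_def)
  let ?Q = "\<lambda>c. {q \<in> chart_map c ` chart_dom c \<times> UNIV. f (chart_inv (tangent_chart \<A> c) q) \<in> U}"
  let ?m = "\<lambda>c x. if x \<in> chart_dom c then chart_map c x else 0"
  let ?v = "\<lambda>c z. if X z \<in> chart_dom c then tc c (X z) (V z) else 0"
  have "(\<lambda>z. f (X z, V z)) -` U \<inter> space Z =
    (\<Union>c\<in>C. (X -` chart_dom c \<inter> space Z) \<inter> ((\<lambda>z. (?m c (X z), ?v c z)) -` ?Q c \<inter> space Z))"
  proof (intro set_eqI iffI)
    fix z assume z: "z \<in> (\<lambda>z. f (X z, V z)) -` U \<inter> space Z"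
    obtain c where c: "c \<in> C" "X z \<in> chart_dom c" using C(3) by blast
    then show "z \<in> (\<Union>c\<in>C. (X -` chart_dom c \<inter> space Z) \<inter> ((\<lambda>z. (?m c (X z), ?v c z)) -` ?Q c \<inter> space Z))"
      using z C(1) tangent_chart_inv_map[of c "X z" "V z"] by (intro UN_I[OF c(1)]) auto
  next
    fix z assume "z \<in> (\<Union>c\<in>C. (X -` chart_dom c \<inter> space Z) \<inter> ((\<lambda>z. (?m c (X z), ?v c z)) -` ?Q c \<inter> space Z))"
    then show "z \<in> (\<lambda>z. f (X z, V z)) -` U \<inter> space Z"
      using C(1) tangent_chart_inv_map by fastforce
  qed
  also have "\<dots> \<in> sets Z"
  proof (intro sets.countable_UN' C(2) sets.Int)
    show "(\<lambda>c. (X -` chart_dom c \<inter> space Z) \<inter> ((\<lambda>z. (?m c (X z), ?v c z)) -` ?Q c \<inter> space Z)) ` C \<subseteq> sets Z"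
    proof safe
      fix a b assume "(a, b) \<in> C"
      then have c: "(a, b) \<in> \<A>" using C(1) by blast
      let ?c = "(a, b)"
      have op: "open (chart_dom ?c)" by (rule open_chart_dom[OF c])
      have "?m ?c \<in> borel_measurable borel"
        by (rule borel_measurable_continuous_on_if[OF _ continuous_on_chart_map[OF c]]) (use op in auto)
      then have 1: "(\<lambda>z. ?m ?c (X z)) \<in> borel_measurable Z" by (rule measurable_compose[OF X])
      have 2: "?v ?c \<in> borel_measurable Z" using XV c unfolding vector_measurable_def by blast
      have "(\<lambda>z. (?m ?c (X z), ?v ?c z)) \<in> borel_measurable Z" by (rule borel_measurable_Pair[OF 1 2])
      then show "(X -` chart_dom ?c \<inter> space Z) \<inter> ((\<lambda>z. (?m ?c (X z), ?v ?c z)) -` ?Q ?c \<inter> space Z) \<in> sets Z"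
        using op f[OF c U] by (intro sets.Int measurable_sets[OF X] measurable_sets[of _ Z borel]) auto
    qed
  qed
  finally show "(\<lambda>z. f (X z, V z)) -` U \<inter> space Z \<in> sets Z" .
qed

lemma vector_measurable_continuous_on:
  fixes f :: "'m \<times> 'e \<Rightarrow> 'n::topological_space"
  assumes f: "\<And>c. c \<in> \<A> \<Longrightarrow>
      continuous_on (chart_map c ` chart_dom c \<times> UNIV) (\<lambda>q. f (chart_inv (tangent_chart \<A> c) q))"
    and XV: "vector_measurable Z X V"
  shows "(\<lambda>z. f (X z, V z)) \<in> borel_measurable Z"
proof (rule vector_measurable_apply[OF _ XV])
  fix c and U :: "'n set" assume c: "c \<in> \<A>" and U: "open U"
  show "open {q \<in> chart_map c ` chart_dom c \<times> UNIV. f (chart_inv (tangent_chart \<A> c) q) \<in> U}"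
    using continuous_open_preimage[OF f[OF c] open_Times[OF open_chart_range[OF c] open_UNIV] U]
    by (simp add: vimage_def Int_def)
qed

lemma chart_coords_cases:
  assumes c: "c \<in> \<A>" and q: "q \<in> chart_map c ` chart_dom c \<times> UNIV"
  obtains x v where "x \<in> chart_dom c" "q = (chart_map c x, tc c x v)"
proof -
  obtain x w where x: "q = (chart_map c x, w)" "x \<in> chart_dom c" using q by auto
  obtain v where "w = tc c x v" using bij_tangent_coords[OF c x(2)] by (metis bij_is_surj surjD)
  then show thesis using that x by blast
qed

lemma tangent_norm_measurable:
  assumes "vector_measurable Z X V"
  shows "(\<lambda>z. tangent_norm g (X z) (V z)) \<in> borel_measurable Z"
proof -
  have "(\<lambda>z. (\<lambda>(x, v). tangent_norm g x v) (X z, V z)) \<in> borel_measurable Z"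
  proof (rule vector_measurable_continuous_on[OF _ assms])
    fix c assume c: "c \<in> \<A>"
    show "continuous_on (chart_map c ` chart_dom c \<times> UNIV)
      (\<lambda>q. case chart_inv (tangent_chart \<A> c) q of (x, v) \<Rightarrow> tangent_norm g x v)"
      by (rule continuous_on_eq[OF continuous_on_tangent_norm_coords[OF c]], erule chart_coords_cases[OF c])
        (simp add: tangent_chart_inv_map[OF c] chart_inv_map[OF c])
  qed
  then show ?thesis by simp
qed

lemma dF_measurable:
  assumes "vector_measurable Z X V"
  shows "(\<lambda>z. dF (X z) (V z)) \<in> borel_measurable Z"
proof -
  have "(\<lambda>z. (\<lambda>(x, v). dF x v) (X z, V z)) \<in> borel_measurable Z"
  proof (rule vector_measurable_continuous_on[OF _ assms])
    fix c assume c: "c \<in> \<A>"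
    show "continuous_on (chart_map c ` chart_dom c \<times> UNIV)
      (\<lambda>q. case chart_inv (tangent_chart \<A> c) q of (x, v) \<Rightarrow> dF x v)"
      by (rule continuous_on_eq[OF continuous_on_dF_coords[OF c]], erule chart_coords_cases[OF c])
        (simp add: tangent_chart_inv_map[OF c] differential_chart[OF c])
  qed
  then show ?thesis by simp
qed

text \<open>In coordinates the preimage of an open set is a union over all target charts. It may be
  uncountable, but its members are open.\<close>

lemma R_measurable:
  assumes "vector_measurable Z X V"
  shows "(\<lambda>z. R (X z, V z)) \<in> borel_measurable Z"
proof (rule vector_measurable_apply[OF _ assms])
  fix c and U :: "'m set" assume c: "c \<in> \<A>" and U: "open U"
  let ?P = "\<lambda>d. R_chart_dom c d \<inter> R_chart c d -` (chart_map d ` (chart_dom d \<inter> U))"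
  have "{q \<in> chart_map c ` chart_dom c \<times> UNIV. R (chart_inv (tangent_chart \<A> c) q) \<in> U} = (\<Union>d\<in>\<A>. ?P d)"
  proof (intro set_eqI iffI)
    fix q assume q: "q \<in> {q \<in> chart_map c ` chart_dom c \<times> UNIV. R (chart_inv (tangent_chart \<A> c) q) \<in> U}"
    then obtain x v where xw: "q = (chart_map c x, tc c x v)" "x \<in> chart_dom c"
      using chart_coords_cases[OF c, of q] by blast
    have Rx: "R (x, v) \<in> U" using q by (simp add: xw tangent_chart_inv_map[OF c xw(2)])
    let ?d = "chart_at \<A> (R (x, v))"
    have "q \<in> R_chart_dom c ?d" unfolding xw(1) by (rule R_chart_dom_I[OF c xw(2) chart_at(2)])
    moreover have "R_chart c ?d q = chart_map ?d (R (x, v))" unfolding xw(1) by (rule R_chart_apply[OF c xw(2)])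
    ultimately show "q \<in> (\<Union>d\<in>\<A>. ?P d)" using Rx chart_at[of "R (x, v)"] by (intro UN_I[of ?d]) auto
  next
    fix q assume "q \<in> (\<Union>d\<in>\<A>. ?P d)"
    then obtain d where d: "d \<in> \<A>" and q: "q \<in> R_chart_dom c d" "R_chart c d q \<in> chart_map d ` (chart_dom d \<inter> U)"
      by blast
    obtain x v where xv: "x \<in> chart_dom c" "R (x, v) \<in> chart_dom d" "q = (chart_map c x, tc c x v)"
      using q(1) by (auto simp: tangent_chart_def)
    have "chart_map d (R (x, v)) \<in> chart_map d ` (chart_dom d \<inter> U)"
      using q(2) unfolding xv(3) R_chart_apply[OF c xv(1)] .
    then obtain y where "y \<in> chart_dom d" "y \<in> U" "chart_map d (R (x, v)) = chart_map d y" by auto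
    then have "R (x, v) \<in> U" using xv(2) chart_inv_map[OF d] by metis
    then show "q \<in> {q \<in> chart_map c ` chart_dom c \<times> UNIV. R (chart_inv (tangent_chart \<A> c) q) \<in> U}"
      using xv by (simp add: tangent_chart_inv_map[OF c])
  qed
  moreover have "open (?P d)" if "d \<in> \<A>" for d
    by (intro continuous_open_preimage Ck_on_Suc_continuous_on[OF Ck_on_R_chart[OF c that]]
        open_R_chart_dom c that open_chart_image U)
  ultimately show "open {q \<in> chart_map c ` chart_dom c \<times> UNIV. R (chart_inv (tangent_chart \<A> c) q) \<in> U}"
    by auto
qed

end

section \<open>Histories and martingale differences\<close>

text \<open>The sigma-algebra generated by the variables with index below \<open>n\<close>. Pulling
  back one product makes every event a preimage under a finite tuple, the form in which independence
  of blocks of variables applies.\<close>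

definition history :: "'z measure \<Rightarrow> 'w measure \<Rightarrow> (nat \<Rightarrow> 'z \<Rightarrow> 'w) \<Rightarrow> nat \<Rightarrow> 'z measure" where
  "history M \<mu> \<omega> n = vimage_algebra (space M) (\<lambda>z. restrict (\<lambda>i. \<omega> i z) {..<n}) (PiM {..<n} (\<lambda>_. \<mu>))"

context
  fixes M :: "'z measure" and \<mu> :: "'w measure" and \<omega> :: "nat \<Rightarrow> 'z \<Rightarrow> 'w"
  assumes rv: "\<And>i. \<omega> i \<in> M \<rightarrow>\<^sub>M \<mu>"
begin

lemma restrict_history_space: "(\<lambda>z. restrict (\<lambda>i. \<omega> i z) {..<n}) \<in> space M \<rightarrow> space (PiM {..<n} (\<lambda>_. \<mu>))"
  using measurable_space[OF rv] by (auto simp: space_PiM)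

lemma space_history [simp]: "space (history M \<mu> \<omega> n) = space M"
  by (simp add: history_def)

lemma sets_history: "sets (history M \<mu> \<omega> n) =
  {(\<lambda>z. restrict (\<lambda>i. \<omega> i z) {..<n}) -` A \<inter> space M | A. A \<in> sets (PiM {..<n} (\<lambda>_. \<mu>))}"
  unfolding history_def by (rule sets_vimage_algebra2[OF restrict_history_space])

lemma measurable_history: "\<omega> i \<in> history M \<mu> \<omega> n \<rightarrow>\<^sub>M \<mu>" if "i < n"
proof -
  have "(\<lambda>z. restrict (\<lambda>i. \<omega> i z) {..<n} i) \<in> history M \<mu> \<omega> n \<rightarrow>\<^sub>M \<mu>"
    unfolding history_def
    by (rule measurable_compose[OF measurable_vimage_algebra1[OF restrict_history_space]
          measurable_component_singleton]) (use that in auto)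
  then show ?thesis using that by simp
qed

lemma measurable_from_history: "id \<in> N \<rightarrow>\<^sub>M history M \<mu> \<omega> n"
  if "space N = space M" "\<And>i. i < n \<Longrightarrow> \<omega> i \<in> N \<rightarrow>\<^sub>M \<mu>"
  unfolding history_def
  by (rule measurable_vimage_algebra2) (use that in \<open>auto intro!: measurable_restrict\<close>)

lemma history_subalgebra: "sets (history M \<mu> \<omega> n) \<subseteq> sets M"
  using measurable_sets[OF measurable_from_history[of M n]] rv sets.sets_into_space[of _ "history M \<mu> \<omega> n"]
  by (fastforce simp: Int_absorb2)

lemma history_mono: "sets (history M \<mu> \<omega> m) \<subseteq> sets (history M \<mu> \<omega> n)" if "m \<le> n"
  using measurable_sets[OF measurable_from_history[of "history M \<mu> \<omega> n" m]] that
    measurable_history sets.sets_into_space[of _ "history M \<mu> \<omega> m"]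
  by (fastforce simp: Int_absorb2)

text \<open>With finitely many discrete samples every set of histories is measurable, so mere
  dependence on the history is already measurability. This carries the alternative in which
  \<open>H\<close> need not be measurable in the point.\<close>

lemma measurable_finite_history:
  assumes fin: "finite (space \<mu>)" and sets: "sets \<mu> = Pow (space \<mu>)"
    and f: "\<And>z z'. z \<in> space M \<Longrightarrow> z' \<in> space M \<Longrightarrow> (\<And>i. i < n \<Longrightarrow> \<omega> i z = \<omega> i z') \<Longrightarrow> f z = f z'"
    and sp: "f \<in> space M \<rightarrow> space N"
  shows "f \<in> history M \<mu> \<omega> n \<rightarrow>\<^sub>M N"
proof (rule measurableI)
  let ?h = "\<lambda>z. restrict (\<lambda>i. \<omega> i z) {..<n}"
  let ?P = "PiM {..<n} (\<lambda>_. \<mu>)"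
  fix A
  \<comment> \<open>The histories realised on the event. Since \<open>f\<close> depends on the
    history alone, pulling \<open>?B\<close> back gives nothing new.\<close>
  let ?B = "?h ` (f -` A \<inter> space M)"
  have B: "?B \<subseteq> space ?P" using restrict_history_space by blast
  have "{v} \<in> sets ?P" if "v \<in> space ?P" for v
  proof -
    have v: "v \<in> PiE {..<n} (\<lambda>_. space \<mu>)" using that by (simp add: space_PiM)
    then have "PiE {..<n} (\<lambda>i. {v i}) = {v}"
      by (intro PiE_singleton) (simp add: PiE_def)
    moreover have "PiE {..<n} (\<lambda>i. {v i}) \<in> sets ?P"
      using v sets by (intro sets_PiM_I_finite) auto
    ultimately show ?thesis by simp
  qed
  then have "{v} \<in> sets ?P" if "v \<in> ?B" for v using that B by blast
  moreover have "finite (space ?P)" using fin by (simp add: space_PiM finite_PiE)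
  ultimately have "(\<Union>v\<in>?B. {v}) \<in> sets ?P"
    using finite_subset[OF B] by (intro sets.finite_UN)
  then have "?B \<in> sets ?P" by (simp only: UN_singleton)
  moreover have "f -` A \<inter> space (history M \<mu> \<omega> n) = ?h -` ?B \<inter> space M"
  proof (intro set_eqI iffI)
    fix z assume "z \<in> ?h -` ?B \<inter> space M"
    then obtain z' where z: "z \<in> space M" "z' \<in> space M" "f z' \<in> A" "?h z = ?h z'" by blast
    have "\<omega> i z = \<omega> i z'" if "i < n" for i using fun_cong[OF z(4), of i] that by simp
    then have "f z = f z'" by (rule f[OF z(1,2)])
    then show "z \<in> f -` A \<inter> space (history M \<mu> \<omega> n)" using z by simp
  qed auto
  ultimately show "f -` A \<inter> space (history M \<mu> \<omega> n) \<in> sets (history M \<mu> \<omega> n)"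
    unfolding sets_history by blast
qed (use sp in auto)

end

text \<open>The substitute for conditioning on the past: sample \<open>j\<close> is independent of
  the first \<open>n\<close> variables, so Fubini integrates it out while the past is held
  fixed.\<close>

lemma (in prob_space) history_freezing:
  fixes \<phi> :: "'a \<times> 'w \<Rightarrow> real"
  assumes indep: "indep_vars (\<lambda>_. \<mu>) \<omega> (UNIV :: nat set)" and distr: "distr M \<mu> (\<omega> j) = \<mu>"
    and j: "n \<le> j"
    and \<phi>: "\<phi> \<in> borel_measurable (history M \<mu> \<omega> n \<Otimes>\<^sub>M \<mu>)"
    and bound: "\<And>z w. z \<in> space M \<Longrightarrow> w \<in> space \<mu> \<Longrightarrow> \<bar>\<phi> (z, w)\<bar> \<le> B"
  shows "expectation (\<lambda>z. \<phi> (z, \<omega> j z)) = expectation (\<lambda>z. \<integral>w. \<phi> (z, w) \<partial>\<mu>)"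
proof -
  let ?H = "history M \<mu> \<omega> n" and ?h = "\<lambda>z. restrict (\<lambda>i. \<omega> i z) {..<n}"
  have rv: "\<omega> i \<in> M \<rightarrow>\<^sub>M \<mu>" for i using indep by (auto simp: indep_vars_def)
  note sp = space_history[OF rv]
  have [measurable]: "(\<lambda>z. z) \<in> M \<rightarrow>\<^sub>M ?H"
    using measurable_from_history[OF rv, of M n] rv by (simp add: id_def)
  have ind: "indep_var (PiM {..<n} (\<lambda>_. \<mu>)) ?h (PiM {j} (\<lambda>_. \<mu>)) (\<lambda>z. restrict (\<lambda>i. \<omega> i z) {j})"
    by (rule indep_var_restrict[OF indep]) (use j in auto)
  interpret H: prob_space "distr M ?H (\<lambda>z. z)" by (rule prob_space_distr) simp
  interpret mu: prob_space \<mu> using prob_space_distr[OF rv[of j]] distr by simp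
  \<comment> \<open>The joint law of past and sample is a product law. On a rectangle
    \<open>A \<times> B\<close> the event \<open>A\<close> is a preimage under the tuple of the
    first \<open>n\<close> variables, so independence of the two blocks applies.\<close>
  have "distr M ?H (\<lambda>z. z) \<Otimes>\<^sub>M \<mu> = distr M (?H \<Otimes>\<^sub>M \<mu>) (\<lambda>z. (z, \<omega> j z))"
  proof (rule pair_measure_eqI)
    fix A B assume "A \<in> sets (distr M ?H (\<lambda>z. z))" and B: "B \<in> sets \<mu>"
    then have "A \<in> sets ?H" by simp
    then obtain A' where A': "A' \<in> sets (PiM {..<n} (\<lambda>_. \<mu>))" "A = ?h -` A' \<inter> space M"
      unfolding sets_history[OF rv] by blast
    let ?B = "(\<lambda>f. f j) -` B \<inter> space (PiM {j} (\<lambda>_. \<mu>))"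
    have B': "?B \<in> sets (PiM {j} (\<lambda>_. \<mu>))"
      using B by (intro measurable_sets[OF measurable_component_singleton]) auto
    have eq: "(\<lambda>z. restrict (\<lambda>i. \<omega> i z) {j}) -` ?B \<inter> space M = \<omega> j -` B \<inter> space M"
      using measurable_space[OF rv] by (auto simp: space_PiM)
    let ?h2 = "\<lambda>z. (?h z, restrict (\<lambda>i. \<omega> i z) {j})"
    have "?h2 -` (A' \<times> ?B) \<inter> space M = A \<inter> ((\<lambda>z. restrict (\<lambda>i. \<omega> i z) {j}) -` ?B \<inter> space M)"
      unfolding A'(2) by (intro set_eqI) (simp only: Int_iff vimage_eq mem_Times_iff fst_conv snd_conv, blast)
    then have "prob (A \<inter> (\<omega> j -` B \<inter> space M)) = prob A * prob (\<omega> j -` B \<inter> space M)"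
      using indep_varD[OF ind A'(1) B'] eq A'(2) by simp
    moreover have "prob (\<omega> j -` B \<inter> space M) = measure \<mu> B"
      using measure_distr[OF rv[of j] B] distr by simp
    ultimately have "measure (distr M ?H (\<lambda>z. z)) A * measure \<mu> B = prob (A \<inter> (\<omega> j -` B \<inter> space M))"
      using \<open>A \<in> sets ?H\<close> A'(2) by (simp add: measure_distr Int_absorb2)
    also have "A \<inter> (\<omega> j -` B \<inter> space M) = (\<lambda>z. (z, \<omega> j z)) -` (A \<times> B) \<inter> space M" by auto
    finally show "emeasure (distr M ?H (\<lambda>z. z)) A * emeasure \<mu> B =
        emeasure (distr M (?H \<Otimes>\<^sub>M \<mu>) (\<lambda>z. (z, \<omega> j z))) (A \<times> B)"
      using \<open>A \<in> sets ?H\<close> B rv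
      by (subst emeasure_distr) (auto simp: H.emeasure_eq_measure mu.emeasure_eq_measure emeasure_eq_measure
          ennreal_mult[symmetric])
  qed (auto intro: H.sigma_finite_measure_axioms mu.sigma_finite_measure_axioms cong: sets_pair_measure_cong)
  note eq = this
  interpret P: pair_prob_space "distr M ?H (\<lambda>z. z)" \<mu> ..
  have [measurable]: "\<phi> \<in> borel_measurable (distr M ?H (\<lambda>z. z) \<Otimes>\<^sub>M \<mu>)"
    using \<phi> by (simp cong: measurable_cong_sets)
  have int: "integrable (distr M ?H (\<lambda>z. z) \<Otimes>\<^sub>M \<mu>) \<phi>"
    by (rule P.integrable_const_bound[of _ B])
      (use bound in \<open>auto intro!: AE_I2 simp: space_pair_measure sp\<close>)
  have "expectation (\<lambda>z. \<phi> (z, \<omega> j z)) = integral\<^sup>L (distr M (?H \<Otimes>\<^sub>M \<mu>) (\<lambda>z. (z, \<omega> j z))) \<phi>"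
    by (rule integral_distr[symmetric]) (use rv \<phi> in auto)
  also have "\<dots> = (\<integral>z. (\<integral>w. \<phi> (z, w) \<partial>\<mu>) \<partial>distr M ?H (\<lambda>z. z))"
    unfolding eq[symmetric] by (rule P.integral_fst'[OF int, symmetric])
  also have "\<dots> = expectation (\<lambda>z. \<integral>w. \<phi> (z, w) \<partial>\<mu>)"
    by (rule integral_distr) (use \<phi> in \<open>auto intro!: mu.borel_measurable_lebesgue_integral\<close>)
  finally show ?thesis .
qed

section \<open>Maximal inequality and almost sure summability of martingale differences\<close>

context prob_space
begin

lemma integrable_bounded:
  fixes f :: "'a \<Rightarrow> real"
  assumes "f \<in> borel_measurable M" "\<And>z. z \<in> space M \<Longrightarrow> \<bar>f z\<bar> \<le> B"
  shows "integrable M f"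
  by (rule integrable_const_bound[of _ B]) (use assms in auto)

context
  fixes \<F> :: "nat \<Rightarrow> 'a measure" and \<xi> :: "nat \<Rightarrow> 'a \<Rightarrow> real" and b :: "nat \<Rightarrow> real"
  assumes filtration: "\<And>n. space (\<F> n) = space M" "\<And>n. sets (\<F> n) \<subseteq> sets M"
      "\<And>n. sets (\<F> n) \<subseteq> sets (\<F> (Suc n))"
    and adapted: "\<And>n. \<xi> n \<in> borel_measurable (\<F> (Suc n))"
    and bounded: "\<And>n z. z \<in> space M \<Longrightarrow> \<bar>\<xi> n z\<bar> \<le> b n"
    and orthogonal: "\<And>n Y B. Y \<in> borel_measurable (\<F> n) \<Longrightarrow> (\<And>z. z \<in> space M \<Longrightarrow> \<bar>Y z\<bar> \<le> B)
      \<Longrightarrow> expectation (\<lambda>z. Y z * \<xi> n z) = 0"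
begin

lemma filtration_measurable: "f \<in> borel_measurable (\<F> n) \<Longrightarrow> f \<in> borel_measurable M"
  using measurable_mono[OF order_refl refl filtration(2,1)] by blast

lemma filtration_Suc_measurable: "f \<in> borel_measurable (\<F> n) \<Longrightarrow> f \<in> borel_measurable (\<F> (Suc n))"
  using measurable_mono[OF order_refl refl filtration(3)] filtration(1) by blast

text \<open>
  Kolmogorov's maximal inequality for martingales: the sum is frozen as soon as its absolute value
  reaches \<open>e\<close>, so that exceeding \<open>e\<close> at some time becomes exceeding \<open>e\<close> at the final time.
\<close>

primrec stopped_sum :: "real \<Rightarrow> nat \<Rightarrow> nat \<Rightarrow> 'a \<Rightarrow> real" where
  "stopped_sum e m 0 z = 0"
| "stopped_sum e m (Suc k) z = stopped_sum e m k z + (if \<bar>stopped_sum e m k z\<bar> < e then \<xi> (m + k) z else 0)"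

text \<open>Once frozen, the sum keeps an absolute value of at least \<open>e\<close>; a value below
  \<open>e\<close> therefore certifies that no freezing has happened.\<close>

lemma stopped_sum_eq:
  "\<bar>stopped_sum e m k z\<bar> < e \<Longrightarrow>
    stopped_sum e m k z = (\<Sum>t=m..<m + k. \<xi> t z) \<and> (\<forall>i\<le>k. \<bar>\<Sum>t=m..<m + i. \<xi> t z\<bar> < e)"
proof (induction k)
  case (Suc k)
  then have "\<bar>stopped_sum e m k z\<bar> < e" by (auto split: if_splits)
  then show ?case using Suc by (auto simp: le_Suc_eq)
qed simp

lemma stopped_sum_measurable: "stopped_sum e m k \<in> borel_measurable (\<F> (m + k))"
proof (induction k)
  case (Suc k)
  have [measurable]: "stopped_sum e m k \<in> borel_measurable (\<F> (Suc (m + k)))"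
    using filtration_Suc_measurable[OF Suc] .
  have [measurable]: "\<xi> (m + k) \<in> borel_measurable (\<F> (Suc (m + k)))" by (rule adapted)
  show ?case by simp
qed simp

lemma stopped_sum_bounded: "z \<in> space M \<Longrightarrow> \<bar>stopped_sum e m k z\<bar> \<le> (\<Sum>t=m..<m + k. \<bar>b t\<bar>)"
proof (induction k)
  case (Suc k)
  then show ?case using bounded[OF Suc.prems, of "m + k"] by (auto simp: abs_le_iff)
qed simp

text \<open>The assumption \<open>orthogonal\<close> is the martingale property in weak form. Tested
  against \<open>2 * ?T z * I z\<close>, which is bounded and known before the increment, it removes
  the cross term; the indicator \<open>I\<close> can only shrink the square of the
  increment.\<close>

lemma stopped_sum_second_moment:
  "expectation (\<lambda>z. (stopped_sum e m k z)\<^sup>2) \<le> (\<Sum>t=m..<m + k. expectation (\<lambda>z. (\<xi> t z)\<^sup>2))"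
proof (induction k)
  case (Suc k)
  let ?T = "stopped_sum e m k" and ?B = "\<Sum>t=m..<m + k. \<bar>b t\<bar>"
  define I where "I z = (if \<bar>?T z\<bar> < e then 1 else (0::real))" for z
  have TF [measurable]: "?T \<in> borel_measurable (\<F> (m + k))" by (rule stopped_sum_measurable)
  have TI: "(\<lambda>z. 2 * ?T z * I z) \<in> borel_measurable (\<F> (m + k))" unfolding I_def by measurable
  have [measurable]: "?T \<in> borel_measurable M" by (rule filtration_measurable[OF TF])
  have [measurable]: "\<xi> (m + k) \<in> borel_measurable M" by (rule filtration_measurable[OF adapted])
  have [measurable]: "I \<in> borel_measurable M" unfolding I_def by measurable
  have T2: "\<bar>(?T z)\<^sup>2\<bar> \<le> ?B\<^sup>2" if "z \<in> space M" for z
    using stopped_sum_bounded[OF that, of e m k] by (simp add: abs_le_square_iff[symmetric] sum_nonneg)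
  have x2: "\<bar>(\<xi> (m + k) z)\<^sup>2\<bar> \<le> (b (m + k))\<^sup>2" if "z \<in> space M" for z
    using bounded[OF that, of "m + k"] by (simp add: abs_le_square_iff[symmetric])
  have Tb: "\<bar>2 * ?T z * I z\<bar> \<le> 2 * ?B" if "z \<in> space M" for z
    using stopped_sum_bounded[OF that, of e m k] by (auto simp: I_def abs_mult sum_nonneg)
  have i1: "integrable M (\<lambda>z. (?T z)\<^sup>2)" by (rule integrable_bounded[OF _ T2]) auto
  have i2: "integrable M (\<lambda>z. 2 * ?T z * I z * \<xi> (m + k) z)"
  proof (rule integrable_bounded)
    fix z assume z: "z \<in> space M"
    show "\<bar>2 * ?T z * I z * \<xi> (m + k) z\<bar> \<le> 2 * ?B * b (m + k)"
      unfolding abs_mult[of _ "\<xi> (m + k) z"]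
      using Tb[OF z] bounded[OF z, of "m + k"] by (intro mult_mono) auto
  qed simp
  have i3: "integrable M (\<lambda>z. (\<xi> (m + k) z)\<^sup>2)" by (rule integrable_bounded[OF _ x2]) auto
  have "expectation (\<lambda>z. (stopped_sum e m (Suc k) z)\<^sup>2) \<le>
      expectation (\<lambda>z. (?T z)\<^sup>2 + 2 * ?T z * I z * \<xi> (m + k) z + (\<xi> (m + k) z)\<^sup>2)"
  proof (rule integral_mono)
    show "integrable M (\<lambda>z. (stopped_sum e m (Suc k) z)\<^sup>2)"
    proof (rule integrable_bounded)
      show "(\<lambda>z. (stopped_sum e m (Suc k) z)\<^sup>2) \<in> borel_measurable M"
        using filtration_measurable[OF stopped_sum_measurable[of e m "Suc k"]] by (intro borel_measurable_power)
      show "\<bar>(stopped_sum e m (Suc k) z)\<^sup>2\<bar> \<le> (\<Sum>t=m..<m + Suc k. \<bar>b t\<bar>)\<^sup>2" if "z \<in> space M" for z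
        using stopped_sum_bounded[OF that, of e m "Suc k"]
        by (simp add: abs_le_square_iff[symmetric] sum_nonneg del: stopped_sum.simps)
    qed
  qed (use i1 i2 i3 in \<open>auto simp: I_def power2_sum\<close>)
  also have "\<dots> = expectation (\<lambda>z. (?T z)\<^sup>2) + expectation (\<lambda>z. 2 * ?T z * I z * \<xi> (m + k) z)
      + expectation (\<lambda>z. (\<xi> (m + k) z)\<^sup>2)"
    using i1 i2 i3 by simp
  also have "expectation (\<lambda>z. 2 * ?T z * I z * \<xi> (m + k) z) = 0" by (rule orthogonal[OF TI Tb])
  finally show ?case using Suc by simp
qed simp

text \<open>Markov's inequality for the squared stopped sum settles each finite horizon. The events
  increase with the horizon while the bound stays the same.\<close>

lemma maximal_inequality:
  assumes e: "e > 0" and r: "\<And>k. (\<Sum>t=m..<m + k. expectation (\<lambda>z. (\<xi> t z)\<^sup>2)) \<le> r"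
  shows "prob {z \<in> space M. \<exists>k. \<bar>\<Sum>t=m..<m + k. \<xi> t z\<bar> \<ge> e} \<le> r / e\<^sup>2"
proof -
  define E where "E k = {z \<in> space M. \<exists>i\<le>k. \<bar>\<Sum>t=m..<m + i. \<xi> t z\<bar> \<ge> e}" for k
  have [measurable]: "\<xi> t \<in> borel_measurable M" for t by (rule filtration_measurable[OF adapted])
  have [measurable]: "stopped_sum e m k \<in> borel_measurable M" for k
    by (rule filtration_measurable[OF stopped_sum_measurable])
  have Es: "E k \<in> sets M" for k unfolding E_def by measurable
  have "prob (E k) \<le> r / e\<^sup>2" for k
  proof -
    have "prob (E k) \<le> prob {z \<in> space M. (stopped_sum e m k z)\<^sup>2 \<ge> e\<^sup>2}"
    proof (rule finite_measure_mono)
      show "E k \<subseteq> {z \<in> space M. (stopped_sum e m k z)\<^sup>2 \<ge> e\<^sup>2}"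
      proof
        fix z assume z: "z \<in> E k"
        then have "\<not> \<bar>stopped_sum e m k z\<bar> < e" using stopped_sum_eq[of e m k z] by (fastforce simp: E_def)
        then have "\<bar>e\<bar> \<le> \<bar>stopped_sum e m k z\<bar>" using e by simp
        then show "z \<in> {z \<in> space M. (stopped_sum e m k z)\<^sup>2 \<ge> e\<^sup>2}"
          using z by (simp add: E_def abs_le_square_iff)
      qed
    qed simp
    also have "\<dots> \<le> expectation (\<lambda>z. (stopped_sum e m k z)\<^sup>2) / e\<^sup>2"
    proof (rule integral_Markov_inequality_measure[where A = "{}"])
      show "integrable M (\<lambda>z. (stopped_sum e m k z)\<^sup>2)"
      proof (rule integrable_bounded)
        show "\<bar>(stopped_sum e m k z)\<^sup>2\<bar> \<le> (\<Sum>t=m..<m + k. \<bar>b t\<bar>)\<^sup>2" if "z \<in> space M" for z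
          using stopped_sum_bounded[OF that, of e m k] by (simp add: abs_le_square_iff[symmetric] sum_nonneg)
      qed simp
    qed (use e in auto)
    also have "\<dots> \<le> r / e\<^sup>2"
      using stopped_sum_second_moment[of e m k] r[of k] by (intro divide_right_mono) auto
    finally show ?thesis .
  qed
  moreover have "(\<lambda>k. prob (E k)) \<longlonglongrightarrow> prob (\<Union>k. E k)"
  proof (rule finite_Lim_measure_incseq)
    show "range E \<subseteq> events" using Es by blast
    show "incseq E" unfolding incseq_def E_def by (auto intro: order_trans)
  qed
  ultimately have "prob (\<Union>k. E k) \<le> r / e\<^sup>2"
    by (intro LIMSEQ_le_const2) auto
  moreover have "(\<Union>k. E k) = {z \<in> space M. \<exists>k. \<bar>\<Sum>t=m..<m + k. \<xi> t z\<bar> \<ge> e}"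
    by (auto simp: E_def)
  ultimately show ?thesis by simp
qed

text \<open>The Cauchy criterion at level \<open>e\<close> fails from \<open>m\<close> on with
  probability at most \<open>r m / e\<^sup>2\<close>, where \<open>r m\<close> is the tail of the
  second moments. As this tends to 0, failing for every \<open>m\<close> has probability
  zero.\<close>

lemma martingale_differences_summable:
  assumes C: "\<And>n. (\<Sum>t<n. expectation (\<lambda>z. (\<xi> t z)\<^sup>2)) \<le> C"
  shows "AE z in M. summable (\<lambda>t. \<xi> t z)"
proof -
  let ?v = "\<lambda>t. expectation (\<lambda>z. (\<xi> t z)\<^sup>2)"
  have [measurable]: "\<xi> t \<in> borel_measurable M" for t by (rule filtration_measurable[OF adapted])
  have sv: "summable ?v"
    by (rule summableI_nonneg_bounded[of _ C]) (use C in auto)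
  define r where "r m = suminf (\<lambda>t. ?v (t + m))" for m
  have r0: "r \<longlonglongrightarrow> 0"
    unfolding r_def by (rule suminf_exist_split2[OF sv])
  have rle: "(\<Sum>t=m..<m + k. ?v t) \<le> r m" for m k
  proof -
    have "(\<Sum>t=m..<m + k. ?v t) = (\<Sum>t<k. ?v (t + m))"
      using sum.shift_bounds_nat_ivl[of ?v 0 m k] by (simp add: lessThan_atLeast0 add.commute)
    also have "\<dots> \<le> r m" unfolding r_def
      using summable_ignore_initial_segment[OF sv] by (intro sum_le_suminf) auto
    finally show ?thesis .
  qed
  have "AE z in M. \<exists>m. \<forall>k. \<bar>\<Sum>t=m..<m + k. \<xi> t z\<bar> < e" if e: "e > 0" for e
  proof -
    let ?E = "\<lambda>m. {z \<in> space M. \<exists>k. \<bar>\<Sum>t=m..<m + k. \<xi> t z\<bar> \<ge> e}"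
    have Es: "(\<Inter>m. ?E m) \<in> sets M" by measurable
    have "prob (\<Inter>m. ?E m) \<le> r m / e\<^sup>2" for m
    proof -
      have "prob (\<Inter>m. ?E m) \<le> prob (?E m)" by (rule finite_measure_mono) (auto simp: INT_lower)
      also have "\<dots> \<le> r m / e\<^sup>2" by (rule maximal_inequality[OF e rle])
      finally show ?thesis .
    qed
    moreover have "(\<lambda>m. r m / e\<^sup>2) \<longlonglongrightarrow> 0" using r0 by (rule tendsto_divide_zero)
    ultimately have "prob (\<Inter>m. ?E m) \<le> 0" by (intro LIMSEQ_le_const) auto
    then have "prob (\<Inter>m. ?E m) = 0" by (simp add: measure_le_0_iff)
    then have "AE z in M. z \<notin> (\<Inter>m. ?E m)" using Es by (subst (asm) prob_eq_0) auto
    then show ?thesis by (rule AE_mp) (auto simp: not_le intro!: AE_I2)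
  qed
  \<comment> \<open>Countably many levels \<open>1 / real (Suc j)\<close>, so that the exceptional
    null sets can be united.\<close>
  then have "AE z in M. \<forall>j :: nat. \<exists>m. \<forall>k. \<bar>\<Sum>t=m..<m + k. \<xi> t z\<bar> < 1 / real (Suc j)"
    by (simp add: AE_all_countable)
  then show ?thesis
  proof (rule AE_mp, intro AE_I2 impI)
    fix z assume *: "\<forall>j :: nat. \<exists>m. \<forall>k. \<bar>\<Sum>t=m..<m + k. \<xi> t z\<bar> < 1 / real (Suc j)"
    show "summable (\<lambda>t. \<xi> t z)"
      unfolding summable_Cauchy
    proof (intro allI impI)
      fix e :: real assume "e > 0"
      \<comment> \<open>Half of \<open>e\<close>, because a block from \<open>m\<close> to
        \<open>n\<close> is the difference of two blocks starting at \<open>N\<close>.\<close>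
      then obtain j where j: "1 / real (Suc j) < e / 2" using nat_approx_posE[of "e / 2"] by auto
      obtain N where N: "\<And>k. \<bar>\<Sum>t=N..<N + k. \<xi> t z\<bar> < 1 / real (Suc j)" using * by blast
      have "norm (\<Sum>t=m..<n. \<xi> t z) < e" if "m \<ge> N" for m n
      proof (cases "m \<le> n")
        case True
        have "(\<Sum>t=N..<n. \<xi> t z) = (\<Sum>t=N..<m. \<xi> t z) + (\<Sum>t=m..<n. \<xi> t z)"
          using sum.atLeastLessThan_concat[OF that True, of "\<lambda>t. \<xi> t z"] by simp
        then show ?thesis using N[of "n - N"] N[of "m - N"] that True j by simp
      qed (use \<open>e > 0\<close> in simp)
      then show "\<exists>N. \<forall>m\<ge>N. \<forall>n. norm (\<Sum>t=m..<n. \<xi> t z) < e" by blast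
    qed
  qed
qed

end
end

section \<open>The stochastic gradient iteration\<close>

locale stochastic_gradient = retraction_objective \<A> g R F
  for \<A> :: "('m::{t2_space, second_countable_topology}, 'e::findim_inner) chart set"
    and g :: "'m \<Rightarrow> 'e \<Rightarrow> 'e \<Rightarrow> real" and R F +
  fixes K :: "'m set" and A :: real and \<mu> :: "'w measure" and H :: "'m \<times> 'w \<Rightarrow> 'm \<times> 'e"
    and N :: "'z measure" and \<omega> :: "nat \<Rightarrow> 'z \<Rightarrow> 'w" and S :: "nat \<Rightarrow> nat"
    and x0 :: 'm and x :: "nat \<Rightarrow> 'z \<Rightarrow> 'm"
  assumes K_compact: "compact K"
    and A_pos: "A > 0"
    and grad_Lipschitz: "R_Lipschitz_on \<A> g R grad K A"
    and prob_mu: "prob_space \<mu>"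
    and H_field: "\<And>w x. w \<in> space \<mu> \<Longrightarrow> fst (H (x, w)) = x"
    and H_meas: "(finite (space \<mu>) \<and> sets \<mu> = Pow (space \<mu>)) \<or>
                 H \<in> (borel \<Otimes>\<^sub>M \<mu>) \<rightarrow>\<^sub>M tangent_borel \<A>"
    and H_mean: "\<And>x. has_bochner_integral \<mu> (\<lambda>w. snd (H (x, w))) (grad x)"
    and H_bound: "\<And>x w. x \<in> K \<Longrightarrow> w \<in> space \<mu> \<Longrightarrow> tangent_norm g x (snd (H (x, w))) \<le> A"
    and prob_N: "prob_space N"
    and indep: "prob_space.indep_vars N (\<lambda>_. \<mu>) \<omega> UNIV"
    and distr: "\<And>t. distr N \<mu> (\<omega> t) = \<mu>"
    and S_mono: "strict_mono S"
    and start: "\<And>z. z \<in> space N \<Longrightarrow> x 0 z = x0"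
    and in_K: "\<And>z t. z \<in> space N \<Longrightarrow> x t z \<in> K"
begin

sublocale N: prob_space N by (rule prob_N)

sublocale mu: prob_space \<mu> by (rule prob_mu)

abbreviation "gradsq y \<equiv> dF y (grad y)"

definition direction :: "nat \<Rightarrow> 'z \<Rightarrow> 'e" where
  "direction t z = (1 / real (S (Suc t) - S t)) *\<^sub>R (\<Sum>j\<in>{S t..<S (Suc t)}. snd (H (x t z, \<omega> j z)))"

definition dirsq :: "nat \<Rightarrow> 'z \<Rightarrow> real" where
  "dirsq t z = (tangent_norm g (x t z) (direction t z))\<^sup>2"

definition slope :: "nat \<Rightarrow> 'z \<Rightarrow> real" where
  "slope t z = dF (x t z) (direction t z)"

text \<open>All samples consumed before step \<open>t\<close>: the iterate \<open>x t\<close>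
  depends on these, \<open>direction t\<close> on one batch more.\<close>

abbreviation "\<F> t \<equiv> history N \<mu> \<omega> (S t)"

lemma rv: "\<omega> j \<in> N \<rightarrow>\<^sub>M \<mu>"
  using indep by (auto simp: N.indep_vars_def)

lemma rv_space: "z \<in> space N \<Longrightarrow> \<omega> j z \<in> space \<mu>"
  by (rule measurable_space[OF rv])

lemma S_Suc: "S t < S (Suc t)"
  using S_mono by (simp add: strict_mono_Suc_iff)

lemma filtration: "space (\<F> t) = space N" "sets (\<F> t) \<subseteq> sets N" "sets (\<F> t) \<subseteq> sets (\<F> (Suc t))"
  using history_subalgebra[OF rv] history_mono[OF rv less_imp_le[OF S_Suc]] by (simp_all add: space_history[OF rv])

lemma filtration_measurableD:
  "f \<in> borel_measurable (\<F> t) \<Longrightarrow> f \<in> borel_measurable N"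
  "f \<in> borel_measurable (\<F> t) \<Longrightarrow> f \<in> borel_measurable (\<F> (Suc t))"
  using measurable_mono[OF order_refl refl filtration(2,1)] measurable_mono[OF order_refl refl filtration(3)] filtration(1)
  by blast+

lemma mean_derivative:
  "integrable \<mu> (\<lambda>w. dF y (snd (H (y, w))))" "(\<integral>w. dF y (snd (H (y, w))) \<partial>\<mu>) = gradsq y"
  using has_bochner_integral_bounded_linear[OF findim_linear_bounded_linear[OF linear_dF] H_mean, of y y]
  by (auto simp: has_bochner_integral_iff)

lemma derivative_le: "\<bar>dF y v\<bar> \<le> tangent_norm g y (grad y) * tangent_norm g y v"
  using metric_Cauchy_Schwarz[of y "grad y" v] by (simp add: gradient)

text \<open>Pairing the mean of \<open>H\<close> with the gradient itself gives
  \<open>?n\<^sup>2 \<le> ?n * A\<close>, so only a scalar integral has to be estimated.\<close>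

lemma gradient_norm_le: "y \<in> K \<Longrightarrow> tangent_norm g y (grad y) \<le> A"
proof -
  assume y: "y \<in> K"
  let ?n = "tangent_norm g y (grad y)"
  have "?n\<^sup>2 = (\<integral>w. dF y (snd (H (y, w))) \<partial>\<mu>)" by (simp add: mean_derivative gradient_norm)
  also have "\<dots> \<le> (\<integral>w. ?n * A \<partial>\<mu>)"
  proof (rule integral_mono)
    fix w assume w: "w \<in> space \<mu>"
    have "dF y (snd (H (y, w))) \<le> ?n * tangent_norm g y (snd (H (y, w)))" using derivative_le abs_le_D1 by blast
    also have "\<dots> \<le> ?n * A" using H_bound[OF y w] tangent_norm_nonneg by (rule mult_left_mono)
    finally show "dF y (snd (H (y, w))) \<le> ?n * A" .
  qed (auto simp: mean_derivative)
  finally have "?n * ?n \<le> ?n * A" by (simp add: mu.prob_space power2_eq_square)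
  then show ?thesis using A_pos tangent_norm_nonneg[of y "grad y"] by (cases "?n = 0") auto
qed

lemma gradsq_le: "y \<in> K \<Longrightarrow> gradsq y \<le> A\<^sup>2"
  using power_mono[OF gradient_norm_le tangent_norm_nonneg, of y 2] by (simp add: gradient_norm)

lemma derivative_bound:
  assumes "y \<in> K" "tangent_norm g y v \<le> A"
  shows "\<bar>dF y v\<bar> \<le> A\<^sup>2"
  using order_trans[OF derivative_le mult_mono[OF gradient_norm_le[OF assms(1)] assms(2)]] A_pos tangent_norm_nonneg
  by (simp add: power2_eq_square)

lemma direction_norm_le:
  assumes z: "z \<in> space N"
  shows "tangent_norm g (x t z) (direction t z) \<le> A"
proof -
  let ?J = "{S t..<S (Suc t)}"
  have "tangent_norm g (x t z) (\<Sum>j\<in>?J. snd (H (x t z, \<omega> j z))) \<le> (\<Sum>j\<in>?J. A)"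
    by (rule order_trans[OF tangent_norm_sum sum_mono]) (use H_bound in_K z rv_space in auto)
  then show ?thesis
    using S_Suc[of t] by (simp add: direction_def tangent_norm_scale field_simps)
qed

lemma slope_bound: "z \<in> space N \<Longrightarrow> \<bar>slope t z\<bar> \<le> A\<^sup>2"
  unfolding slope_def by (rule derivative_bound[OF in_K direction_norm_le])

text \<open>One factor is kept as \<open>dirsq\<close> instead of being bounded by a constant: the
  weighted sums of \<open>dirsq\<close> are what the adaptive step sizes control.\<close>

lemma slope_power2_le:
  assumes z: "z \<in> space N"
  shows "(slope t z)\<^sup>2 \<le> A\<^sup>2 * dirsq t z"
proof -
  have "\<bar>slope t z\<bar> \<le> A * tangent_norm g (x t z) (direction t z)"
    unfolding slope_def
    using order_trans[OF derivative_le mult_right_mono[OF gradient_norm_le[OF in_K[OF z]] tangent_norm_nonneg]] .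
  then have "\<bar>slope t z\<bar>\<^sup>2 \<le> (A * tangent_norm g (x t z) (direction t z))\<^sup>2" by (rule power_mono) simp
  then show ?thesis by (simp add: dirsq_def power_mult_distrib)
qed

lemma dirsq_bound: "z \<in> space N \<Longrightarrow> dirsq t z \<le> A\<^sup>2" "dirsq t z \<ge> 0"
  unfolding dirsq_def by (auto intro!: power_mono direction_norm_le tangent_norm_nonneg)

end

text \<open>The second argument of \<open>e\<close> is the accumulated squared direction norm. The
  bound by 1 keeps steps inside the Lipschitz radius, and \<open>B\<close> is deterministic, so the
  pathwise bound passes to expectations.\<close>

locale adaptive_stochastic_gradient = stochastic_gradient \<A> g R F K A \<mu> H N \<omega> S x0 x
  for \<A> :: "('m::{t2_space, second_countable_topology}, 'e::findim_inner) chart set"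
    and g :: "'m \<Rightarrow> 'e \<Rightarrow> 'e \<Rightarrow> real" and R F
    and K :: "'m set" and A :: real and \<mu> :: "'w measure" and H :: "'m \<times> 'w \<Rightarrow> 'm \<times> 'e"
    and N :: "'z measure" and \<omega> :: "nat \<Rightarrow> 'z \<Rightarrow> 'w" and S :: "nat \<Rightarrow> nat"
    and x0 :: 'm and x :: "nat \<Rightarrow> 'z \<Rightarrow> 'm" +
  fixes e :: "nat \<Rightarrow> real \<Rightarrow> real" and B :: real
  assumes e_range: "\<And>t s. s \<ge> 0 \<Longrightarrow> 0 < e t s" "\<And>t s. s \<ge> 0 \<Longrightarrow> e t s \<le> 1"
    and e_measurable: "\<And>t. e t \<in> borel_measurable borel"
    and step: "\<And>z t. z \<in> space N \<Longrightarrow>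
      x (Suc t) z = R (x t z, - (e t (\<Sum>k<t. dirsq k z) *\<^sub>R direction t z))"
    and steps_summable: "\<And>z n. z \<in> space N \<Longrightarrow>
      (\<Sum>t<n. (e t (\<Sum>k<t. dirsq k z))\<^sup>2 * dirsq t z) \<le> B"
    and steps_diverge: "\<And>z. z \<in> space N \<Longrightarrow>
      filterlim (\<lambda>n. \<Sum>t<n. e t (\<Sum>k<t. dirsq k z)) at_top sequentially"
begin

definition eta :: "nat \<Rightarrow> 'z \<Rightarrow> real" where
  "eta t z = e t (\<Sum>k<t. dirsq k z)"

lemma eta_range: "0 < eta t z" "eta t z \<le> 1"
  unfolding eta_def by (auto intro!: e_range sum_nonneg dirsq_bound)

text \<open>Supplies the dependence on the history for \<open>measurable_finite_history\<close>.
  Iterates and squared norms go through one induction because the step size reads the earlier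
  norms.\<close>

lemma finite_case_determined:
  assumes "z \<in> space N" "z' \<in> space N"
  shows "(\<And>i. i < S t \<Longrightarrow> \<omega> i z = \<omega> i z') \<Longrightarrow> x t z = x t z' \<and> (\<forall>k<t. dirsq k z = dirsq k z')"
proof (induction t)
  case (Suc t)
  have "x t z = x t z'" "\<forall>k<t. dirsq k z = dirsq k z'"
    using Suc S_Suc[of t] by auto
  moreover have "direction t z = direction t z'"
    using Suc(2) \<open>x t z = x t z'\<close> by (simp add: direction_def)
  ultimately show ?case
    using step[of z t] step[of z' t] assms by (auto simp: dirsq_def less_Suc_eq)
qed (use assms start in auto)

lemma vector_measurable_H:
  assumes "H \<in> (borel \<Otimes>\<^sub>M \<mu>) \<rightarrow>\<^sub>M tangent_borel \<A>"
  shows "vector_measurable (borel \<Otimes>\<^sub>M \<mu>) fst (\<lambda>p. snd (H p))"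
proof -
  have "vector_measurable (borel \<Otimes>\<^sub>M \<mu>) (\<lambda>p. fst (H p)) (\<lambda>p. snd (H p))"
    by (rule vector_measurable_compose[OF vector_measurable_tangent_borel assms])
  then show ?thesis
    by (subst vector_measurable_cong[where X' = "\<lambda>p. fst (H p)" and V' = "\<lambda>p. snd (H p)"])
      (auto simp: space_pair_measure H_field)
qed

lemma adapted_borel:
  assumes H: "H \<in> (borel \<Otimes>\<^sub>M \<mu>) \<rightarrow>\<^sub>M tangent_borel \<A>"
  shows "x t \<in> borel_measurable (\<F> t) \<and> (\<forall>k<t. dirsq k \<in> borel_measurable (\<F> t))"
    and "vector_measurable (\<F> (Suc t)) (x t) (direction t)"
proof -
  have dir: "vector_measurable (\<F> (Suc t)) (x t) (direction t)" if xt: "x t \<in> borel_measurable (\<F> t)" for t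
    unfolding direction_def
  proof (rule vector_measurable_lincomb)
    show xt': "x t \<in> borel_measurable (\<F> (Suc t))" by (rule filtration_measurableD(2)[OF xt])
    fix j assume "j \<in> {S t..<S (Suc t)}"
    then have "\<omega> j \<in> \<F> (Suc t) \<rightarrow>\<^sub>M \<mu>" using measurable_history[OF rv] by simp
    then have "(\<lambda>z. (x t z, \<omega> j z)) \<in> \<F> (Suc t) \<rightarrow>\<^sub>M borel \<Otimes>\<^sub>M \<mu>"
      by (rule measurable_Pair[OF xt'])
    from vector_measurable_compose[OF vector_measurable_H[OF H] this]
    show "vector_measurable (\<F> (Suc t)) (x t) (\<lambda>z. snd (H (x t z, \<omega> j z)))" by simp
  qed simp
  show *: "x t \<in> borel_measurable (\<F> t) \<and> (\<forall>k<t. dirsq k \<in> borel_measurable (\<F> t))" for t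
  proof (induction t)
    case 0
    have "x 0 \<in> borel_measurable (\<F> 0) \<longleftrightarrow> (\<lambda>_. x0) \<in> borel_measurable (\<F> 0)"
      by (rule measurable_cong) (simp add: filtration start)
    then show ?case by simp
  next
    case (Suc t)
    note d = dir[OF conjunct1[OF Suc]]
    have [measurable]: "dirsq k \<in> borel_measurable (\<F> (Suc t))" if "k < Suc t" for k
    proof (cases "k = t")
      case True
      show ?thesis unfolding True dirsq_def by (intro borel_measurable_power tangent_norm_measurable d)
    next
      case False
      then show ?thesis using that Suc by (intro filtration_measurableD(2)) auto
    qed
    have x: "x t \<in> borel_measurable (\<F> (Suc t))" using Suc by (intro filtration_measurableD(2)) auto
    have "(\<lambda>z. \<Sum>k<t. dirsq k z) \<in> borel_measurable (\<F> (Suc t))" by (intro borel_measurable_sum) simp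
    then have "eta t \<in> borel_measurable (\<F> (Suc t))"
      unfolding eta_def by (rule measurable_compose[OF _ e_measurable])
    \<comment> \<open>The scalar multiple is written as a one-term sum to fit the lemma on linear
      combinations.\<close>
    then have "vector_measurable (\<F> (Suc t)) (x t) (\<lambda>z. - eta t z *\<^sub>R (\<Sum>j\<in>{0::nat}. direction t z))"
      by (intro vector_measurable_lincomb[OF x] d borel_measurable_uminus)
    from R_measurable[OF this]
    have "(\<lambda>z. R (x t z, - (eta t z *\<^sub>R direction t z))) \<in> borel_measurable (\<F> (Suc t))" by simp
    moreover have "x (Suc t) \<in> borel_measurable (\<F> (Suc t)) \<longleftrightarrow>
      (\<lambda>z. R (x t z, - (eta t z *\<^sub>R direction t z))) \<in> borel_measurable (\<F> (Suc t))"
      by (rule measurable_cong) (simp add: filtration step eta_def)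
    ultimately show ?case by simp
  qed
  show "vector_measurable (\<F> (Suc t)) (x t) (direction t)" using dir * by blast
qed

text \<open>The two alternatives of \<open>H_meas\<close> are merged here; the measurability needed
  for the noise is drawn from these facts alone.\<close>

lemma
  shows derivative_measurable:
    "(\<lambda>(z, w). dF (x t z) (snd (H (x t z, w)))) \<in> borel_measurable (\<F> t \<Otimes>\<^sub>M \<mu>)"
    and eta_measurable: "eta t \<in> borel_measurable (\<F> t)"
    and slope_measurable: "slope t \<in> borel_measurable (\<F> (Suc t))"
    and dirsq_measurable: "dirsq t \<in> borel_measurable (\<F> (Suc t))"
proof -
  consider (fin) "finite (space \<mu>)" "sets \<mu> = Pow (space \<mu>)" | (bor) "H \<in> (borel \<Otimes>\<^sub>M \<mu>) \<rightarrow>\<^sub>M tangent_borel \<A>"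
    using H_meas by blast
  note cases = this
  have hm: "f \<in> borel_measurable (\<F> t)"
    if "finite (space \<mu>)" "sets \<mu> = Pow (space \<mu>)"
      "\<And>z z'. z \<in> space N \<Longrightarrow> z' \<in> space N \<Longrightarrow> (\<And>i. i < S t \<Longrightarrow> \<omega> i z = \<omega> i z') \<Longrightarrow> f z = f z'"
    for f :: "'z \<Rightarrow> real" and t
    by (rule measurable_finite_history[OF rv that(1,2)], rule that(3)) auto
  have dir: "direction t z = direction t z'"
    if "z \<in> space N" "z' \<in> space N" "\<And>i. i < S (Suc t) \<Longrightarrow> \<omega> i z = \<omega> i z'" for z z'
    using that finite_case_determined[OF that(1,2), of t] S_Suc[of t] by (simp add: direction_def)
  have xt: "x t z = x t z'"
    if "z \<in> space N" "z' \<in> space N" "\<And>i. i < S (Suc t) \<Longrightarrow> \<omega> i z = \<omega> i z'" for z z'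
    using that finite_case_determined[OF that(1,2), of t] S_Suc[of t] by simp
  show "(\<lambda>(z, w). dF (x t z) (snd (H (x t z, w)))) \<in> borel_measurable (\<F> t \<Otimes>\<^sub>M \<mu>)"
  proof (cases rule: cases)
    case fin
    \<comment> \<open>For a finite discrete sample space, joint measurability follows from that of
      each section at fixed \<open>w\<close>.\<close>
    have "(\<lambda>p. (\<lambda>w p. dF (x t (fst p)) (snd (H (x t (fst p), w)))) (snd p) p) \<in> borel_measurable (\<F> t \<Otimes>\<^sub>M \<mu>)"
    proof (rule measurable_compose_countable'[where I = "space \<mu>"])
      fix w
      have "(\<lambda>z. dF (x t z) (snd (H (x t z, w)))) \<in> borel_measurable (\<F> t)"
      proof (rule hm[OF fin])
        fix z z' assume zz: "z \<in> space N" "z' \<in> space N" "\<And>i. i < S t \<Longrightarrow> \<omega> i z = \<omega> i z'"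
        show "dF (x t z) (snd (H (x t z, w))) = dF (x t z') (snd (H (x t z', w)))"
          using finite_case_determined[OF zz] by simp
      qed
      then show "(\<lambda>p. dF (x t (fst p)) (snd (H (x t (fst p), w)))) \<in> borel_measurable (\<F> t \<Otimes>\<^sub>M \<mu>)"
        by (rule measurable_compose[OF measurable_fst])
    next
      have "sets \<mu> = sets (count_space (space \<mu>))" using fin by simp
      then show "snd \<in> \<F> t \<Otimes>\<^sub>M \<mu> \<rightarrow>\<^sub>M count_space (space \<mu>)"
        using measurable_cong_sets[OF refl, of \<mu> "count_space (space \<mu>)" "\<F> t \<Otimes>\<^sub>M \<mu>"] measurable_snd by blast
      show "countable (space \<mu>)" using fin by (simp add: countable_finite)
    qed
    then show ?thesis by (simp add: case_prod_unfold)
  next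
    case bor
    have "(\<lambda>p. (x t (fst p), snd p)) \<in> \<F> t \<Otimes>\<^sub>M \<mu> \<rightarrow>\<^sub>M borel \<Otimes>\<^sub>M \<mu>"
      by (intro measurable_Pair measurable_snd measurable_compose[OF measurable_fst] conjunct1[OF adapted_borel(1)[OF bor]])
    from vector_measurable_compose[OF vector_measurable_H[OF bor] this]
    show ?thesis by (auto dest: dF_measurable simp: case_prod_unfold)
  qed
  show "eta t \<in> borel_measurable (\<F> t)"
  proof (cases rule: cases)
    case fin
    show ?thesis unfolding eta_def
    proof (rule hm[OF fin])
      fix z z' assume "z \<in> space N" "z' \<in> space N" "\<And>i. i < S t \<Longrightarrow> \<omega> i z = \<omega> i z'"
      then have "\<forall>k<t. dirsq k z = dirsq k z'" using finite_case_determined by blast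
      then show "e t (\<Sum>k<t. dirsq k z) = e t (\<Sum>k<t. dirsq k z')" by simp
    qed
  next
    case bor
    have "(\<lambda>z. \<Sum>k<t. dirsq k z) \<in> borel_measurable (\<F> t)"
      using adapted_borel(1)[OF bor] by (intro borel_measurable_sum) simp
    then show ?thesis unfolding eta_def by (rule measurable_compose[OF _ e_measurable])
  qed
  show "slope t \<in> borel_measurable (\<F> (Suc t))"
  proof (cases rule: cases)
    case fin
    show ?thesis
    proof (rule hm[OF fin])
      fix z z' assume zz: "z \<in> space N" "z' \<in> space N" "\<And>i. i < S (Suc t) \<Longrightarrow> \<omega> i z = \<omega> i z'"
      show "slope t z = slope t z'" using dir[OF zz] xt[OF zz] by (simp add: slope_def)
    qed
  next
    case bor
    show ?thesis unfolding slope_def by (rule dF_measurable[OF adapted_borel(2)[OF bor]])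
  qed
  show "dirsq t \<in> borel_measurable (\<F> (Suc t))"
  proof (cases rule: cases)
    case fin
    show ?thesis
    proof (rule hm[OF fin])
      fix z z' assume zz: "z \<in> space N" "z' \<in> space N" "\<And>i. i < S (Suc t) \<Longrightarrow> \<omega> i z = \<omega> i z'"
      show "dirsq t z = dirsq t z'" using dir[OF zz] xt[OF zz] by (simp add: dirsq_def)
    qed
  next
    case bor
    show ?thesis unfolding dirsq_def
      by (intro borel_measurable_power tangent_norm_measurable adapted_borel(2)[OF bor])
  qed
qed

text \<open>Read off as the \<open>w\<close>-integral of a jointly measurable function, which covers
  both alternatives at once.\<close>

lemma gradsq_measurable: "(\<lambda>z. gradsq (x t z)) \<in> borel_measurable (\<F> t)"
  using mu.borel_measurable_lebesgue_integral[OF derivative_measurable[of t]]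
  by (simp add: mean_derivative)

text \<open>Unbiasedness in weak form. Every sample of the batch has index at least
  \<open>S t\<close>, so each can be frozen against the history; averaging over the batch leaves the
  common value.\<close>

lemma mean_slope:
  assumes Y: "Y \<in> borel_measurable (\<F> t)" and D: "\<And>z. z \<in> space N \<Longrightarrow> \<bar>Y z\<bar> \<le> D"
  shows "N.expectation (\<lambda>z. Y z * slope t z) = N.expectation (\<lambda>z. Y z * gradsq (x t z))"
proof -
  let ?J = "{S t..<S (Suc t)}" and ?n = "real (S (Suc t) - S t)"
  let ?h = "\<lambda>z w. dF (x t z) (snd (H (x t z, w)))"
  let ?\<phi> = "\<lambda>(z, w). Y z * ?h z w"
  have \<phi>: "?\<phi> \<in> borel_measurable (\<F> t \<Otimes>\<^sub>M \<mu>)"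
    using borel_measurable_times[OF measurable_compose[OF measurable_fst Y] derivative_measurable[of t]]
    by (simp add: case_prod_unfold)
  have bound: "\<bar>Y z * ?h z w\<bar> \<le> D * A\<^sup>2" if "z \<in> space N" "w \<in> space \<mu>" for z w
    unfolding abs_mult
    using D[OF that(1)] derivative_bound[OF in_K[OF that(1)] H_bound[OF in_K[OF that(1)] that(2)]]
    by (intro mult_mono) auto
  have frozen: "N.expectation (\<lambda>z. Y z * ?h z (\<omega> j z)) = N.expectation (\<lambda>z. Y z * gradsq (x t z))"
    if "j \<in> ?J" for j
    using N.history_freezing[OF indep distr _ \<phi>, of j "D * A\<^sup>2"] that bound
    by (simp add: mean_derivative)
  have int: "integrable N (\<lambda>z. Y z * ?h z (\<omega> j z))" for j
  proof (rule N.integrable_bounded)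
    have "id \<in> N \<rightarrow>\<^sub>M \<F> t" using measurable_from_history[OF rv, of N "S t"] rv by simp
    then have "(\<lambda>z. (z, \<omega> j z)) \<in> N \<rightarrow>\<^sub>M \<F> t \<Otimes>\<^sub>M \<mu>" by (intro measurable_Pair rv) (simp add: id_def)
    from measurable_compose[OF this \<phi>] show "(\<lambda>z. Y z * ?h z (\<omega> j z)) \<in> borel_measurable N" by simp
    show "\<bar>Y z * ?h z (\<omega> j z)\<bar> \<le> D * A\<^sup>2" if "z \<in> space N" for z
      by (rule bound[OF that rv_space[OF that]])
  qed
  have "Y z * slope t z = 1 / ?n * (\<Sum>j\<in>?J. Y z * ?h z (\<omega> j z))" for z
    by (simp add: slope_def direction_def linear_scale[OF linear_dF] linear_sum[OF linear_dF] sum_distrib_left mult_ac)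
  then have "N.expectation (\<lambda>z. Y z * slope t z) = 1 / ?n * (\<Sum>j\<in>?J. N.expectation (\<lambda>z. Y z * ?h z (\<omega> j z)))"
    using int by simp
  also have "\<dots> = N.expectation (\<lambda>z. Y z * gradsq (x t z))"
    using S_Suc[of t] by (simp add: frozen)
  finally show ?thesis .
qed

section \<open>The martingale noise and the convergence of the iteration\<close>

definition noise :: "nat \<Rightarrow> 'z \<Rightarrow> real" where
  "noise t z = eta t z * (slope t z - gradsq (x t z))"

lemma gradsq_bound: "z \<in> space N \<Longrightarrow> \<bar>gradsq (x t z)\<bar> \<le> A\<^sup>2"
  using gradsq_le[OF in_K] gradient_norm_nonneg by simp

lemma noise_bound: "z \<in> space N \<Longrightarrow> \<bar>noise t z\<bar> \<le> 2 * A\<^sup>2"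
proof -
  assume z: "z \<in> space N"
  have "\<bar>slope t z - gradsq (x t z)\<bar> \<le> 2 * A\<^sup>2"
    using slope_bound[OF z, of t] gradsq_bound[OF z, of t] by linarith
  then have "\<bar>eta t z\<bar> * \<bar>slope t z - gradsq (x t z)\<bar> \<le> 1 * (2 * A\<^sup>2)"
    using eta_range[of t z] by (intro mult_mono) auto
  then show ?thesis by (simp add: noise_def abs_mult)
qed

lemma noise_measurable: "noise t \<in> borel_measurable (\<F> (Suc t))"
  unfolding noise_def
  by (intro borel_measurable_times borel_measurable_diff slope_measurable
      filtration_measurableD(2)[OF eta_measurable] filtration_measurableD(2)[OF gradsq_measurable])

text \<open>\<open>eta t\<close> is known before the batch of step \<open>t\<close>, so it is
  absorbed into the test function; this is where its independence of the current direction
  counts.\<close>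

lemma noise_orthogonal:
  assumes Y: "Y \<in> borel_measurable (\<F> t)" and D: "\<And>z. z \<in> space N \<Longrightarrow> \<bar>Y z\<bar> \<le> D"
  shows "N.expectation (\<lambda>z. Y z * noise t z) = 0"
proof -
  let ?Z = "\<lambda>z. Y z * eta t z"
  have Z: "?Z \<in> borel_measurable (\<F> t)" using Y eta_measurable by (intro borel_measurable_times)
  have Zb: "\<bar>?Z z\<bar> \<le> D" if "z \<in> space N" for z
    using mult_mono[OF D[OF that], of "\<bar>eta t z\<bar>" 1] eta_range[of t z] D[OF that] by (simp add: abs_mult)
  note m = filtration_measurableD(1)[OF Z] filtration_measurableD(1)[OF slope_measurable]
    filtration_measurableD(1)[OF gradsq_measurable]
  have i1: "integrable N (\<lambda>z. ?Z z * slope t z)"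
  proof (rule N.integrable_bounded)
    show "\<bar>?Z z * slope t z\<bar> \<le> D * A\<^sup>2" if "z \<in> space N" for z
      unfolding abs_mult[of "?Z z"] using Zb[OF that] slope_bound[OF that] by (intro mult_mono) auto
  qed (intro borel_measurable_times m)
  have i2: "integrable N (\<lambda>z. ?Z z * gradsq (x t z))"
  proof (rule N.integrable_bounded)
    show "\<bar>?Z z * gradsq (x t z)\<bar> \<le> D * A\<^sup>2" if "z \<in> space N" for z
      unfolding abs_mult[of "?Z z"] using Zb[OF that] gradsq_bound[OF that] by (intro mult_mono) auto
  qed (intro borel_measurable_times m)
  have "N.expectation (\<lambda>z. Y z * noise t z) = N.expectation (\<lambda>z. ?Z z * slope t z - ?Z z * gradsq (x t z))"
    by (simp add: noise_def algebra_simps)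
  also have "\<dots> = 0" using i1 i2 mean_slope[OF Z Zb] by simp
  finally show ?thesis .
qed

text \<open>Variance is at most second moment: testing the slope against \<open>?Y\<close> turns the
  cross term into minus twice the square of the mean part, and a nonpositive remainder is
  dropped.\<close>

lemma noise_second_moment:
  "N.expectation (\<lambda>z. (noise t z)\<^sup>2) \<le> N.expectation (\<lambda>z. A\<^sup>2 * ((eta t z)\<^sup>2 * dirsq t z))"
proof -
  let ?q = "\<lambda>z. gradsq (x t z)"
  note m = filtration_measurableD(1)[OF eta_measurable, measurable] filtration_measurableD(1)[OF slope_measurable, measurable]
    filtration_measurableD(1)[OF gradsq_measurable, measurable] filtration_measurableD(1)[OF dirsq_measurable, measurable]
  have e: "\<bar>(eta t z)\<^sup>2\<bar> \<le> 1" for z using eta_range[of t z] by (simp add: power_le_one)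
  have prod: "integrable N (\<lambda>z. (eta t z)\<^sup>2 * (u z * v z))"
    if [measurable]: "u \<in> borel_measurable N" "v \<in> borel_measurable N"
      and b: "\<And>z. z \<in> space N \<Longrightarrow> \<bar>u z\<bar> \<le> A\<^sup>2" "\<And>z. z \<in> space N \<Longrightarrow> \<bar>v z\<bar> \<le> A\<^sup>2" for u v
  proof (rule N.integrable_bounded)
    fix z assume z: "z \<in> space N"
    have "\<bar>u z\<bar> * \<bar>v z\<bar> \<le> A\<^sup>2 * A\<^sup>2" using b z by (intro mult_mono) auto
    then have "\<bar>(eta t z)\<^sup>2\<bar> * \<bar>u z * v z\<bar> \<le> 1 * (A\<^sup>2 * A\<^sup>2)" using e by (intro mult_mono) (auto simp: abs_mult)
    then show "\<bar>(eta t z)\<^sup>2 * (u z * v z)\<bar> \<le> A\<^sup>2 * A\<^sup>2" by (simp add: abs_mult)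
  qed measurable
  let ?Y = "\<lambda>z. (eta t z)\<^sup>2 * ?q z"
  have Y: "?Y \<in> borel_measurable (\<F> t)"
    by (intro borel_measurable_times borel_measurable_power eta_measurable gradsq_measurable)
  have Yb: "\<bar>?Y z\<bar> \<le> 1 * A\<^sup>2" if "z \<in> space N" for z
    unfolding abs_mult using e gradsq_bound[OF that] by (intro mult_mono) auto
  have i: "integrable N (\<lambda>z. (eta t z)\<^sup>2 * (slope t z * slope t z))"
    "integrable N (\<lambda>z. (eta t z)\<^sup>2 * (?q z * slope t z))"
    "integrable N (\<lambda>z. (eta t z)\<^sup>2 * (?q z * ?q z))"
    by (intro prod m slope_bound gradsq_bound; assumption)+
  have "N.expectation (\<lambda>z. (noise t z)\<^sup>2) = N.expectation (\<lambda>z. (eta t z)\<^sup>2 * (slope t z * slope t z)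
      - 2 * ((eta t z)\<^sup>2 * (?q z * slope t z)) + (eta t z)\<^sup>2 * (?q z * ?q z))"
    by (simp add: noise_def power2_eq_square algebra_simps)
  also have "\<dots> = N.expectation (\<lambda>z. (eta t z)\<^sup>2 * (slope t z * slope t z))
      - 2 * N.expectation (\<lambda>z. (eta t z)\<^sup>2 * (?q z * slope t z)) + N.expectation (\<lambda>z. (eta t z)\<^sup>2 * (?q z * ?q z))"
    using i by simp
  also have "N.expectation (\<lambda>z. (eta t z)\<^sup>2 * (?q z * slope t z)) = N.expectation (\<lambda>z. (eta t z)\<^sup>2 * (?q z * ?q z))"
    using mean_slope[OF Y Yb] by (simp add: mult.assoc)
  also have "N.expectation (\<lambda>z. (eta t z)\<^sup>2 * (slope t z * slope t z))
      - 2 * N.expectation (\<lambda>z. (eta t z)\<^sup>2 * (?q z * ?q z)) + N.expectation (\<lambda>z. (eta t z)\<^sup>2 * (?q z * ?q z))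
      \<le> N.expectation (\<lambda>z. (eta t z)\<^sup>2 * (slope t z * slope t z))"
  proof -
    have "0 \<le> N.expectation (\<lambda>z. (eta t z)\<^sup>2 * (?q z * ?q z))"
      by (rule Bochner_Integration.integral_nonneg) simp
    then show ?thesis by simp
  qed
  also have "\<dots> \<le> N.expectation (\<lambda>z. A\<^sup>2 * ((eta t z)\<^sup>2 * dirsq t z))"
  proof (rule integral_mono[OF i(1)])
    show "integrable N (\<lambda>z. A\<^sup>2 * ((eta t z)\<^sup>2 * dirsq t z))"
    proof (rule N.integrable_bounded)
      show "\<bar>A\<^sup>2 * ((eta t z)\<^sup>2 * dirsq t z)\<bar> \<le> A\<^sup>2 * (1 * A\<^sup>2)" if "z \<in> space N" for z
        unfolding abs_mult[of "A\<^sup>2"] abs_mult[of "(eta t z)\<^sup>2"]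
        using e dirsq_bound(1)[OF that, of t] dirsq_bound(2)[of t z] by (intro mult_mono) auto
    qed measurable
    fix z assume "z \<in> space N"
    from mult_left_mono[OF slope_power2_le[OF this, of t], of "(eta t z)\<^sup>2"]
    show "(eta t z)\<^sup>2 * (slope t z * slope t z) \<le> A\<^sup>2 * ((eta t z)\<^sup>2 * dirsq t z)"
      by (simp add: power2_eq_square mult_ac)
  qed
  finally show ?thesis .
qed

lemma noise_summable: "AE z in N. summable (\<lambda>t. noise t z)"
proof (rule N.martingale_differences_summable[where \<F> = \<F> and b = "\<lambda>_. 2 * A\<^sup>2" and C = "A\<^sup>2 * B"])
  fix n
  note [measurable] = filtration_measurableD(1)[OF eta_measurable] filtration_measurableD(1)[OF dirsq_measurable]
  have int: "integrable N (\<lambda>z. A\<^sup>2 * ((eta t z)\<^sup>2 * dirsq t z))" for t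
  proof (rule N.integrable_bounded)
    have e: "\<bar>(eta t z)\<^sup>2\<bar> \<le> 1" for z using eta_range[of t z] by (simp add: power_le_one)
    show "\<bar>A\<^sup>2 * ((eta t z)\<^sup>2 * dirsq t z)\<bar> \<le> A\<^sup>2 * (1 * A\<^sup>2)" if "z \<in> space N" for z
      unfolding abs_mult[of "A\<^sup>2"] abs_mult[of "(eta t z)\<^sup>2"]
      using e dirsq_bound(1)[OF that, of t] dirsq_bound(2)[of t z] by (intro mult_mono) auto
  qed measurable
  have "(\<Sum>t<n. N.expectation (\<lambda>z. (noise t z)\<^sup>2)) \<le> (\<Sum>t<n. N.expectation (\<lambda>z. A\<^sup>2 * ((eta t z)\<^sup>2 * dirsq t z)))"
    by (intro sum_mono noise_second_moment)
  also have "\<dots> = N.expectation (\<lambda>z. \<Sum>t<n. A\<^sup>2 * ((eta t z)\<^sup>2 * dirsq t z))"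
    using int by simp
  \<comment> \<open>The bound \<open>B\<close> holds on every path, so it bounds the expectation as
    well.\<close>
  also have "\<dots> \<le> N.expectation (\<lambda>z. A\<^sup>2 * B)"
    by (rule integral_mono)
      (use int steps_summable in \<open>auto simp: sum_distrib_left[symmetric] eta_def intro!: mult_left_mono\<close>)
  finally show "(\<Sum>t<n. N.expectation (\<lambda>z. (noise t z)\<^sup>2)) \<le> A\<^sup>2 * B" by (simp add: N.prob_space)
qed (auto simp: filtration noise_measurable noise_bound intro: noise_orthogonal dest: subsetD[OF filtration(2)] subsetD[OF filtration(3)])

text \<open>Randomness is exhausted by the summability of the noise; the rest is deterministic on
  the given path.\<close>

lemma pointwise_convergence:
  assumes z: "z \<in> space N" and noise: "summable (\<lambda>t. noise t z)"
  shows "convergent (\<lambda>t. F (x t z))" and "(\<lambda>t. gradsq (x t z)) \<longlonglongrightarrow> 0"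
proof -
  define u where "u t = - (eta t z *\<^sub>R direction t z)" for t
  have nu2: "(tangent_norm g (x t z) (u t))\<^sup>2 = (eta t z)\<^sup>2 * dirsq t z" for t
    using tangent_norm_scale[of "x t z" "- eta t z" "direction t z"]
    by (simp add: u_def dirsq_def power_mult_distrib)
  have nu: "tangent_norm g (x t z) (u t) = eta t z * tangent_norm g (x t z) (direction t z)" for t
    using tangent_norm_scale[of "x t z" "- eta t z" "direction t z"] eta_range(1)[of t z]
    by (simp add: u_def)
  have nuA: "tangent_norm g (x t z) (u t) \<le> A * eta t z" for t
    using mult_left_mono[OF direction_norm_le[OF z], of "eta t z" t] eta_range(1)[of t z] by (simp add: nu mult.commute)
  have xS: "x (Suc t) z = R (x t z, u t)" for t
    using step[OF z] by (simp add: u_def eta_def)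
  define err where "err t = F (x (Suc t) z) - F (x t z) + eta t z * slope t z" for t
  obtain C where C: "C > 0" "\<And>y v. y \<in> K \<Longrightarrow> tangent_norm g y v \<le> A \<Longrightarrow>
      tangent_norm g y (tangent_adjoint g y (R (y, v)) (fibre_differential \<A> R y v) (grad (R (y, v))) - grad y)
      \<le> C * tangent_norm g y v"
    using grad_Lipschitz unfolding R_Lipschitz_on_def by blast
  have err: "norm (err t) \<le> C * ((eta t z)\<^sup>2 * dirsq t z)" for t
  proof -
    have "tangent_norm g (x t z) (u t) \<le> A"
      using order_trans[OF nuA mult_left_mono[OF eta_range(2) less_imp_le[OF A_pos]]] by simp
    from descent_estimate[OF C(2) in_K[OF z] this]
    have "\<bar>F (x (Suc t) z) - F (x t z) - dF (x t z) (u t)\<bar> \<le> C * ((eta t z)\<^sup>2 * dirsq t z)"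
      by (simp add: xS nu2)
    moreover have "dF (x t z) (u t) = - (eta t z * slope t z)"
      by (simp add: u_def slope_def linear_neg[OF linear_dF] linear_scale[OF linear_dF])
    ultimately show ?thesis by (simp add: err_def)
  qed
  have sq: "summable (\<lambda>t. (eta t z)\<^sup>2 * dirsq t z)"
    by (rule summableI_nonneg_bounded[of _ B])
      (use steps_summable[OF z] dirsq_bound(2) in \<open>auto simp: eta_def\<close>)
  have serr: "summable err"
    by (rule summable_comparison_test'[OF summable_mult[OF sq] err])
  have tele: "F (x n z) = F (x 0 z) + (\<Sum>t<n. err t) - (\<Sum>t<n. noise t z) - (\<Sum>t<n. eta t z * gradsq (x t z))" for n
    by (induction n) (simp_all add: err_def noise_def algebra_simps)
  have "bounded (F ` K)"
    by (intro compact_imp_bounded compact_continuous_image continuous_on_subset[OF continuous_F] K_compact) auto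
  then obtain b where b: "\<And>y. y \<in> K \<Longrightarrow> \<bar>F y\<bar> \<le> b" unfolding bounded_real by auto
  obtain b1 where b1: "\<And>n. norm (\<Sum>t<n. err t) \<le> b1"
    using convergent_imp_Bseq[OF summable_iff_convergent[THEN iffD1, OF serr]] unfolding Bseq_def by blast
  obtain b2 where b2: "\<And>n. norm (\<Sum>t<n. noise t z) \<le> b2"
    using convergent_imp_Bseq[OF summable_iff_convergent[THEN iffD1, OF noise]] unfolding Bseq_def by blast
  have sg: "summable (\<lambda>t. eta t z * gradsq (x t z))"
  proof (rule summableI_nonneg_bounded)
    show "0 \<le> eta t z * gradsq (x t z)" for t
      using eta_range(1)[of t z] gradient_norm_nonneg by (simp add: less_imp_le)
    \<comment> \<open>\<open>tele\<close> is solved for this sum: two values of \<open>F\<close> on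
      \<open>K\<close> cost \<open>2 * b\<close>, the two convergent series cost \<open>b1\<close>
      and \<open>b2\<close>.\<close>
    show "(\<Sum>t<n. eta t z * gradsq (x t z)) \<le> 2 * b + b1 + b2" for n
      using tele[of n] b[OF in_K[OF z], of 0] b[OF in_K[OF z], of n] b1[of n] b2[of n]
      unfolding real_norm_def by linarith
  qed
  have "convergent (\<lambda>n. F (x 0 z) + (\<Sum>t<n. err t) - (\<Sum>t<n. noise t z) - (\<Sum>t<n. eta t z * gradsq (x t z)))"
    using serr noise sg unfolding summable_iff_convergent
    by (intro convergent_diff convergent_add convergent_const)
  then show "convergent (\<lambda>t. F (x t z))" by (simp only: tele[symmetric])
  have "(\<lambda>t. sqrt ((tangent_norm g (x t z) (u t))\<^sup>2)) \<longlonglongrightarrow> sqrt 0"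
    unfolding nu2 by (intro tendsto_real_sqrt summable_LIMSEQ_zero[OF sq])
  then have null: "(\<lambda>t. tangent_norm g (x t z) (u t)) \<longlonglongrightarrow> 0"
    by (simp add: tangent_norm_nonneg)
  show "(\<lambda>t. gradsq (x t z)) \<longlonglongrightarrow> 0"
    by (rule gradient_vanishes[where x = "\<lambda>t. x t z", OF K_compact in_K[OF z] xS nuA _ null _ sg])
      (use A_pos eta_range(1) steps_diverge[OF z] in \<open>auto simp: eta_def intro: less_imp_le\<close>)
qed

lemma almost_sure_convergence:
  "AE z in N. convergent (\<lambda>t. F (x t z))"
  "AE z in N. (\<lambda>t. tangent_norm g (x t z) (grad (x t z))) \<longlonglongrightarrow> 0"
proof -
  show "AE z in N. convergent (\<lambda>t. F (x t z))"
    using noise_summable by (rule AE_mp) (auto intro!: AE_I2 pointwise_convergence(1))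
  have "tangent_norm g y (grad y) = sqrt (gradsq y)" for y
    by (simp add: gradient_norm[symmetric] tangent_norm_nonneg)
  then have "(\<lambda>t. tangent_norm g (x t z) (grad (x t z))) \<longlonglongrightarrow> 0"
    if "z \<in> space N" "summable (\<lambda>t. noise t z)" for z
    using tendsto_real_sqrt[OF pointwise_convergence(2)[OF that]] by simp
  then show "AE z in N. (\<lambda>t. tangent_norm g (x t z) (grad (x t z))) \<longlonglongrightarrow> 0"
    using noise_summable by (rule_tac AE_mp) (auto intro!: AE_I2)
qed

text \<open>The uniform bound \<open>A\<^sup>2\<close> on \<open>K\<close> is an integrable
  majorant, so almost sure convergence passes to the mean.\<close>

lemma mean_square_convergence:
  "integrable N (\<lambda>z. (tangent_norm g (x t z) (grad (x t z)))\<^sup>2)"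
  "(\<lambda>t. \<integral>z. (tangent_norm g (x t z) (grad (x t z)))\<^sup>2 \<partial>N) \<longlonglongrightarrow> 0"
proof -
  note m = filtration_measurableD(1)[OF gradsq_measurable]
  show "integrable N (\<lambda>z. (tangent_norm g (x t z) (grad (x t z)))\<^sup>2)"
    unfolding gradient_norm by (rule N.integrable_bounded[OF m gradsq_bound])
  have "(\<lambda>t. \<integral>z. gradsq (x t z) \<partial>N) \<longlonglongrightarrow> (\<integral>z. 0 \<partial>N)"
  proof (rule integral_dominated_convergence[where w = "\<lambda>_. A\<^sup>2"])
    show "AE z in N. (\<lambda>t. gradsq (x t z)) \<longlonglongrightarrow> 0"
      using noise_summable by (rule AE_mp) (auto intro!: AE_I2 pointwise_convergence(2))
  qed (use m gradsq_bound in \<open>auto intro!: AE_I2\<close>)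
  then show "(\<lambda>t. \<integral>z. (tangent_norm g (x t z) (grad (x t z)))\<^sup>2 \<partial>N) \<longlonglongrightarrow> 0"
    by (simp add: gradient_norm)
qed

end

section \<open>Step sizes\<close>

text \<open>Comparison with the integral of \<open>s powr - (1 + p)\<close>, a bounded increment being absorbed in the constant.\<close>

lemma adaptive_step_term_le:
  fixes a \<beta> M s p :: real
  assumes \<beta>: "\<beta> > 0" and p: "p > 0" and s: "s \<ge> \<beta>" and a: "0 \<le> a" "a \<le> M"
  shows "a * s powr - (1 + p) \<le>
    (1 + M / \<beta>) powr (1 + p) / p * (s powr - p - (s + a) powr - p)"
proof (cases "a = 0")
  case False
  define q where "q = 1 + p"
  define k where "k = 1 + M / \<beta>"
  have a0: "a > 0" using False a by simp
  have s0: "s > 0" using s \<beta> by simp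
  have k: "k > 0" unfolding k_def using a \<beta> by (intro add_pos_nonneg) auto
  have "\<exists>\<xi>>s. \<xi> < s + a \<and> (s + a) powr - p - s powr - p = (s + a - s) * (- p * \<xi> powr (- p - 1))"
    by (rule MVT2) (use a0 s0 in \<open>auto intro!: derivative_eq_intros\<close>)
  moreover have "- p - 1 = - q" by (simp add: q_def)
  ultimately obtain \<xi> where \<xi>: "\<xi> > s" "\<xi> < s + a"
    "(s + a) powr - p - s powr - p = a * (- p * \<xi> powr - q)" by auto
  \<comment> \<open>Since \<open>s \<ge> \<beta>\<close>, an increment of at most \<open>M\<close>
    enlarges \<open>s\<close> by at most the factor \<open>k\<close>, so the intermediate point may
    be exchanged for \<open>s\<close> at the price \<open>k powr q\<close>.\<close>
  have "M \<le> s * (M / \<beta>)" using mult_right_mono[OF s, of "M / \<beta>"] \<beta> a by simp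
  then have "\<xi> \<le> s * k" using \<xi>(2) a by (simp add: k_def distrib_left)
  then have "(s * k) powr - q \<le> \<xi> powr - q"
    by (intro powr_mono2') (use p \<xi> s0 in \<open>auto simp: q_def\<close>)
  then have "s powr - q * k powr - q \<le> \<xi> powr - q"
    using powr_mult[of s k "- q"] by simp
  then have "s powr - q * k powr - q * k powr q \<le> \<xi> powr - q * k powr q"
    by (rule mult_right_mono) simp
  moreover have "k powr - q * k powr q = 1"
    using powr_add[of k "- q" q] k by simp
  ultimately have "s powr - q \<le> \<xi> powr - q * k powr q"
    by (simp only: mult.assoc mult_1_right)
  then have "a * s powr - q \<le> a * (\<xi> powr - q * k powr q)"
    using a(1) by (rule mult_left_mono)
  also have "\<dots> = k powr q / p * (s powr - p - (s + a) powr - p)"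
  proof -
    have "s powr - p - (s + a) powr - p = p * (a * \<xi> powr - q)"
    proof -
      have "a * (- p * \<xi> powr - q) = - (p * (a * \<xi> powr - q))" by simp
      then show ?thesis using \<xi>(3) by linarith
    qed
    then show ?thesis using p by simp
  qed
  finally show ?thesis by (simp only: k_def q_def)
qed simp

text \<open>Squaring raises the exponent \<open>1 / 2 + \<epsilon>\<close> to
  \<open>1 + 2 * \<epsilon>\<close>, above the critical value 1, so the terms are dominated by
  telescoping differences of \<open>s t powr - (2 * \<epsilon>)\<close>, of which only the first
  value survives.\<close>

lemma adaptive_steps_bounded:
  fixes b :: "nat \<Rightarrow> real" and \<alpha> \<beta> \<epsilon> M :: real
  assumes \<beta>: "\<beta> > 0" and \<epsilon>: "\<epsilon> > 0" and b: "\<And>t. 0 \<le> b t" "\<And>t. b t \<le> M"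
  shows "(\<Sum>t<n. (\<alpha> / (\<beta> + (\<Sum>k<t. b k)) powr (1 / 2 + \<epsilon>))\<^sup>2 * b t)
    \<le> \<alpha>\<^sup>2 * ((1 + M / \<beta>) powr (1 + 2 * \<epsilon>) / (2 * \<epsilon>) * \<beta> powr - (2 * \<epsilon>))"
proof -
  define s where "s t = \<beta> + (\<Sum>k<t. b k)" for t
  let ?c = "(1 + M / \<beta>) powr (1 + 2 * \<epsilon>) / (2 * \<epsilon>)"
  have e2: "2 * \<epsilon> > 0" using \<epsilon> by simp
  have s: "s t \<ge> \<beta>" for t using b by (simp add: s_def sum_nonneg)
  then have s0: "s t > 0" for t using \<beta> less_le_trans by blast
  have "(\<alpha> / s t powr (1 / 2 + \<epsilon>))\<^sup>2 * b t = \<alpha>\<^sup>2 * (b t * s t powr - (1 + 2 * \<epsilon>))" for t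
  proof -
    have "(s t powr (1 / 2 + \<epsilon>))\<^sup>2 = s t powr (1 + 2 * \<epsilon>)"
      using powr_add[of "s t" "1 / 2 + \<epsilon>" "1 / 2 + \<epsilon>"] by (simp add: power2_eq_square)
    then show ?thesis
      unfolding powr_minus power_divide by (simp only: divide_inverse mult_ac)
  qed
  then have "(\<Sum>t<n. (\<alpha> / s t powr (1 / 2 + \<epsilon>))\<^sup>2 * b t) = \<alpha>\<^sup>2 * (\<Sum>t<n. b t * s t powr - (1 + 2 * \<epsilon>))"
    by (simp only: sum_distrib_left)
  also have "\<dots> \<le> \<alpha>\<^sup>2 * (\<Sum>t<n. ?c * (s t powr - (2 * \<epsilon>) - s (Suc t) powr - (2 * \<epsilon>)))"
  proof (intro mult_left_mono sum_mono)
    fix t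
    show "b t * s t powr - (1 + 2 * \<epsilon>) \<le> ?c * (s t powr - (2 * \<epsilon>) - s (Suc t) powr - (2 * \<epsilon>))"
      using adaptive_step_term_le[OF \<beta> e2 s b, of t t] by (simp only: s_def add.assoc sum.lessThan_Suc)
  qed simp
  also have "\<dots> = \<alpha>\<^sup>2 * (?c * (s 0 powr - (2 * \<epsilon>) - s n powr - (2 * \<epsilon>)))"
    using sum_lessThan_telescope'[of "\<lambda>t. s t powr - (2 * \<epsilon>)" n] sum_distrib_left[of ?c _ "{..<n}"] by metis
  also have "\<dots> \<le> \<alpha>\<^sup>2 * (?c * \<beta> powr - (2 * \<epsilon>))"
  proof (intro mult_left_mono)
    show "s 0 powr - (2 * \<epsilon>) - s n powr - (2 * \<epsilon>) \<le> \<beta> powr - (2 * \<epsilon>)" by (simp add: s_def)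
  qed (use \<epsilon> in auto)
  finally show ?thesis by (simp only: s_def)
qed

text \<open>Bounded increments make the accumulated sum grow at most linearly, and an exponent of at
  most 1 preserves this, so the harmonic series is a minorant.\<close>

lemma adaptive_steps_diverge:
  fixes b :: "nat \<Rightarrow> real" and \<alpha> \<beta> p M :: real
  assumes \<alpha>: "\<alpha> > 0" and \<beta>: "\<beta> > 0" and p: "0 < p" "p \<le> 1" and b: "\<And>t. 0 \<le> b t" "\<And>t. b t \<le> M"
  shows "filterlim (\<lambda>n. \<Sum>t<n. \<alpha> / (\<beta> + (\<Sum>k<t. b k)) powr p) at_top sequentially"
proof -
  let ?c = "1 + \<beta> + M"
  have M: "M \<ge> 0" using b[of 0] by simp
  have le: "\<alpha> / ?c * inverse (of_nat (Suc t)) \<le> \<alpha> / (\<beta> + (\<Sum>k<t. b k)) powr p" for t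
  proof -
    have s: "0 \<le> (\<Sum>k<t. b k)" "(\<Sum>k<t. b k) \<le> real t * M"
      using b sum_bounded_above[of "{..<t}" b M] by (auto intro: sum_nonneg)
    \<comment> \<open>Adding 1 lifts the base to at least 1, where raising the exponent from
      \<open>p\<close> to 1 can only increase the power.\<close>
    have "(\<beta> + (\<Sum>k<t. b k)) powr p \<le> (1 + \<beta> + (\<Sum>k<t. b k)) powr p"
      using s \<beta> p by (intro powr_mono2) auto
    also have "\<dots> \<le> (1 + \<beta> + (\<Sum>k<t. b k)) powr 1"
      using s \<beta> p by (intro powr_mono) auto
    also have "\<dots> \<le> 1 + \<beta> + real t * M" using s \<beta> by simp
    also have "\<dots> \<le> ?c * real (Suc t)" using M \<beta> by (simp add: algebra_simps)
    finally have "\<alpha> / (?c * real (Suc t)) \<le> \<alpha> / (\<beta> + (\<Sum>k<t. b k)) powr p"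
      using \<alpha> s \<beta> M by (intro divide_left_mono mult_pos_pos) auto
    then show ?thesis by (simp add: divide_inverse)
  qed
  have "filterlim (\<lambda>n. \<alpha> / ?c * harm n) at_top sequentially"
    using \<alpha> \<beta> M by (intro filterlim_tendsto_pos_mult_at_top[OF tendsto_const _ harm_at_top]) auto
  moreover have "\<alpha> / ?c * harm n \<le> (\<Sum>t<n. \<alpha> / (\<beta> + (\<Sum>k<t. b k)) powr p)" for n
  proof -
    have "harm n = (\<Sum>t<n. inverse (of_nat (Suc t)) :: real)"
      by (induction n) (simp_all only: harm_Suc harm_expand(1) sum.lessThan_Suc lessThan_0 sum.empty)
    then have "\<alpha> / ?c * harm n = (\<Sum>t<n. \<alpha> / ?c * inverse (of_nat (Suc t)))"
      by (simp only: sum_distrib_left)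
    also have "\<dots> \<le> (\<Sum>t<n. \<alpha> / (\<beta> + (\<Sum>k<t. b k)) powr p)" by (intro sum_mono le)
    finally show ?thesis .
  qed
  ultimately show ?thesis by (rule filterlim_at_top_mono[OF _ always_eventually[OF allI]])
qed

theorem corollary2p7:
  fixes \<A> :: "('m::{t2_space, second_countable_topology}, 'e::findim_inner) chart set"
    and g :: "'m \<Rightarrow> 'e \<Rightarrow> 'e \<Rightarrow> real"
    and R :: "'m \<times> 'e \<Rightarrow> 'm"
    and F :: "'m \<Rightarrow> real"
    and K :: "'m set"
    and A :: real
    and \<mu> :: "'w measure"
    and H :: "'m \<times> 'w \<Rightarrow> 'm \<times> 'e"
    and N :: "'z measure"
    and \<omega> :: "nat \<Rightarrow> 'z \<Rightarrow> 'w"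
    and S :: "nat \<Rightarrow> nat"
  assumes manifold: "riemannian_manifold \<A> g"
    and connected: "connected (UNIV :: 'm set)"
    and retraction: "manifold_retraction \<A> R"
    and F_C1: "Ck_map 1 \<A> vector_space_atlas F"
    and K_compact: "compact K"
    and A_pos: "A > 0"
    and grad_Lipschitz: "R_Lipschitz_on \<A> g R (riemannian_gradient \<A> g F) K A"
    and prob_mu: "prob_space \<mu>"
    and H_field: "\<And>w x. w \<in> space \<mu> \<Longrightarrow> fst (H (x, w)) = x"
    and H_meas: "(finite (space \<mu>) \<and> sets \<mu> = Pow (space \<mu>)) \<or>
                 H \<in> (borel \<Otimes>\<^sub>M \<mu>) \<rightarrow>\<^sub>M tangent_borel \<A>"
    and H_mean: "\<And>x. has_bochner_integral \<mu> (\<lambda>w. snd (H (x, w))) (riemannian_gradient \<A> g F x)"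
    and H_bound: "\<And>x w. x \<in> K \<Longrightarrow> w \<in> space \<mu> \<Longrightarrow> tangent_norm g x (snd (H (x, w))) \<le> A"
    and prob_N: "prob_space N"
    and indep: "prob_space.indep_vars N (\<lambda>_. \<mu>) \<omega> UNIV"
    and distr: "\<And>t. distr N \<mu> (\<omega> t) = \<mu>"
    and S_mono: "strict_mono S"
    and S_0: "S 0 = 0"
  shows
    "(\<forall>(\<gamma> :: nat \<Rightarrow> real) (x0 :: 'm) (x :: nat \<Rightarrow> 'z \<Rightarrow> 'm).
        (\<forall>t. 0 < \<gamma> t) \<longrightarrow>
        summable (\<lambda>t. (\<gamma> t)\<^sup>2) \<longrightarrow>
        filterlim (\<lambda>n. \<Sum>t<n. \<gamma> t) at_top sequentially \<longrightarrow>
        (\<forall>t. \<gamma> t \<le> 1) \<longrightarrow>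
        x0 \<in> K \<longrightarrow>
        (\<forall>z\<in>space N. x 0 z = x0) \<longrightarrow>
        (\<forall>z\<in>space N. \<forall>t. x (Suc t) z =
           R (x t z, - (\<gamma> t / real (S (Suc t) - S t)) *\<^sub>R
                       (\<Sum>j\<in>{S t..<S (Suc t)}. snd (H (x t z, \<omega> j z))))) \<longrightarrow>
        (\<forall>z\<in>space N. \<forall>t. x t z \<in> K) \<longrightarrow>
        (AE z in N. convergent (\<lambda>t. F (x t z))) \<and>
        (AE z in N. (\<lambda>t. tangent_norm g (x t z) (riemannian_gradient \<A> g F (x t z))) \<longlonglongrightarrow> 0) \<and>
        (\<forall>t. integrable N (\<lambda>z. (tangent_norm g (x t z) (riemannian_gradient \<A> g F (x t z)))\<^sup>2)) \<and>
        (\<lambda>t. \<integral>z. (tangent_norm g (x t z) (riemannian_gradient \<A> g F (x t z)))\<^sup>2 \<partial>N) \<longlonglongrightarrow> 0)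
     \<and>
     (\<forall>(\<alpha> :: real) (\<beta> :: real) (\<epsilon> :: real) (x0 :: 'm) (x :: nat \<Rightarrow> 'z \<Rightarrow> 'm)
        (\<eta> :: nat \<Rightarrow> 'z \<Rightarrow> real).
        0 < \<beta> \<longrightarrow>
        0 < \<epsilon> \<longrightarrow> \<epsilon> \<le> 1 / 2 \<longrightarrow>
        0 < \<alpha> \<longrightarrow> \<alpha> \<le> \<beta> powr (1 / 2 + \<epsilon>) \<longrightarrow>
        x0 \<in> K \<longrightarrow>
        (\<forall>z\<in>space N. x 0 z = x0) \<longrightarrow>
        (\<forall>z\<in>space N. \<forall>t. x (Suc t) z =
           R (x t z, - (\<eta> t z / real (S (Suc t) - S t)) *\<^sub>R
                       (\<Sum>j\<in>{S t..<S (Suc t)}. snd (H (x t z, \<omega> j z))))) \<longrightarrow>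
        (\<forall>z\<in>space N. \<forall>t. \<eta> t z = \<alpha> /
           (\<beta> + (\<Sum>k<t. (tangent_norm g (x k z)
                           ((1 / real (S (Suc k) - S k)) *\<^sub>R
                            (\<Sum>j\<in>{S k..<S (Suc k)}. snd (H (x k z, \<omega> j z)))))\<^sup>2))
           powr (1 / 2 + \<epsilon>)) \<longrightarrow>
        (\<forall>z\<in>space N. \<forall>t. x t z \<in> K) \<longrightarrow>
        (AE z in N. convergent (\<lambda>t. F (x t z))) \<and>
        (AE z in N. (\<lambda>t. tangent_norm g (x t z) (riemannian_gradient \<A> g F (x t z))) \<longlonglongrightarrow> 0))"
proof -
  have data: "stochastic_gradient \<A> g R F K A \<mu> H N \<omega> S x0 x"
    if "\<forall>z\<in>space N. x 0 z = x0" "\<forall>z\<in>space N. \<forall>t. x t z \<in> K" for x :: "nat \<Rightarrow> 'z \<Rightarrow> 'm" and x0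
  proof (intro stochastic_gradient.intro retraction_objective.intro stochastic_gradient_axioms.intro
      retraction_objective_axioms.intro)
    show "x 0 z = x0" if "z \<in> space N" for z
      using that \<open>\<forall>z\<in>space N. x 0 z = x0\<close> by (rule bspec[rotated])
    show "x t z \<in> K" if "z \<in> space N" for z t
      using spec[OF bspec[OF \<open>\<forall>z\<in>space N. \<forall>t. x t z \<in> K\<close> that], of t] .
  qed (fact manifold retraction F_C1 K_compact A_pos grad_Lipschitz prob_mu H_field H_meas H_mean H_bound
      prob_N indep distr S_mono)+
  have part1: "(AE z in N. convergent (\<lambda>t. F (x t z))) \<and>
      (AE z in N. (\<lambda>t. tangent_norm g (x t z) (riemannian_gradient \<A> g F (x t z))) \<longlonglongrightarrow> 0) \<and>
      (\<forall>t. integrable N (\<lambda>z. (tangent_norm g (x t z) (riemannian_gradient \<A> g F (x t z)))\<^sup>2)) \<and>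
      (\<lambda>t. \<integral>z. (tangent_norm g (x t z) (riemannian_gradient \<A> g F (x t z)))\<^sup>2 \<partial>N) \<longlonglongrightarrow> 0"
    if \<gamma>: "\<forall>t. 0 < \<gamma> t" "summable (\<lambda>t. (\<gamma> t)\<^sup>2)"
        "filterlim (\<lambda>n. \<Sum>t<n. \<gamma> t) at_top sequentially" "\<forall>t. \<gamma> t \<le> 1"
      and x: "\<forall>z\<in>space N. x 0 z = x0"
        "\<forall>z\<in>space N. \<forall>t. x (Suc t) z =
           R (x t z, - (\<gamma> t / real (S (Suc t) - S t)) *\<^sub>R
                       (\<Sum>j\<in>{S t..<S (Suc t)}. snd (H (x t z, \<omega> j z))))"
        "\<forall>z\<in>space N. \<forall>t. x t z \<in> K"
    for \<gamma> :: "nat \<Rightarrow> real" and x0 :: 'm and x :: "nat \<Rightarrow> 'z \<Rightarrow> 'm"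
  proof -
    interpret SG: stochastic_gradient \<A> g R F K A \<mu> H N \<omega> S x0 x by (rule data[OF x(1,3)])
    \<comment> \<open>Prescribed steps ignore the accumulated norm; the pathwise bound uses that
      each \<open>dirsq\<close> is at most \<open>A\<^sup>2\<close>.\<close>
    interpret adaptive_stochastic_gradient \<A> g R F K A \<mu> H N \<omega> S x0 x "\<lambda>t _. \<gamma> t" "A\<^sup>2 * (\<Sum>t. (\<gamma> t)\<^sup>2)"
    proof unfold_locales
      fix z n assume z: "z \<in> space N"
      show "x (Suc n) z = R (x n z, - (\<gamma> n *\<^sub>R SG.direction n z))"
        using x(2) z by (simp add: SG.direction_def)
      have "(\<Sum>t<n. (\<gamma> t)\<^sup>2 * SG.dirsq t z) \<le> (\<Sum>t<n. (\<gamma> t)\<^sup>2 * A\<^sup>2)"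
        by (intro sum_mono mult_left_mono SG.dirsq_bound z) simp
      also have "\<dots> = A\<^sup>2 * (\<Sum>t<n. (\<gamma> t)\<^sup>2)" by (simp add: sum_distrib_left mult.commute)
      also have "\<dots> \<le> A\<^sup>2 * (\<Sum>t. (\<gamma> t)\<^sup>2)"
        by (intro mult_left_mono sum_le_suminf \<gamma>(2)) auto
      finally show "(\<Sum>t<n. (\<gamma> t)\<^sup>2 * SG.dirsq t z) \<le> A\<^sup>2 * (\<Sum>t. (\<gamma> t)\<^sup>2)" .
    qed (use \<gamma> in auto)
    show ?thesis using almost_sure_convergence mean_square_convergence by blast
  qed
  have part2: "(AE z in N. convergent (\<lambda>t. F (x t z))) \<and>
      (AE z in N. (\<lambda>t. tangent_norm g (x t z) (riemannian_gradient \<A> g F (x t z))) \<longlonglongrightarrow> 0)"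
    if par: "0 < \<beta>" "0 < \<epsilon>" "\<epsilon> \<le> 1 / 2" "0 < \<alpha>" "\<alpha> \<le> \<beta> powr (1 / 2 + \<epsilon>)"
      and x: "\<forall>z\<in>space N. x 0 z = x0"
        "\<forall>z\<in>space N. \<forall>t. x (Suc t) z =
           R (x t z, - (\<eta> t z / real (S (Suc t) - S t)) *\<^sub>R
                       (\<Sum>j\<in>{S t..<S (Suc t)}. snd (H (x t z, \<omega> j z))))"
      and eta: "\<forall>z\<in>space N. \<forall>t. \<eta> t z = \<alpha> /
           (\<beta> + (\<Sum>k<t. (tangent_norm g (x k z)
                           ((1 / real (S (Suc k) - S k)) *\<^sub>R
                            (\<Sum>j\<in>{S k..<S (Suc k)}. snd (H (x k z, \<omega> j z)))))\<^sup>2))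
           powr (1 / 2 + \<epsilon>)"
      and xK: "\<forall>z\<in>space N. \<forall>t. x t z \<in> K"
    for \<alpha> \<beta> \<epsilon> :: real and x0 :: 'm and x :: "nat \<Rightarrow> 'z \<Rightarrow> 'm" and \<eta> :: "nat \<Rightarrow> 'z \<Rightarrow> real"
  proof -
    interpret SG: stochastic_gradient \<A> g R F K A \<mu> H N \<omega> S x0 x by (rule data[OF x(1) xK])
    let ?e = "\<lambda>(t :: nat) s. \<alpha> / (\<beta> + s) powr (1 / 2 + \<epsilon>)"
    \<comment> \<open>The first denominator is the smallest, so the hypothesis on
      \<open>\<alpha>\<close> and \<open>\<beta>\<close> bounds all step sizes by 1.\<close>
    have pw: "\<beta> powr (1 / 2 + \<epsilon>) \<le> (\<beta> + s) powr (1 / 2 + \<epsilon>)" if "s \<ge> 0" for s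
      using that par by (intro powr_mono2) auto
    interpret adaptive_stochastic_gradient \<A> g R F K A \<mu> H N \<omega> S x0 x ?e
      "\<alpha>\<^sup>2 * ((1 + A\<^sup>2 / \<beta>) powr (1 + 2 * \<epsilon>) / (2 * \<epsilon>) * \<beta> powr - (2 * \<epsilon>))"
    proof unfold_locales
      fix z n assume z: "z \<in> space N"
      have "\<eta> n z = ?e n (\<Sum>k<n. SG.dirsq k z)"
        using eta z by (simp add: SG.dirsq_def SG.direction_def)
      then show "x (Suc n) z = R (x n z, - (?e n (\<Sum>k<n. SG.dirsq k z) *\<^sub>R SG.direction n z))"
        using x(2) z by (simp add: SG.direction_def)
      show "(\<Sum>t<n. (?e t (\<Sum>k<t. SG.dirsq k z))\<^sup>2 * SG.dirsq t z) \<le>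
          \<alpha>\<^sup>2 * ((1 + A\<^sup>2 / \<beta>) powr (1 + 2 * \<epsilon>) / (2 * \<epsilon>) * \<beta> powr - (2 * \<epsilon>))"
        by (rule adaptive_steps_bounded[OF par(1,2) SG.dirsq_bound(2) SG.dirsq_bound(1)[OF z]])
    next
      fix z assume z: "z \<in> space N"
      \<comment> \<open>The exponent \<open>1 / 2 + \<epsilon>\<close> is at most 1 because
        \<open>\<epsilon> \<le> 1 / 2\<close>.\<close>
      show "filterlim (\<lambda>n. \<Sum>t<n. ?e t (\<Sum>k<t. SG.dirsq k z)) at_top sequentially"
        by (rule adaptive_steps_diverge[OF par(4,1) _ _ SG.dirsq_bound(2) SG.dirsq_bound(1)[OF z]])
          (use par in auto)
    next
      fix s :: real assume s: "s \<ge> 0"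
      have "\<beta> + s > 0" using s par by simp
      then show "0 < \<alpha> / (\<beta> + s) powr (1 / 2 + \<epsilon>)" using par by simp
      show "\<alpha> / (\<beta> + s) powr (1 / 2 + \<epsilon>) \<le> 1"
        using order_trans[OF par(5) pw[OF s]] \<open>\<beta> + s > 0\<close> by simp
    qed measurable
    show ?thesis using almost_sure_convergence by blast
  qed
  show ?thesis
    by (intro conjI[of "\<forall>\<gamma>. P \<gamma>" "\<forall>\<alpha>. Q \<alpha>" for P Q] allI impI) (rule part1 part2; assumption)+
qed

end
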